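(* For every $d,c\in\mathbb{Z}\setminus\{0\}$ there exist two ergodic measure preserving transformations $T,S$ of a standard probability space $(X,\mathcal{X},\mu)$, with $h_\mu(X,T)=h_\mu(X,S)=0$, and $A\in\mathcal{X}$ with $\mu(A)>0$, such that the averages $$\frac{1}{N}\sum_{n=0}^{N-1}\left(1_A\circ T^{cn}\right)\left(1_A\circ S^{dn}\right)$$ do not converge in $L^2(\mu)$ as $N\to\infty$.
   Context: $h_\mu(X,T)$ denotes the measure-theoretic (Kolmogorov–Sinai) entropy of $T$ with respect to $\mu$. $T$ and $S$ are not assumed to commute; they are invertible, so that negative iterates make sense. *)

theory Defs
  imports "HOL-Probability.Probability"
begin

text \<open>A standard probability space is a standard Borel space (the Borel sigma-algebra of a Polish
  topology on the carrier) with a probability measure on it. Every Polish space embeds in the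
  space of real sequences, so up to isomorphism every standard probability space is carried by a
  subset of the type \<open>nat \<Rightarrow> real\<close>.\<close>

definition standard_prob_space :: "'a measure \<Rightarrow> bool" where
  "standard_prob_space M \<longleftrightarrow> prob_space M \<and>
     (\<exists>X. completely_metrizable_space X \<and> second_countable X \<and> topspace X = space M \<and>
          sets M = sigma_sets (topspace X) {U. openin X U})"

definition invertible_mpt :: "'a measure \<Rightarrow> ('a \<Rightarrow> 'a) \<Rightarrow> bool" where
  "invertible_mpt M T \<longleftrightarrow>
     bij_betw T (space M) (space M) \<and> T \<in> M \<rightarrow>\<^sub>M M \<and> inv_into (space M) T \<in> M \<rightarrow>\<^sub>M M \<and>
     (\<forall>A\<in>sets M. emeasure M (T -` A \<inter> space M) = emeasure M A)"

definition ergodic_mpt :: "'a measure \<Rightarrow> ('a \<Rightarrow> 'a) \<Rightarrow> bool" where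
  "ergodic_mpt M T \<longleftrightarrow> invertible_mpt M T \<and>
     (\<forall>A\<in>sets M. T -` A \<inter> space M = A \<longrightarrow> measure M A = 0 \<or> measure M A = 1)"

text \<open>The inverse is taken on the carrier; outside the carrier the value is immaterial.\<close>

definition int_iterate :: "'a measure \<Rightarrow> ('a \<Rightarrow> 'a) \<Rightarrow> int \<Rightarrow> 'a \<Rightarrow> 'a" where
  "int_iterate M T k =
     (if 0 \<le> k then T ^^ nat k else inv_into (space M) T ^^ nat (- k))"

definition finite_partition :: "'a measure \<Rightarrow> 'a set set \<Rightarrow> bool" where
  "finite_partition M P \<longleftrightarrow> finite P \<and> P \<subseteq> sets M \<and> partition_on (space M) P"

text \<open>Since \<open>ln 0 = 0\<close>, null cells contribute nothing, in accordance with \<open>0 log 0 = 0\<close>.\<close>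

definition partition_entropy :: "'a measure \<Rightarrow> 'a set set \<Rightarrow> real" where
  "partition_entropy M P = - (\<Sum>p\<in>P. measure M p * ln (measure M p))"

text \<open>The nonempty cells of the join of the partitions \<open>T\<^sup>-\<^sup>i P\<close> for \<open>i < n\<close>: the cell with
  itinerary \<open>p\<close> consists of the points \<open>x\<close> with \<open>T\<^sup>i x \<in> p i\<close> for all \<open>i < n\<close>.\<close>

definition iterated_join :: "'a measure \<Rightarrow> ('a \<Rightarrow> 'a) \<Rightarrow> 'a set set \<Rightarrow> nat \<Rightarrow> 'a set set" where
  "iterated_join M T P n =
     {space M \<inter> (\<Inter>i<n. (T ^^ i) -` p i) | p. \<forall>i<n. p i \<in> P} - {{}}"

definition partition_ks_entropy :: "'a measure \<Rightarrow> ('a \<Rightarrow> 'a) \<Rightarrow> 'a set set \<Rightarrow> real" where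
  "partition_ks_entropy M T P =
     lim (\<lambda>n. partition_entropy M (iterated_join M T P n) / real n)"

definition ks_entropy :: "'a measure \<Rightarrow> ('a \<Rightarrow> 'a) \<Rightarrow> ereal" where
  "ks_entropy M T = (SUP P\<in>{P. finite_partition M P}. ereal (partition_ks_entropy M T P))"

text \<open>Meant for sequences of square-integrable functions \<open>F N\<close>, since the Bochner integral of a
  non-integrable function is 0.\<close>

definition converges_in_L2 :: "'a measure \<Rightarrow> (nat \<Rightarrow> 'a \<Rightarrow> real) \<Rightarrow> bool" where
  "converges_in_L2 M F \<longleftrightarrow>
     (\<exists>f\<in>borel_measurable M. integrable M (\<lambda>x. (f x)\<^sup>2) \<and>
        (\<lambda>N. \<integral>x. (F N x - f x)\<^sup>2 \<partial>M) \<longlonglongrightarrow> 0)"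

definition double_average ::
  "'a measure \<Rightarrow> ('a \<Rightarrow> 'a) \<Rightarrow> ('a \<Rightarrow> 'a) \<Rightarrow> int \<Rightarrow> int \<Rightarrow> 'a set \<Rightarrow> nat \<Rightarrow> 'a \<Rightarrow> real" where
  "double_average M T S c d A N x =
     (1 / real N) * (\<Sum>n<N. indicator A (int_iterate M T (c * int n) x) *
                            indicator A (int_iterate M S (d * int n) x))"

end

theory Submission
  imports Defs "HOL-Number_Theory.Cong"
begin

text \<open>
  Let \<open>m = c * d\<close>. On the product of the two-point fibre with cyclic groups of pairwise coprime orders
  \<open>P 0, P 1, \<dots>\<close> that grow very fast, consider the integer action \<open>R\<close> that rotates all cyclic coordinates
  and adds to the fibre coordinate \<open>y\<close> the number of levels \<open>i\<close> with \<open>S i (x i + n) \<noteq> S i (x i)\<close> modulo 2,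
  where \<open>S i\<close> is a slowly varying two-valued pattern. Let \<open>\<phi>\<close> be a measure preserving involution that acts on each
  cyclic coordinate separately, \<open>x i \<mapsto> x i + z i (x i)\<close>. Put \<open>T = R\<^sup>d\<close> and \<open>S = \<phi> R\<^sup>c \<phi>\<close>. Then
  \<open>T\<^sup>c\<^sup>n = R\<^sup>m\<^sup>n\<close> and \<open>S\<^sup>d\<^sup>n = \<phi> R\<^sup>m\<^sup>n \<phi>\<close>, so different \<open>c\<close> and \<open>d\<close> cause no trouble, and for \<open>A = {y = 0}\<close> the integral of
  the \<open>n\<close>-th term is half the probability that the fibre turns equally often, modulo 2, from \<open>x\<close> and from
  \<open>\<phi> x\<close> in \<open>m * n\<close> steps (\<open>prob_joint_return\<close>).

  Level \<open>i\<close> contributes to the difference of these turns if exactly one of \<open>S i (x i)\<close> and \<open>S i (x' i)\<close>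
  changes, where \<open>x' = \<phi> x\<close>. For times short compared to the slowness of \<open>S i\<close> neither changes. For
  a typical time beyond \<open>P i\<close> exactly one does, provided that \<open>z i\<close> is chosen such that \<open>S i\<close> differs at \<open>x i\<close> and
  \<open>x' i\<close> for most points, whereas after a typical time the two values agree. Both demands are compatible,
  because the displacement may depend on the point (\<open>swap_pattern_exists\<close>): take for \<open>S i\<close> an exclusive or of
  many square waves in independent coordinates and move one coordinate that happens to be close to
  a jump of its wave; there almost always is one. Therefore, at \<open>N = P 0 * \<dots> * P (k - 1)\<close>, the turns differ by \<open>k\<close>
  modulo 2 for most \<open>n < N\<close> and most points, and the integrals of the averages alternate between values
  near 1/2 and near 0 (\<open>integral_double_average_at_period\<close>).

  The powers of \<open>R\<close> along the products of the periods tend to the identity, so \<open>T\<close> and \<open>S\<close> are rigid, and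
  rigid transformations have zero entropy (\<open>ks_entropy_rigid\<close>). Other powers tend to the flip of the fibre. So an
  invariant set is invariant under the flip, and it meets all base cylinders of the same length in the
  same proportion because these are permuted transitively. This gives ergodicity (\<open>ergodic_rot\<close>).
\<close>

section \<open>Densities of periodic predicates\<close>

definition dens :: "int \<Rightarrow> (int \<Rightarrow> bool) \<Rightarrow> real" where
  "dens P F = real (card {x\<in>{0..<P}. F x}) / real_of_int P"

text \<open>Functions on a finite cyclic group are handled as functions of an integer that depend only on its
residue. In this way functions of period \<open>P\<close> and of period \<open>l\<close> are both functions of period \<open>P * l\<close>
without any conversion.\<close>

definition periodic :: "int \<Rightarrow> (int \<Rightarrow> 'a) \<Rightarrow> bool" where
  "periodic P f \<longleftrightarrow> (\<forall>x. f (x mod P) = f x)"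

lemma periodic_cong:
  assumes "periodic P f" "[x = y] (mod P)"
  shows "f x = f y"
  using assms unfolding periodic_def cong_def by metis

lemma periodicI:
  assumes "\<And>x y. [x = y] (mod P) \<Longrightarrow> f x = f y"
  shows "periodic P f"
  unfolding periodic_def by (intro allI assms) (simp add: cong_def)

lemma dens_mono:
  assumes "P > 0" "\<And>x. F x \<Longrightarrow> G x"
  shows "dens P F \<le> dens P G"
proof -
  have "card {x\<in>{0..<P}. F x} \<le> card {x\<in>{0..<P}. G x}"
    by (rule card_mono[OF finite_subset[of _ "{0..<P}"]]) (use assms in auto)
  then show ?thesis using assms(1) by (simp add: dens_def divide_right_mono)
qed

lemma dens_disj:
  assumes "P > 0"
  shows "dens P (\<lambda>x. F x \<or> G x) \<le> dens P F + dens P G"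
proof -
  have "{x\<in>{0..<P}. F x \<or> G x} = {x\<in>{0..<P}. F x} \<union> {x\<in>{0..<P}. G x}" by auto
  then have "card {x\<in>{0..<P}. F x \<or> G x} \<le> card {x\<in>{0..<P}. F x} + card {x\<in>{0..<P}. G x}"
    by (simp add: card_Un_le)
  then have "real (card {x\<in>{0..<P}. F x \<or> G x})
      \<le> real (card {x\<in>{0..<P}. F x}) + real (card {x\<in>{0..<P}. G x})" by linarith
  then show ?thesis using assms by (simp add: dens_def divide_right_mono flip: add_divide_distrib)
qed

lemma dens_nonneg: "P > 0 \<Longrightarrow> 0 \<le> dens P F"
  by (simp add: dens_def)

lemma dens_le_1: "P > 0 \<Longrightarrow> dens P F \<le> 1"
proof -
  assume P: "P > 0"
  have "card {x\<in>{0..<P}. F x} \<le> card {0..<P}" by (intro card_mono) auto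
  then show ?thesis using P by (simp add: dens_def divide_le_eq_1)
qed

lemma affine_bij_betw:
  assumes "P > 0" "coprime m P"
  shows "bij_betw (\<lambda>x. (m * x + n) mod P) {0..<P} {0..<P::int}"
proof -
  have "inj_on (\<lambda>x. (m * x + n) mod P) {0..<P}"
  proof (rule inj_onI)
    fix x y assume xy: "x \<in> {0..<P}" "y \<in> {0..<P}" "(m * x + n) mod P = (m * y + n) mod P"
    then have "[m * x + n = m * y + n] (mod P)" by (simp add: cong_def)
    then have "[m * x = m * y] (mod P)" by (simp add: cong_add_rcancel)
    then have "[x = y] (mod P)" using assms by (simp add: cong_mult_lcancel)
    with xy show "x = y" by (simp add: cong_def)
  qed
  moreover have "(\<lambda>x. (m * x + n) mod P) ` {0..<P} \<subseteq> {0..<P}" using assms by auto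
  ultimately show ?thesis
    by (simp add: bij_betw_def endo_inj_surj)
qed

lemma card_reindex_bij:
  assumes "bij_betw f A A"
  shows "card {x\<in>A. F (f x)} = card {x\<in>A. F x}"
proof -
  have "bij_betw f {x\<in>A. F (f x)} {x\<in>A. F x}"
    using assms unfolding bij_betw_def inj_on_def by auto
  then show ?thesis by (rule bij_betw_same_card)
qed

lemma dens_affine:
  assumes "P > 0" "coprime m P" "periodic P F"
  shows "dens P (\<lambda>x. F (m * x + n)) = dens P F"
proof -
  have "{x\<in>{0..<P}. F (m * x + n)} = {x\<in>{0..<P}. F ((m * x + n) mod P)}"
    using assms(3) by (auto simp: periodic_def)
  then show ?thesis
    using card_reindex_bij[OF affine_bij_betw[OF assms(1,2)], of F n] by (simp add: dens_def)
qed

lemma dens_shift: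
  assumes "P > 0" "periodic P F"
  shows "dens P (\<lambda>x. F (x + n)) = dens P F"
  using dens_affine[of P 1 F n] assms by simp

text \<open>By the Chinese remainder theorem the residues modulo coprime numbers are independent.\<close>

lemma dens_prod:
  assumes "P > 0" "l > 0" "coprime P l" "periodic P F" "periodic l G"
  shows "dens (P * l) (\<lambda>x. F x \<and> G x) = dens P F * dens l G"
proof -
  let ?f = "\<lambda>x::int. (x mod P, x mod l)"
  have inj: "inj_on ?f {0..<P * l}"
  proof (rule inj_onI)
    fix x y assume xy: "x \<in> {0..<P*l}" "y \<in> {0..<P*l}" "?f x = ?f y"
    then have "[x = y] (mod P * l)" using assms(3) by (intro coprime_cong_mult) (auto simp: cong_def)
    with xy show "x = y" by (simp add: cong_def)
  qed
  have sub: "?f ` {0..<P * l} \<subseteq> {0..<P} \<times> {0..<l}" using assms by auto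
  have "card (?f ` {0..<P * l}) = card ({0..<P} \<times> {0..<l})"
    using inj assms by (simp add: card_image nat_mult_distrib card_cartesian_product)
  then have im: "?f ` {0..<P * l} = {0..<P} \<times> {0..<l}"
    using sub by (intro card_subset_eq) auto
  have "?f ` {x\<in>{0..<P * l}. F x \<and> G x} = {x\<in>{0..<P}. F x} \<times> {x\<in>{0..<l}. G x}"
  proof (intro equalityI subsetI)
    fix p assume "p \<in> ?f ` {x\<in>{0..<P * l}. F x \<and> G x}"
    then obtain x where "F x" "G x" "p = ?f x" by auto
    then show "p \<in> {x\<in>{0..<P}. F x} \<times> {x\<in>{0..<l}. G x}"
      using assms by (simp add: periodic_def)
  next
    fix p assume p: "p \<in> {x\<in>{0..<P}. F x} \<times> {x\<in>{0..<l}. G x}"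
    then have "p \<in> ?f ` {0..<P * l}" using im by auto
    then obtain x where x: "x \<in> {0..<P*l}" "p = ?f x" by auto
    with p have "F (x mod P)" "G (x mod l)" by auto
    then have "F x" "G x" using assms by (auto simp: periodic_def)
    with x show "p \<in> ?f ` {x\<in>{0..<P * l}. F x \<and> G x}" by auto
  qed
  moreover have "inj_on ?f {x\<in>{0..<P * l}. F x \<and> G x}"
    using inj by (rule inj_on_subset) auto
  ultimately have "card {x\<in>{0..<P * l}. F x \<and> G x} = card {x\<in>{0..<P}. F x} * card {x\<in>{0..<l}. G x}"
    by (simp add: card_cartesian_product flip: card_image)
  then show ?thesis by (simp add: dens_def)
qed

lemma dens_True: "P > 0 \<Longrightarrow> dens P (\<lambda>_. True) = 1"
proof -
  assume "P > 0"
  moreover have "{x\<in>{0..<P}. True} = {0..<P}" by auto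
  ultimately show ?thesis unfolding dens_def by (simp del: atLeastLessThan_iff)
qed

lemma dens_lift:
  assumes "P > 0" "l > 0" "coprime P l" "periodic P F"
  shows "dens (P * l) F = dens P F" "dens (l * P) F = dens P F"
proof -
  have "periodic l (\<lambda>_. True)" by (simp add: periodic_def)
  then show "dens (P * l) F = dens P F" using dens_prod[OF assms, of "\<lambda>_. True"] assms(2) by (simp add: dens_True)
  then show "dens (l * P) F = dens P F" by (simp add: mult.commute)
qed

lemma periodic_change:
  assumes "periodic P S" shows "periodic P (\<lambda>x. S (x + n) \<noteq> S (x + k))"
    "periodic P (\<lambda>x. S (x + n) = S (x + k))"
proof -
  have *: "S (x + i) = S (y + i)" if "[x = y] (mod P)" for x y i
    by (rule periodic_cong[OF assms cong_add[OF that cong_refl]])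
  show "periodic P (\<lambda>x. S (x + n) \<noteq> S (x + k))" "periodic P (\<lambda>x. S (x + n) = S (x + k))"
    by (rule periodicI, simp only: *)+
qed

text \<open>A change over \<open>n\<close> steps needs a change in one of them.\<close>

lemma dens_change_le:
  fixes S :: "int \<Rightarrow> 'a"
  assumes "P > 0" "periodic P S"
  shows "dens P (\<lambda>x. S (x + n) \<noteq> S x) \<le> real_of_int \<bar>n\<bar> * dens P (\<lambda>x. S (x + 1) \<noteq> S x)"
proof -
  have pos: "dens P (\<lambda>x. S (x + int k) \<noteq> S x) \<le> real k * dens P (\<lambda>x. S (x + 1) \<noteq> S x)" for k :: nat
  proof (induction k)
    case 0
    then show ?case by (simp add: dens_def)
  next
    case (Suc k)
    have "dens P (\<lambda>x. S (x + int (Suc k)) \<noteq> S x)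
        \<le> dens P (\<lambda>x. S (x + int k) \<noteq> S x \<or> S ((x + int k) + 1) \<noteq> S (x + int k))"
      by (rule dens_mono[OF assms(1)]) (auto simp: algebra_simps)
    also have "\<dots> \<le> dens P (\<lambda>x. S (x + int k) \<noteq> S x) + dens P (\<lambda>x. S ((x + int k) + 1) \<noteq> S (x + int k))"
      by (rule dens_disj[OF assms(1)])
    also have "dens P (\<lambda>x. S ((x + int k) + 1) \<noteq> S (x + int k)) = dens P (\<lambda>x. S (x + 1) \<noteq> S x)"
      using dens_shift[OF assms(1) periodic_change(1)[OF assms(2), of 1 0], of "int k"] by simp
    finally show ?case using Suc by (simp add: algebra_simps)
  qed
  show ?thesis
  proof (cases "n \<ge> 0")
    case True
    then show ?thesis using pos[of "nat n"] by simp
  next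
    case False
    have "dens P (\<lambda>x. S (x + n) \<noteq> S x) = dens P (\<lambda>x. S (x + - n) \<noteq> S x)"
      using dens_shift[OF assms(1) periodic_change(1)[OF assms(2), of 0 "-n"], of n]
      by (auto simp: eq_commute)
    then show ?thesis using False pos[of "nat (- n)"] by simp
  qed
qed

text \<open>Fubini for two cyclic variables: a bound that is uniform in one variable survives averaging over it.\<close>

lemma sum_dens_le:
  assumes "P > 0" "N > 0" and le: "\<And>v. dens N (\<lambda>n. F n v) \<le> \<epsilon>"
  shows "(\<Sum>n\<in>{0..<N}. dens P (F n)) \<le> real_of_int N * \<epsilon>"
proof -
  have card_sum: "real (card {v\<in>{0..<Q}. G v}) = (\<Sum>v\<in>{0..<Q}. of_bool (G v))" for Q :: int and G
    by (simp add: of_bool_def sum.If_cases Int_def)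
  have "(\<Sum>n\<in>{0..<N}. dens P (F n)) = (\<Sum>v\<in>{0..<P}. \<Sum>n\<in>{0..<N}. of_bool (F n v)) / P"
    unfolding dens_def card_sum sum_divide_distrib[symmetric] by (subst sum.swap) simp
  also have "\<dots> = (\<Sum>v\<in>{0..<P}. N * dens N (\<lambda>n. F n v)) / P"
    unfolding dens_def card_sum using assms(2) by simp
  also have "\<dots> \<le> (\<Sum>v\<in>{0..<P}. N * \<epsilon>) / P"
    using le assms by (intro divide_right_mono sum_mono mult_left_mono) auto
  also have "\<dots> = N * \<epsilon>" using assms by simp
  finally show ?thesis .
qed


section \<open>Patterns whose values almost all points can swap\<close>

text \<open>The building block is a square wave of period \<open>l\<close>, jumping at \<open>h\<close>. The swap exchanges the windows of
width \<open>a\<close> on both sides of the jump and is recorded by its displacement, which is 0 off the windows.\<close>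

definition wave :: "int \<Rightarrow> int \<Rightarrow> int \<Rightarrow> bool" where
  "wave l h x \<longleftrightarrow> x mod l < h"

definition jump_swap :: "int \<Rightarrow> int \<Rightarrow> int \<Rightarrow> int \<Rightarrow> int" where
  "jump_swap l h a x =
     (if h - a \<le> x mod l \<and> x mod l < h then a else if h \<le> x mod l \<and> x mod l < h + a then - a else 0)"

lemma periodic_wave: "periodic l (wave l h)" "periodic l (jump_swap l h a)"
  unfolding periodic_def wave_def jump_swap_def by simp_all

lemma jump_swap:
  assumes "0 < a" "a \<le> h" "h + a < l"
  shows "jump_swap l h a (x + jump_swap l h a x) = - jump_swap l h a x"
    and "jump_swap l h a x \<noteq> 0 \<Longrightarrow> wave l h (x + jump_swap l h a x) \<noteq> wave l h x"
proof -
  define r where "r = x mod l"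
  have "l > 0" using assms by linarith
  then have r: "0 \<le> r" "r < l" by (simp_all add: r_def)
  have "(x + a) mod l = (r + a) mod l" by (simp add: r_def mod_add_left_eq)
  then have a: "(x + a) mod l = r + a" if "r < h"
    using that assms r by (simp add: mod_pos_pos_trivial)
  have "(x + - a) mod l = (r - a) mod l"
    by (metis r_def mod_diff_left_eq add_uminus_conv_diff)
  then have b: "(x + - a) mod l = r - a" if "h \<le> r"
    using that assms r by (simp add: mod_pos_pos_trivial)
  show "jump_swap l h a (x + jump_swap l h a x) = - jump_swap l h a x"
    using assms r a b by (auto simp: jump_swap_def r_def[symmetric])
  show "jump_swap l h a x \<noteq> 0 \<Longrightarrow> wave l h (x + jump_swap l h a x) \<noteq> wave l h x"
    using assms r a b by (auto simp: jump_swap_def wave_def r_def[symmetric] split: if_splits)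
qed

lemma dens_wave_change:
  assumes "0 < h" "h < l"
  shows "dens l (\<lambda>x. wave l h (x + 1) \<noteq> wave l h x) \<le> 2 / real_of_int l"
proof -
  have "{x\<in>{0..<l}. wave l h (x + 1) \<noteq> wave l h x} \<subseteq> {h - 1, l - 1}"
  proof
    fix x assume x: "x \<in> {x\<in>{0..<l}. wave l h (x + 1) \<noteq> wave l h x}"
    show "x \<in> {h - 1, l - 1}"
    proof (cases "x = l - 1")
      case False
      then have "(x + 1) mod l = x + 1" "x mod l = x" using x by auto
      then show ?thesis using x by (auto simp: wave_def)
    qed simp
  qed
  then have "card {x\<in>{0..<l}. wave l h (x + 1) \<noteq> wave l h x} \<le> card {h - 1, l - 1}"
    by (rule card_mono[rotated]) simp
  also have "\<dots> \<le> 2" by (simp add: card_insert_if)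
  finally show ?thesis using assms by (simp add: dens_def divide_right_mono)
qed

text \<open>With \<open>l = 2 * h + 1\<close> the halves differ in length by one, so shifting by \<open>h\<close> inverts the wave except at
one residue. An odd \<open>l\<close> is what allows periods coprime to any prescribed number.\<close>

lemma dens_wave_half:
  assumes "0 < h" "l = 2 * h + 1"
  shows "dens l (\<lambda>x. wave l h (x + h) = wave l h x) \<le> 1 / real_of_int l"
proof -
  have "{x\<in>{0..<l}. wave l h (x + h) = wave l h x} \<subseteq> {h}"
  proof
    fix x assume x: "x \<in> {x\<in>{0..<l}. wave l h (x + h) = wave l h x}"
    have "(x + h) mod l = x + h - l" if "x > h"
    proof -
      have "(x + h) mod l = (x + h - l) mod l" by simp
      also have "\<dots> = x + h - l" using that x assms by (intro mod_pos_pos_trivial) auto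
      finally show ?thesis .
    qed
    moreover have "(x + h) mod l = x + h" if "x < h"
      using that x assms by (intro mod_pos_pos_trivial) auto
    ultimately show "x \<in> {h}"
      using x assms by (cases "x < h"; cases "x > h") (auto simp: wave_def)
  qed
  then have "card {x\<in>{0..<l}. wave l h (x + h) = wave l h x} \<le> card {h}"
    by (rule card_mono[rotated]) simp
  then show ?thesis using assms by (simp add: dens_def divide_right_mono)
qed

lemma dens_jump_swap_zero:
  assumes "0 < a" "a \<le> h" "h + a < l"
  shows "dens l (\<lambda>x. jump_swap l h a x = 0) = 1 - 2 * real_of_int a / real_of_int l"
proof -
  have "{x\<in>{0..<l}. jump_swap l h a x = 0} = {0..<l} - {h - a..<h + a}"
    using assms by (auto simp: jump_swap_def)
  then have "card {x\<in>{0..<l}. jump_swap l h a x = 0} = card {0..<l} - card {h - a..<h + a}"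
    using assms by (simp add: card_Diff_subset)
  then show ?thesis using assms by (simp add: dens_def of_nat_diff field_simps)
qed

text \<open>A pattern \<open>S\<close> on the cyclic group of order \<open>P\<close> with the involution \<open>v \<mapsto> v + z v\<close> of that group. What the
construction needs is a pattern for which this involution changes the value of \<open>S\<close> at almost every
\<open>v\<close>, although each single displacement \<open>z v\<close>, applied to all points at once, changes \<open>S\<close> almost
nowhere.\<close>

definition swap_pattern :: "int \<Rightarrow> (int \<Rightarrow> bool) \<Rightarrow> (int \<Rightarrow> int) \<Rightarrow> bool" where
  "swap_pattern P S z \<longleftrightarrow> P > 0 \<and> periodic P S \<and> periodic P z \<and> (\<forall>x. z (x + z x) = - z x)"

text \<open>One more coprime factor \<open>l\<close> carries a new square wave \<open>s\<close>, and the new pattern is the exclusive or of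
the old one and \<open>s\<close>. Where the new coordinate lies in a window around the jump, only this coordinate
is moved, which flips \<open>s\<close> and leaves the old factor alone; elsewhere the old displacement is applied to
the old coordinate. Either way a single displacement moves only one coordinate, so it is as invisible
as before: a shift by \<open>a\<close> changes \<open>s\<close> at \<open>2 * a\<close> of the \<open>l = 2 * D * a + 1\<close> residues, a proportion
below \<open>1 / D\<close>. The points whose value is not changed shrink by the
factor \<open>1 - 2 / (3 * D)\<close>, since they must avoid the windows and be bad in the independent old factor.\<close>

lemma swap_pattern_extend:
  fixes D :: nat
  assumes sp: "swap_pattern P S z" and "coprime P Q" "Q > 0" "D > 0" "\<kappa> > 0"
    and slow: "dens P (\<lambda>x. S (x + 1) \<noteq> S x) \<le> \<kappa> / 2"
    and corr: "\<And>x. dens P (\<lambda>n. S (n + z x) \<noteq> S n) \<le> 1 / real D"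
  obtains P' S' z' n0 where "swap_pattern P' S' z'" "coprime P' Q"
    "dens P' (\<lambda>x. S' (x + 1) \<noteq> S' x) \<le> \<kappa>"
    "\<And>x. dens P' (\<lambda>n. S' (n + z' x) \<noteq> S' n) \<le> 1 / real D"
    "dens P' (\<lambda>x. S' (x + z' x) = S' x) \<le> (1 - 2 / (3 * real D)) * dens P (\<lambda>x. S (x + z x) = S x)"
    "dens P' (\<lambda>x. S' (x + n0) = S' x) \<le> \<kappa>"
proof -
  have P: "P > 0" and perS: "periodic P S" and perz: "periodic P z" and inv: "z (x + z x) = - z x" for x
    using sp by (auto simp: swap_pattern_def)
  \<comment> \<open>the new wave has to be long for slowness, and \<open>l\<close> has to be 1 modulo \<open>P * Q\<close>\<close>
  define t where "t = \<lceil>4 / \<kappa>\<rceil>"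
  have t: "t > 0" "4 / \<kappa> \<le> t" using \<open>\<kappa> > 0\<close> by (auto simp: t_def)
  define a where "a = P * Q * t"
  have a: "a > 0" "t \<le> a"
  proof -
    show "a > 0" using P \<open>Q > 0\<close> t by (simp add: a_def)
    have "1 * t \<le> (P * Q) * t" using P \<open>Q > 0\<close> t by (intro mult_right_mono) (auto simp: int_one_le_iff_zero_less)
    then show "t \<le> a" by (simp add: a_def)
  qed
  define h where "h = int D * a"
  define l where "l = 2 * h + 1"
  have "1 * a \<le> h" unfolding h_def using \<open>D > 0\<close> a by (intro mult_right_mono) auto
  then have ah: "a \<le> h" "0 < h" "h + a < l" "h < l" "l > 0" using a by (auto simp: l_def)
  have "4 / \<kappa> \<le> l" using t a ah by linarith
  then have kl: "4 / real_of_int l \<le> \<kappa>" using \<open>\<kappa> > 0\<close> ah by (simp add: field_simps)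
  have cop: "coprime l k" if k: "k dvd P * Q" for k
  proof -
    obtain v where v: "P * Q = k * v" using k by (auto elim: dvdE)
    have "l = k * (2 * int D * t * v) + 1" using v by (simp add: l_def h_def a_def algebra_simps)
    then show ?thesis
      by (metis coprimeI dvd_add_right_iff dvd_mult2)
  qed
  have lP: "coprime P l" and lQ: "coprime l Q" using cop[of P] cop[of Q] by (auto simp: coprime_commute)
  \<comment> \<open>multiples of \<open>e\<close> move only the new coordinate, multiples of \<open>1 - e\<close> only the old one\<close>
  obtain e where e: "[e = 0] (mod P)" "[e = 1] (mod l)"
    using binary_chinese_remainder_int[OF lP, of 0 1] by auto
  define s where "s = wave l h"
  define w where "w = jump_swap l h a"
  have pers: "periodic l s" and perw: "periodic l w" by (auto simp: s_def w_def periodic_wave)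
  define S' where "S' x = (S x \<noteq> s x)" for x
  define z' where "z' x = (if w x \<noteq> 0 then e * w x else (1 - e) * z x)" for x
  have eP: "[x + e * k = x] (mod P)" "[x + (1 - e) * k = x + k] (mod P)" for x k
    using cong_add[OF cong_refl cong_mult[OF e(1) cong_refl], of x k]
      cong_add[OF cong_refl cong_mult[OF cong_diff[OF cong_refl e(1)] cong_refl], of x 1 k] by auto
  have el: "[x + e * k = x + k] (mod l)" "[x + (1 - e) * k = x] (mod l)" for x k
    using cong_add[OF cong_refl cong_mult[OF e(2) cong_refl], of x k]
      cong_add[OF cong_refl cong_mult[OF cong_diff[OF cong_refl e(2)] cong_refl], of x 1 k] by auto
  note PS = periodic_cong[OF perS] and Pz = periodic_cong[OF perz]
    and Ps = periodic_cong[OF pers] and Pw = periodic_cong[OF perw]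
  have wprops: "w (x + w x) = - w x" "w x \<noteq> 0 \<Longrightarrow> s (x + w x) \<noteq> s x" for x
    using jump_swap[OF a(1) ah(1,3), of x] by (auto simp: w_def s_def)
  have modP: "[x = y] (mod P)" "[x = y] (mod l)" if "[x = y] (mod P * l)" for x y
    using that cong_modulus_mult[of x y P l] cong_modulus_mult[of x y l P] by (auto simp: mult.commute)
  have Pl: "P * l > 0" using P ah by simp
  have pat: "swap_pattern (P * l) S' z'"
    unfolding swap_pattern_def
  proof (intro conjI allI)
    show "periodic (P * l) S'" "periodic (P * l) z'"
      by (rule periodicI, metis S'_def PS Ps modP) (rule periodicI, metis z'_def Pz Pw modP)
    fix x show "z' (x + z' x) = - z' x"
    proof (cases "w x = 0")
      case True
      then have "z' x = (1 - e) * z x" by (simp add: z'_def)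
      moreover have "w (x + (1 - e) * z x) = 0" using Pw[OF el(2), of x "z x"] True by simp
      moreover have "z (x + (1 - e) * z x) = - z x" using Pz[OF eP(2), of x "z x"] inv by simp
      ultimately show ?thesis by (simp add: z'_def)
    next
      case False
      then have "z' x = e * w x" by (simp add: z'_def)
      moreover have "w (x + e * w x) = - w x" using Pw[OF el(1), of x "w x"] wprops by simp
      ultimately show ?thesis using False by (simp add: z'_def)
    qed
  qed (use Pl in auto)
  have slow_s: "dens l (\<lambda>x. s (x + 1) \<noteq> s x) \<le> 2 / real_of_int l"
    unfolding s_def by (rule dens_wave_change) (use ah in auto)
  have lift1: "dens (P * l) (\<lambda>x. S (x + n) \<noteq> S x) = dens P (\<lambda>x. S (x + n) \<noteq> S x)" for n
    using dens_lift(1)[OF P ah(5) lP periodic_change(1)[OF perS, of n 0]] by simp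
  have lift2: "dens (P * l) (\<lambda>x. s (x + n) \<noteq> s x) = dens l (\<lambda>x. s (x + n) \<noteq> s x)" for n
    using dens_lift(2)[OF ah(5) P _ periodic_change(1)[OF pers, of n 0]] lP by (simp add: coprime_commute)
  show ?thesis
  proof
    show "swap_pattern (P * l) S' z'" by (rule pat)
    show "coprime (P * l) Q" using lQ \<open>coprime P Q\<close> by simp
    have "dens (P * l) (\<lambda>x. S' (x + 1) \<noteq> S' x)
        \<le> dens (P * l) (\<lambda>x. S (x + 1) \<noteq> S x \<or> s (x + 1) \<noteq> s x)"
      by (rule dens_mono[OF Pl]) (auto simp: S'_def)
    also have "\<dots> \<le> dens P (\<lambda>x. S (x + 1) \<noteq> S x) + dens l (\<lambda>x. s (x + 1) \<noteq> s x)"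
      unfolding lift1[symmetric] lift2[symmetric] by (rule dens_disj[OF Pl])
    also have "\<dots> \<le> \<kappa> / 2 + \<kappa> / 2" using slow slow_s kl by (intro add_mono) auto
    finally show "dens (P * l) (\<lambda>x. S' (x + 1) \<noteq> S' x) \<le> \<kappa>" by simp
    show "dens (P * l) (\<lambda>n. S' (n + z' x) \<noteq> S' n) \<le> 1 / real D" for x
    proof (cases "w x = 0")
      case True
      then have "z' x = (1 - e) * z x" by (simp add: z'_def)
      then have "S' (n + z' x) = (S (n + z x) \<noteq> s n)" for n
        using PS[OF eP(2), of n "z x"] Ps[OF el(2), of n "z x"] by (simp add: S'_def)
      then have "(\<lambda>n. S' (n + z' x) \<noteq> S' n) = (\<lambda>n. S (n + z x) \<noteq> S n)" by (auto simp: S'_def)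
      then show ?thesis using corr[of x] lift1[of "z x"] by (simp only:)
    next
      case False
      then have "z' x = e * w x" by (simp add: z'_def)
      then have "S' (n + z' x) = (S n \<noteq> s (n + w x))" for n
        using PS[OF eP(1), of n "w x"] Ps[OF el(1), of n "w x"] by (simp add: S'_def)
      then have "(\<lambda>n. S' (n + z' x) \<noteq> S' n) = (\<lambda>n. s (n + w x) \<noteq> s n)" by (auto simp: S'_def)
      then have "dens (P * l) (\<lambda>n. S' (n + z' x) \<noteq> S' n) = dens l (\<lambda>n. s (n + w x) \<noteq> s n)"
        using lift2[of "w x"] by (simp only:)
      also have "\<dots> \<le> real_of_int \<bar>w x\<bar> * dens l (\<lambda>x. s (x + 1) \<noteq> s x)"
        by (rule dens_change_le[OF ah(5) pers])
      also have "\<dots> \<le> real_of_int a * (2 / real_of_int l)"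
        using a slow_s dens_nonneg[OF ah(5)] by (intro mult_mono) (auto simp: w_def jump_swap_def)
      also have "\<dots> \<le> 1 / real D"
      proof -
        have "2 * real_of_int a * real D \<le> real_of_int l" by (simp add: l_def h_def)
        then show ?thesis using ah \<open>D > 0\<close> by (simp add: field_simps)
      qed
      finally show ?thesis .
    qed
    have perF: "periodic P (\<lambda>x. S (x + z x) = S x)"
    proof (rule periodicI)
      fix x y assume c: "[x = y] (mod P)"
      show "(S (x + z x) = S x) = (S (y + z y) = S y)"
        using PS[OF c] Pz[OF c] PS[OF cong_add[OF c cong_refl], of "z y"] by simp
    qed
    have perG: "periodic l (\<lambda>x. w x = 0)" by (rule periodicI) (simp only: Pw)
    have "dens (P * l) (\<lambda>x. S' (x + z' x) = S' x) \<le> dens (P * l) (\<lambda>x. S (x + z x) = S x \<and> w x = 0)"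
    proof (rule dens_mono[OF Pl])
      fix x assume as: "S' (x + z' x) = S' x"
      show "S (x + z x) = S x \<and> w x = 0"
      proof (cases "w x = 0")
        case True
        then show ?thesis using as PS[OF eP(2), of x "z x"] Ps[OF el(2), of x "z x"]
          by (cases "s x") (simp_all add: S'_def z'_def)
      next
        case False
        then show ?thesis using as PS[OF eP(1), of x "w x"] Ps[OF el(1), of x "w x"] wprops(2)[of x]
          by (cases "S x") (simp_all add: S'_def z'_def)
      qed
    qed
    also have "\<dots> = dens P (\<lambda>x. S (x + z x) = S x) * (1 - 2 * real_of_int a / real_of_int l)"
      using dens_prod[OF P ah(5) lP perF perG] dens_jump_swap_zero[OF a(1) ah(1,3)] by (simp add: w_def)
    also have "\<dots> \<le> dens P (\<lambda>x. S (x + z x) = S x) * (1 - 2 / (3 * real D))"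
    proof (intro mult_left_mono dens_nonneg[OF P])
      have "1 \<le> int D * a" using ah(1) a unfolding h_def by linarith
      then have "l \<le> 3 * int D * a" unfolding l_def h_def by linarith
      then have "real_of_int l \<le> real_of_int (3 * int D * a)" by (simp only: of_int_le_iff)
      then have "real_of_int l \<le> 3 * real D * real_of_int a" by simp
      then show "1 - 2 * real_of_int a / real_of_int l \<le> 1 - 2 / (3 * real D)"
        using ah \<open>D > 0\<close> by (simp add: field_simps)
    qed
    finally show "dens (P * l) (\<lambda>x. S' (x + z' x) = S' x)
        \<le> (1 - 2 / (3 * real D)) * dens P (\<lambda>x. S (x + z x) = S x)" by (simp add: mult.commute)
    have "S' (x + e * h) = (S x \<noteq> s (x + h))" for x
      using PS[OF eP(1), of x h] Ps[OF el(1), of x h] by (simp add: S'_def)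
    then have "(\<lambda>x. S' (x + e * h) = S' x) = (\<lambda>x. s (x + h) = s x)" by (auto simp: S'_def)
    then have "dens (P * l) (\<lambda>x. S' (x + e * h) = S' x) = dens l (\<lambda>x. s (x + h) = s x)"
      using dens_lift(2)[OF ah(5) P _ periodic_change(2)[OF pers, of h 0]] lP by (simp add: coprime_commute)
    also have "\<dots> \<le> 1 / real_of_int l" unfolding s_def by (rule dens_wave_half) (use ah l_def in auto)
    also have "\<dots> \<le> 4 / real_of_int l" using ah by (simp add: divide_right_mono)
    finally show "dens (P * l) (\<lambda>x. S' (x + e * h) = S' x) \<le> \<kappa>" using kl by linarith
  qed
qed

text \<open>The slowness \<open>\<kappa>\<close> is generalised, because each extension consumes half of it.\<close>

lemma swap_pattern_iterate:
  fixes D r :: nat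
  assumes "Q > 0" "D > 0" "\<kappa> > 0"
  shows "\<exists>P S z. swap_pattern P S z \<and> coprime P Q \<and>
    dens P (\<lambda>x. S (x + 1) \<noteq> S x) \<le> \<kappa> \<and>
    (\<forall>x. dens P (\<lambda>n. S (n + z x) \<noteq> S n) \<le> 1 / real D) \<and>
    dens P (\<lambda>x. S (x + z x) = S x) \<le> (1 - 2 / (3 * real D)) ^ r"
  using assms(3)
proof (induction r arbitrary: \<kappa>)
  case 0
  have "swap_pattern 1 (\<lambda>_. True) (\<lambda>_. 0)" by (simp add: swap_pattern_def periodic_def)
  moreover have "dens 1 (\<lambda>_. False) = 0" by (simp add: dens_def)
  ultimately show ?case using 0 dens_le_1[of 1]
    by (intro exI[of _ 1] exI[of _ "\<lambda>_. True"] exI[of _ "\<lambda>_. 0"]) simp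
next
  case (Suc r)
  obtain P S z where IH: "swap_pattern P S z" "coprime P Q"
    "dens P (\<lambda>x. S (x + 1) \<noteq> S x) \<le> \<kappa> / 2"
    "\<And>x. dens P (\<lambda>n. S (n + z x) \<noteq> S n) \<le> 1 / real D"
    "dens P (\<lambda>x. S (x + z x) = S x) \<le> (1 - 2 / (3 * real D)) ^ r"
    using Suc.IH[of "\<kappa> / 2"] Suc.prems by auto
  obtain P' S' z' n0 where new: "swap_pattern P' S' z'" "coprime P' Q"
    "dens P' (\<lambda>x. S' (x + 1) \<noteq> S' x) \<le> \<kappa>"
    "\<And>x. dens P' (\<lambda>n. S' (n + z' x) \<noteq> S' n) \<le> 1 / real D"
    "dens P' (\<lambda>x. S' (x + z' x) = S' x) \<le> (1 - 2 / (3 * real D)) * dens P (\<lambda>x. S (x + z x) = S x)"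
    "dens P' (\<lambda>x. S' (x + n0) = S' x) \<le> \<kappa>"
    using swap_pattern_extend[OF IH(1,2) assms(1,2) Suc.prems IH(3,4)] by blast
  have "(1 - 2 / (3 * real D)) * dens P (\<lambda>x. S (x + z x) = S x) \<le> (1 - 2 / (3 * real D)) ^ Suc r"
    unfolding power_Suc by (rule mult_left_mono[OF IH(5)]) (use assms(2) in \<open>simp add: field_simps\<close>)
  then show ?case using new order_trans[OF new(5)] by (intro exI[of _ P'] exI[of _ S'] exI[of _ z']) auto
qed

text \<open>First \<open>D\<close> is chosen for the invisibility of the displacements, then so many factors that the exceptional
set is small, while \<open>\<kappa>\<close> is independent of both. The additional shift \<open>n0\<close>, half a period of the last
wave, inverts the pattern almost everywhere; it will give ergodicity.\<close>

lemma swap_pattern_exists: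
  assumes "Q > 0" "\<epsilon> > 0" "\<kappa> > 0"
  shows "\<exists>P S z n0. swap_pattern P S z \<and> coprime P Q \<and>
    dens P (\<lambda>x. S (x + 1) \<noteq> S x) \<le> \<kappa> \<and>
    (\<forall>x. dens P (\<lambda>n. S (n + z x) \<noteq> S n) \<le> \<epsilon>) \<and>
    dens P (\<lambda>x. S (x + z x) = S x) \<le> \<epsilon> \<and>
    dens P (\<lambda>x. S (x + n0) = S x) \<le> \<kappa>"
proof -
  obtain D :: nat where D: "D > 0" "1 / real D < \<epsilon>"
    using reals_Archimedean[OF assms(2)] by (metis inverse_eq_divide zero_less_Suc)
  define q where "q = 1 - 2 / (3 * real D)"
  have q: "0 \<le> q" "q < 1" using D by (auto simp: q_def field_simps)
  obtain r where r: "q ^ r < \<epsilon>" using real_arch_pow_inv[OF assms(2) q(2)] by auto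
  obtain P S z where IH: "swap_pattern P S z" "coprime P Q"
    "dens P (\<lambda>x. S (x + 1) \<noteq> S x) \<le> \<kappa> / 2"
    "\<And>x. dens P (\<lambda>n. S (n + z x) \<noteq> S n) \<le> 1 / real D"
    "dens P (\<lambda>x. S (x + z x) = S x) \<le> q ^ r"
    using swap_pattern_iterate[OF assms(1) D(1), of "\<kappa> / 2" r] assms(3) unfolding q_def by auto
  obtain P' S' z' n0 where new: "swap_pattern P' S' z'" "coprime P' Q"
    "dens P' (\<lambda>x. S' (x + 1) \<noteq> S' x) \<le> \<kappa>"
    "\<And>x. dens P' (\<lambda>n. S' (n + z' x) \<noteq> S' n) \<le> 1 / real D"
    "dens P' (\<lambda>x. S' (x + z' x) = S' x) \<le> q * dens P (\<lambda>x. S (x + z x) = S x)"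
    "dens P' (\<lambda>x. S' (x + n0) = S' x) \<le> \<kappa>"
    using swap_pattern_extend[OF IH(1,2) assms(1) D(1) assms(3) IH(3,4)] unfolding q_def by blast
  have "P > 0" using IH(1) by (simp add: swap_pattern_def)
  have "q * dens P (\<lambda>x. S (x + z x) = S x) \<le> 1 * q ^ r"
    using q IH(5) dens_nonneg[OF \<open>P > 0\<close>] by (intro mult_mono) auto
  then have "dens P' (\<lambda>x. S' (x + z' x) = S' x) \<le> \<epsilon>" using new(5) r by linarith
  moreover have "dens P' (\<lambda>n. S' (n + z' x) \<noteq> S' n) \<le> \<epsilon>" for x using new(4)[of x] D by linarith
  ultimately show ?thesis using new by blast
qed

section \<open>Rigidity and zero entropy\<close>

text \<open>Entropy is at most the mean code length of any code, that is, of any subprobability vector \<open>q\<close>.\<close>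

lemma gibbs_inequality:
  fixes p q :: "'i \<Rightarrow> real"
  assumes "finite I" "\<And>i. i \<in> I \<Longrightarrow> 0 \<le> p i" "\<And>i. i \<in> I \<Longrightarrow> 0 < q i" "sum q I \<le> sum p I"
  shows "- (\<Sum>i\<in>I. p i * ln (p i)) \<le> (\<Sum>i\<in>I. p i * - ln (q i))"
proof -
  have "p i * ln (q i) - p i * ln (p i) \<le> q i - p i" if "i \<in> I" for i
  proof (cases "p i = 0")
    case True
    then show ?thesis using assms(3)[OF that] by simp
  next
    case False
    then have p: "p i > 0" using assms(2)[OF that] by simp
    have "ln (q i / p i) \<le> q i / p i - 1" using p assms(3)[OF that] by (intro ln_le_minus_one) simp
    then have "p i * ln (q i / p i) \<le> p i * (q i / p i - 1)" using p by (intro mult_left_mono) auto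
    then show ?thesis using p assms(3)[OF that] by (simp add: ln_div algebra_simps)
  qed
  then have "(\<Sum>i\<in>I. p i * ln (q i) - p i * ln (p i)) \<le> (\<Sum>i\<in>I. q i - p i)" by (rule sum_mono)
  also have "\<dots> \<le> 0" using assms(4) by (simp add: sum_subtractf)
  finally show ?thesis by (simp add: sum_subtractf sum_negf)
qed

lemma sum_PiE_Suc:
  fixes f :: "(nat \<Rightarrow> 'a) \<Rightarrow> 'b::comm_monoid_add"
  shows "(\<Sum>a\<in>PiE {..<Suc n} (\<lambda>_. P). f a) = (\<Sum>a\<in>PiE {..<n} (\<lambda>_. P). \<Sum>b\<in>P. f (a(n := b)))"
proof -
  have "(\<Sum>a\<in>PiE {..<Suc n} (\<lambda>_. P). f a) = (\<Sum>(b, a)\<in>P \<times> PiE {..<n} (\<lambda>_. P). f (a(n := b)))"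
  proof -
    have "inj_on (\<lambda>(b, a). a(n := b)) (P \<times> PiE {..<n} (\<lambda>_. P))"
      by (rule inj_combinator) simp
    then show ?thesis
      unfolding lessThan_Suc PiE_insert_eq
      by (subst sum.reindex) (auto simp: o_def split_def)
  qed
  then show ?thesis by (simp add: sum.cartesian_product[symmetric] sum.swap[of _ P])
qed

text \<open>Some powers of \<open>T\<close> converge to the identity. Since \<open>T\<close> preserves a finite measure, it suffices to
control the part of \<open>A\<close> that does not return to \<open>A\<close>.\<close>

definition rigid :: "'a measure \<Rightarrow> ('a \<Rightarrow> 'a) \<Rightarrow> bool" where
  "rigid M T \<longleftrightarrow> (\<exists>r::nat \<Rightarrow> nat. (\<forall>k. 0 < r k) \<and>
     (\<forall>A\<in>sets M. (\<lambda>k. measure M (A - (T ^^ r k) -` A)) \<longlonglongrightarrow> 0))"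

definition join_cell :: "'a measure \<Rightarrow> ('a \<Rightarrow> 'a) \<Rightarrow> nat \<Rightarrow> (nat \<Rightarrow> 'a set) \<Rightarrow> 'a set" where
  "join_cell M T n a = space M \<inter> (\<Inter>i<n. (T ^^ i) -` a i)"

context prob_space
begin

context
  fixes T :: "'a \<Rightarrow> 'a" and P :: "'a set set"
  assumes T[measurable]: "T \<in> M \<rightarrow>\<^sub>M M"
    and mp: "\<And>A. A \<in> events \<Longrightarrow> prob (T -` A \<inter> space M) = prob A"
    and P: "finite_partition M P"
begin

lemma finite_cells: "finite P" and cells_measurable: "p \<in> P \<Longrightarrow> p \<in> events"
  and cells_cover: "\<Union>P = space M"
  using P by (auto simp: finite_partition_def partition_on_def)

lemma cell_unique: "p \<in> P \<Longrightarrow> q \<in> P \<Longrightarrow> x \<in> p \<Longrightarrow> x \<in> q \<Longrightarrow> p = q"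
  using P unfolding finite_partition_def partition_on_def disjoint_def by blast

lemma funpow_measurable[measurable]: "(T ^^ i) \<in> M \<rightarrow>\<^sub>M M"
proof (induction i)
  case (Suc i)
  show ?case unfolding funpow.simps by (rule measurable_comp[OF Suc T])
qed (simp add: id_def)

lemma funpow_in_space: "x \<in> space M \<Longrightarrow> (T ^^ i) x \<in> space M"
  using measurable_space[OF funpow_measurable] .

lemma prob_funpow_vimage: "A \<in> events \<Longrightarrow> prob ((T ^^ i) -` A \<inter> space M) = prob A"
proof (induction i arbitrary: A)
  case 0
  then show ?case using sets.sets_into_space[OF 0] by (simp add: Int_absorb2)
next
  case (Suc i)
  have "(T ^^ Suc i) -` A \<inter> space M = (T ^^ i) -` (T -` A \<inter> space M) \<inter> space M"
    using funpow_in_space by auto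
  also have "prob \<dots> = prob (T -` A \<inter> space M)"
    by (rule Suc.IH) (rule measurable_sets[OF T Suc.prems])
  finally show ?case by (simp only: mp[OF Suc.prems])
qed

lemma no_return_measurable: "p \<in> P \<Longrightarrow> p - (T ^^ m) -` p \<in> events"
proof -
  assume p: "p \<in> P"
  have "p - (T ^^ m) -` p = p - ((T ^^ m) -` p \<inter> space M)"
    using sets.sets_into_space[OF cells_measurable[OF p]] by auto
  then show ?thesis using cells_measurable[OF p] measurable_sets[OF funpow_measurable cells_measurable[OF p]] by auto
qed

lemma join_cell_measurable: "a \<in> PiE {..<n} (\<lambda>_. P) \<Longrightarrow> join_cell M T n a \<in> events"
proof -
  assume a: "a \<in> PiE {..<n} (\<lambda>_. P)"
  have "join_cell M T n a = {x\<in>space M. \<forall>i\<in>{..<n}. (T ^^ i) x \<in> a i}"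
    by (auto simp: join_cell_def)
  also have "\<dots> \<in> events"
  proof (rule sets.sets_Collect_finite_All)
    fix i assume "i \<in> {..<n}"
    then have "a i \<in> events" using a cells_measurable by auto
    then have "(T ^^ i) -` a i \<inter> space M \<in> events" by (rule measurable_sets[OF funpow_measurable])
    moreover have "{x \<in> space M. (T ^^ i) x \<in> a i} = (T ^^ i) -` a i \<inter> space M" by auto
    ultimately show "{x \<in> space M. (T ^^ i) x \<in> a i} \<in> events" by simp
  qed simp
  finally show ?thesis .
qed

lemma join_cell_disjoint:
  assumes "a \<in> PiE {..<n} (\<lambda>_. P)" "b \<in> PiE {..<n} (\<lambda>_. P)"
    and "x \<in> join_cell M T n a" "x \<in> join_cell M T n b"
  shows "a = b"
proof (rule PiE_ext[OF assms(1,2)])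
  fix i assume "i \<in> {..<n}"
  then show "a i = b i" using assms cell_unique[of "a i" "b i" "(T ^^ i) x"]
    by (auto simp: join_cell_def)
qed

lemma prob_Union_join_cells:
  assumes "B \<subseteq> PiE {..<n} (\<lambda>_. P)"
  shows "(\<Sum>a\<in>B. prob (join_cell M T n a)) = prob (\<Union>a\<in>B. join_cell M T n a)"
proof (rule finite_measure_finite_Union[symmetric])
  show "finite B" using assms finite_subset finite_PiE finite_cells by (metis finite_lessThan)
  show "disjoint_family_on (join_cell M T n) B"
    unfolding disjoint_family_on_def
  proof (intro ballI impI)
    fix a b assume ab: "a \<in> B" "b \<in> B" "a \<noteq> b"
    then show "join_cell M T n a \<inter> join_cell M T n b = {}"
      using join_cell_disjoint[OF subsetD[OF assms] subsetD[OF assms]] by blast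
  qed
  show "join_cell M T n ` B \<subseteq> events"     by (intro image_subsetI join_cell_measurable subsetD[OF assms])
qed

lemma sum_prob_join_cells: "(\<Sum>a\<in>PiE {..<n} (\<lambda>_. P). prob (join_cell M T n a)) = 1"
proof -
  have "(\<Union>a\<in>PiE {..<n} (\<lambda>_. P). join_cell M T n a) = space M"
  proof (intro equalityI subsetI)
    fix x assume x: "x \<in> space M"
    have "\<exists>p\<in>P. (T ^^ i) x \<in> p" for i using funpow_in_space[OF x] cells_cover by blast
    then obtain f where f: "\<And>i. f i \<in> P \<and> (T ^^ i) x \<in> f i" by metis
    then have "restrict f {..<n} \<in> PiE {..<n} (\<lambda>_. P)" "x \<in> join_cell M T n (restrict f {..<n})"
      using x by (auto simp: join_cell_def)
    then show "x \<in> (\<Union>a\<in>PiE {..<n} (\<lambda>_. P). join_cell M T n a)" by blast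
  qed (auto simp: join_cell_def)
  then show ?thesis unfolding prob_Union_join_cells[OF subset_refl] by (simp only: prob_space)
qed

lemma partition_entropy_iterated_join:
  "partition_entropy M (iterated_join M T P n)
     = - (\<Sum>a\<in>PiE {..<n} (\<lambda>_. P). prob (join_cell M T n a) * ln (prob (join_cell M T n a)))"
proof -
  let ?A = "{a\<in>PiE {..<n} (\<lambda>_. P). join_cell M T n a \<noteq> {}}"
  have join: "iterated_join M T P n = {join_cell M T n p | p. \<forall>i<n. p i \<in> P} - {{}}"
    unfolding iterated_join_def join_cell_def by (rule refl)
  have "iterated_join M T P n = join_cell M T n ` ?A"
  proof (intro equalityI subsetI)
    fix C assume "C \<in> iterated_join M T P n"
    then obtain p where p: "C = join_cell M T n p" "\<forall>i<n. p i \<in> P" "C \<noteq> {}"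
      unfolding join by blast
    have "join_cell M T n p = join_cell M T n (restrict p {..<n})"
      by (simp add: join_cell_def)
    moreover have "restrict p {..<n} \<in> PiE {..<n} (\<lambda>_. P)" using p(2) by simp
    ultimately show "C \<in> join_cell M T n ` ?A" using p by blast
  next
    fix C assume "C \<in> join_cell M T n ` ?A"
    then obtain a where a: "C = join_cell M T n a" "a \<in> PiE {..<n} (\<lambda>_. P)" "C \<noteq> {}" by blast
    have "\<forall>i<n. a i \<in> P" using a(2) by auto
    then show "C \<in> iterated_join M T P n"
      using a(1,3) unfolding join by blast
  qed
  moreover have "inj_on (join_cell M T n) ?A"
  proof (rule inj_onI)
    fix a b assume a: "a \<in> ?A" and b: "b \<in> ?A" and eq: "join_cell M T n a = join_cell M T n b"
    then obtain x where "x \<in> join_cell M T n a" by blast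
    then show "a = b" using a b eq join_cell_disjoint[of a n b x] by simp
  qed
  ultimately have "partition_entropy M (iterated_join M T P n)
     = - (\<Sum>a\<in>?A. prob (join_cell M T n a) * ln (prob (join_cell M T n a)))"
    by (simp add: partition_entropy_def sum.reindex)
  also have "(\<Sum>a\<in>?A. prob (join_cell M T n a) * ln (prob (join_cell M T n a)))
     = (\<Sum>a\<in>PiE {..<n} (\<lambda>_. P). prob (join_cell M T n a) * ln (prob (join_cell M T n a)))"
    by (rule sum.mono_neutral_left) (auto simp: finite_PiE finite_cells)
  finally show ?thesis .
qed

text \<open>Itineraries are encoded by a code that predicts the symbol at time \<open>j\<close> to be the one at time
\<open>j - m\<close>: it spends \<open>- ln (1 - \<delta>)\<close> if the prediction is correct and \<open>ln (card P / \<delta>)\<close> otherwise. By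
invariance the prediction fails with the probability that a point changes its cell in \<open>m\<close> steps,
so if \<open>T\<^sup>m\<close> is close to the identity the code is cheap.\<close>

lemma entropy_le_return:
  fixes m n :: nat and \<delta> :: real
  assumes "0 < \<delta>" "\<delta> < 1" "m > 0"
  shows "partition_entropy M (iterated_join M T P n)
    \<le> real m * ln (card P) + real n * (- ln (1 - \<delta>) + (\<Sum>p\<in>P. prob (p - (T ^^ m) -` p)) * ln (card P / \<delta>))"
proof -
  define N where "N = real (card P)"
  have "space M \<noteq> {}" by (rule not_empty)
  then have "P \<noteq> {}" using cells_cover by auto
  then have N: "1 \<le> N" using finite_cells by (simp add: N_def Suc_le_eq card_gt_0_iff)
  define E where "E = (\<Sum>p\<in>P. prob (p - (T ^^ m) -` p))"
  define K where "K j a = (if j < m then 1 / N else if a j = a (j - m) then 1 - \<delta> else \<delta> / N)"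
    for j and a :: "nat \<Rightarrow> 'a set"
  define q where "q n a = (\<Prod>j<n. K j a)" for n a
  have Kpos: "K j a > 0" for j a using assms N by (auto simp: K_def)
  have q_le: "(\<Sum>a\<in>PiE {..<n} (\<lambda>_. P). q n a) \<le> 1" for n
  proof (induction n)
    case (Suc n)
    have "(\<Sum>b\<in>P. q (Suc n) (a(n := b))) \<le> q n a" if a: "a \<in> PiE {..<n} (\<lambda>_. P)" for a
    proof -
      have "q (Suc n) (a(n := b)) = q n a * K n (a(n := b))" for b
      proof -
        have "K j (a(n := b)) = K j a" if "j < n" for j
        proof -
          have "j \<noteq> n" "j - m \<noteq> n" using that by linarith+
          then show ?thesis by (simp add: K_def)
        qed
        then show ?thesis by (simp add: q_def)
      qed
      then have "(\<Sum>b\<in>P. q (Suc n) (a(n := b))) = q n a * (\<Sum>b\<in>P. K n (a(n := b)))"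
        by (simp add: sum_distrib_left)
      moreover have "(\<Sum>b\<in>P. K n (a(n := b))) \<le> 1"
      proof (cases "n < m")
        case True
        then show ?thesis using N by (simp add: K_def N_def)
      next
        case False
        then have "n - m < n" using assms by simp
        then have "(\<Sum>b\<in>P. K n (a(n := b))) = (\<Sum>b\<in>P. if b = a (n - m) then 1 - \<delta> else \<delta> / N)"
          using False by (intro sum.cong) (auto simp: K_def)
        also have "\<dots> \<le> (\<Sum>b\<in>P. (if b = a (n - m) then 1 - \<delta> else 0) + \<delta> / N)"
          using assms N by (intro sum_mono) auto
        also have "\<dots> \<le> (1 - \<delta>) + N * (\<delta> / N)"
          unfolding sum.distrib using finite_cells assms by (auto simp: sum.delta N_def)
        also have "\<dots> = 1" using N by simp
        finally show ?thesis .
      qed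
      moreover have "0 \<le> q n a" unfolding q_def by (intro prod_nonneg less_imp_le Kpos)
      ultimately show ?thesis by (simp only: mult_left_le)
    qed
    then have "(\<Sum>a\<in>PiE {..<Suc n} (\<lambda>_. P). q (Suc n) a) \<le> (\<Sum>a\<in>PiE {..<n} (\<lambda>_. P). q n a)"
      unfolding sum_PiE_Suc by (rule sum_mono)
    then show ?case using Suc by simp
  qed (simp add: q_def)
  define p where "p a = prob (join_cell M T n a)" for a
  let ?I = "PiE {..<n} (\<lambda>_. P)"
  have sp: "(\<Sum>a\<in>?I. p a) = 1" unfolding p_def by (rule sum_prob_join_cells)
  have ln_nonneg: "0 \<le> ln (N / \<delta>)" "0 \<le> - ln (1 - \<delta>)" "0 \<le> ln N"
    using assms N by (auto simp: field_simps)
  have E0: "0 \<le> E" by (simp add: E_def sum_nonneg)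
  have return: "(\<Sum>a\<in>?I. p a * (if a j \<noteq> a (j - m) then 1 else 0)) \<le> E" if "m \<le> j" "j < n" for j
  proof -
    let ?B = "{a\<in>?I. a j \<noteq> a (j - m)}"
    have "(\<Sum>a\<in>?I. p a * (if a j \<noteq> a (j - m) then 1 else 0)) = (\<Sum>a\<in>?B. p a)"
      by (intro sum.mono_neutral_cong_right) (auto simp: finite_PiE finite_cells)
    also have "\<dots> = prob (\<Union>a\<in>?B. join_cell M T n a)"
      unfolding p_def by (rule prob_Union_join_cells) auto
    also have "\<dots> \<le> prob ((T ^^ (j - m)) -` (\<Union>p\<in>P. p - (T ^^ m) -` p) \<inter> space M)"
    proof (rule finite_measure_mono)
      show "(\<Union>a\<in>?B. join_cell M T n a) \<subseteq> (T ^^ (j - m)) -` (\<Union>p\<in>P. p - (T ^^ m) -` p) \<inter> space M"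
      proof
        fix x assume "x \<in> (\<Union>a\<in>?B. join_cell M T n a)"
        then obtain a where a: "a \<in> ?I" "a j \<noteq> a (j - m)" "x \<in> join_cell M T n a" by auto
        have x: "x \<in> space M" "(T ^^ j) x \<in> a j" "(T ^^ (j - m)) x \<in> a (j - m)"
          using a(3) that by (auto simp: join_cell_def)
        have aP: "a j \<in> P" "a (j - m) \<in> P" using a(1) that by auto
        have "(T ^^ m) ((T ^^ (j - m)) x) = (T ^^ j) x"
          using that funpow_add[of m "j - m" T] by simp
        moreover have "(T ^^ j) x \<notin> a (j - m)" using cell_unique aP x a(2) by blast
        ultimately show "x \<in> (T ^^ (j - m)) -` (\<Union>p\<in>P. p - (T ^^ m) -` p) \<inter> space M"
          using x aP by auto
      qed
      show "(T ^^ (j - m)) -` (\<Union>p\<in>P. p - (T ^^ m) -` p) \<inter> space M \<in> events"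
        by (rule measurable_sets[OF funpow_measurable]) (intro sets.finite_UN finite_cells no_return_measurable)
    qed
    also have "\<dots> = prob (\<Union>p\<in>P. p - (T ^^ m) -` p)"
      by (rule prob_funpow_vimage) (intro sets.finite_UN finite_cells no_return_measurable)
    also have "\<dots> \<le> E" unfolding E_def
      by (rule finite_measure_subadditive_finite) (use finite_cells no_return_measurable in auto)
    finally show ?thesis .
  qed
  have Kln: "- ln (K j a) \<le> (- ln (1 - \<delta>)) + (if a j \<noteq> a (j - m) then 1 else 0) * ln (N / \<delta>)" if "m \<le> j" for j a
    using that ln_nonneg assms N by (auto simp: K_def ln_div)
  have term_le: "(\<Sum>a\<in>?I. p a * - ln (K j a)) \<le> (if j < m then ln N else 0) + (- ln (1 - \<delta>) + E * ln (N / \<delta>))"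
    if "j < n" for j
  proof (cases "j < m")
    case True
    then have "(\<Sum>a\<in>?I. p a * - ln (K j a)) = (\<Sum>a\<in>?I. p a) * ln N"
      using N by (simp add: K_def ln_div sum_distrib_right)
    then show ?thesis using True sp mult_nonneg_nonneg[OF E0 ln_nonneg(1)] ln_nonneg by simp
  next
    case False
    have "(\<Sum>a\<in>?I. p a * - ln (K j a))
        \<le> (\<Sum>a\<in>?I. p a * (- ln (1 - \<delta>) + (if a j \<noteq> a (j - m) then 1 else 0) * ln (N / \<delta>)))"
      using False by (intro sum_mono mult_left_mono Kln) (auto simp: p_def)
    also have "\<dots> = (\<Sum>a\<in>?I. p a) * - ln (1 - \<delta>)
        + (\<Sum>a\<in>?I. p a * (if a j \<noteq> a (j - m) then 1 else 0)) * ln (N / \<delta>)"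
      unfolding sum_distrib_right sum.distrib[symmetric] by (intro sum.cong) (auto simp: algebra_simps)
    also have "\<dots> \<le> - ln (1 - \<delta>) + E * ln (N / \<delta>)"
      unfolding sp using return[of j] False that ln_nonneg by (intro add_mono mult_right_mono) auto
    finally show ?thesis using False by simp
  qed
  have "partition_entropy M (iterated_join M T P n) = - (\<Sum>a\<in>?I. p a * ln (p a))"
    unfolding p_def by (rule partition_entropy_iterated_join)
  also have "\<dots> \<le> (\<Sum>a\<in>?I. p a * - ln (q n a))"
    using q_le[of n] sp Kpos by (intro gibbs_inequality) (auto simp: finite_PiE finite_cells p_def q_def prod_pos)
  also have "\<dots> = (\<Sum>a\<in>?I. \<Sum>j<n. p a * - ln (K j a))"
  proof (rule sum.cong[OF refl])
    fix a
    have "ln (q n a) = (\<Sum>j<n. ln (K j a))"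
      unfolding q_def by (rule ln_prod) (use Kpos in \<open>auto simp: less_imp_neq[symmetric]\<close>)
    then show "p a * - ln (q n a) = (\<Sum>j<n. p a * - ln (K j a))"
      by (simp add: sum_distrib_left sum_negf)
  qed
  also have "\<dots> = (\<Sum>j<n. \<Sum>a\<in>?I. p a * - ln (K j a))" by (rule sum.swap)
  also have "\<dots> \<le> (\<Sum>j<n. (if j < m then ln N else 0) + (- ln (1 - \<delta>) + E * ln (N / \<delta>)))"
    by (rule sum_mono) (use term_le in auto)
  also have "\<dots> = (\<Sum>j<n. if j < m then ln N else 0) + real n * (- ln (1 - \<delta>) + E * ln (N / \<delta>))"
    by (simp add: sum.distrib)
  also have "(\<Sum>j<n. if j < m then ln N else 0) \<le> (\<Sum>j<m. ln N)"
  proof -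
    have "(\<Sum>j<n. if j < m then ln N else 0) = (\<Sum>j\<in>{..<n} \<inter> {..<m}. ln N)"
      by (subst sum.inter_restrict) auto
    also have "\<dots> \<le> (\<Sum>j<m. ln N)" by (rule sum_mono2) (use ln_nonneg in auto)
    finally show ?thesis .
  qed
  finally show ?thesis by (simp add: N_def E_def)
qed

lemma partition_ks_entropy_zero:
  assumes "rigid M T"
  shows "partition_ks_entropy M T P = 0"
proof -
  let ?H = "\<lambda>n. partition_entropy M (iterated_join M T P n)"
  obtain r :: "nat \<Rightarrow> nat" where r: "\<And>k. 0 < r k"
    and lim: "\<And>A. A \<in> events \<Longrightarrow> (\<lambda>k. prob (A - (T ^^ r k) -` A)) \<longlonglongrightarrow> 0"
    using assms by (auto simp: rigid_def)
  have H0: "0 \<le> ?H n" for n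
  proof -
    have "(\<Sum>p\<in>Q. prob p * ln (prob p)) \<le> 0" for Q :: "'a set set"
    proof (rule sum_nonpos)
      fix p show "prob p * ln (prob p) \<le> 0"
        using prob_le_1[of p] by (cases "prob p = 0") (auto simp: mult_le_0_iff zero_less_measure_iff)
    qed
    then show ?thesis by (simp add: partition_entropy_def)
  qed
  have "(\<lambda>n. ?H n / real n) \<longlonglongrightarrow> 0"
  proof (rule LIMSEQ_I)
    fix \<eta> :: real assume \<eta>: "\<eta> > 0"
    define \<delta> where "\<delta> = 1 - exp (- \<eta> / 4)"
    have \<delta>: "0 < \<delta>" "\<delta> < 1" "- ln (1 - \<delta>) = \<eta> / 4" using \<eta> by (auto simp: \<delta>_def)
    have "(\<lambda>k. (\<Sum>p\<in>P. prob (p - (T ^^ r k) -` p)) * ln (card P / \<delta>)) \<longlonglongrightarrow> (\<Sum>p\<in>P. 0) * ln (card P / \<delta>)"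
      by (intro tendsto_intros lim cells_measurable)
    then have "\<forall>\<^sub>F k in sequentially. (\<Sum>p\<in>P. prob (p - (T ^^ r k) -` p)) * ln (card P / \<delta>) < \<eta> / 4"
      using \<eta> by (intro order_tendstoD(2)) auto
    then obtain k where k: "(\<Sum>p\<in>P. prob (p - (T ^^ r k) -` p)) * ln (card P / \<delta>) < \<eta> / 4"
      by (auto simp: eventually_sequentially)
    define m where "m = r k"
    obtain n0 :: nat where n0: "4 * (real m * ln (card P)) / \<eta> < real n0"
      using reals_Archimedean2 by blast
    show "\<exists>no. \<forall>n\<ge>no. norm (?H n / real n - 0) < \<eta>"
    proof (intro exI allI impI)
      fix n assume n: "Suc n0 \<le> n"
      then have n1: "real n0 < real n" "0 < real n" by auto
      then have "4 * (real m * ln (card P)) / \<eta> < real n" using n0 by linarith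
      then have a: "real m * ln (card P) < real n * (\<eta> / 4)" using \<eta> by (simp add: field_simps)
      have "?H n \<le> real m * ln (card P)
         + real n * (- ln (1 - \<delta>) + (\<Sum>p\<in>P. prob (p - (T ^^ m) -` p)) * ln (card P / \<delta>))"
        using \<delta> r by (intro entropy_le_return) (auto simp: m_def)
      also have "\<dots> \<le> real n * (\<eta> / 4) + real n * (\<eta> / 4 + \<eta> / 4)"
        using a k \<delta> n1 by (intro add_mono mult_left_mono) (auto simp: m_def)
      also have "\<dots> < real n * \<eta>" using n1 \<eta> by (simp add: field_simps)
      finally have "?H n / real n < \<eta>" using n1 by (simp add: field_simps)
      then show "norm (?H n / real n - 0) < \<eta>" using H0[of n] n1 by simp
    qed
  qed
  then show ?thesis unfolding partition_ks_entropy_def by (rule limI)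
qed

end

lemma ks_entropy_rigid:
  assumes "invertible_mpt M T" "rigid M T"
  shows "ks_entropy M T = 0"
proof -
  have T: "T \<in> M \<rightarrow>\<^sub>M M" "\<And>A. A \<in> events \<Longrightarrow> prob (T -` A \<inter> space M) = prob A"
    using assms(1) by (auto simp: invertible_mpt_def measure_def)
  have "finite_partition M {space M}"
    using not_empty by (simp add: finite_partition_def partition_on_def)
  then have "{P. finite_partition M P} \<noteq> {}" by blast
  have "ks_entropy M T = (SUP P\<in>{P. finite_partition M P}. 0)"
    unfolding ks_entropy_def
  proof (rule SUP_cong[OF refl])
    fix P assume "P \<in> {P. finite_partition M P}"
    then have "partition_ks_entropy M T P = 0"
      using partition_ks_entropy_zero[OF T _ assms(2)] by simp
    then show "ereal (partition_ks_entropy M T P) = 0" by simp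
  qed
  also have "\<dots> = 0" using \<open>{P. finite_partition M P} \<noteq> {}\<close> by (rule SUP_const)
  finally show ?thesis .
qed

end

section \<open>Convergence in mean square and integrals\<close>

text \<open>The mean of a random variable is at most its root mean square, so mean square convergence passes to
integrals. The counterexample will be detected on integrals alone.\<close>

lemma converges_in_L2_imp_convergent_integral:
  assumes "prob_space M" and conv: "converges_in_L2 M F"
    and meas: "\<And>N. F N \<in> borel_measurable M" and bnd: "\<And>N x. \<bar>F N x\<bar> \<le> 1"
  shows "convergent (\<lambda>N. \<integral>x. F N x \<partial>M)"
proof -
  interpret prob_space M by fact
  obtain f where f[measurable]: "f \<in> borel_measurable M" and sq: "integrable M (\<lambda>x. (f x)\<^sup>2)"
    and lim: "(\<lambda>N. \<integral>x. (F N x - f x)\<^sup>2 \<partial>M) \<longlonglongrightarrow> 0"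
    using conv by (auto simp: converges_in_L2_def)
  note meas[measurable]
  have intf: "integrable M f"
  proof (rule Bochner_Integration.integrable_bound[of M "\<lambda>x. 1 + (f x)\<^sup>2"])
    show "AE x in M. norm (f x) \<le> norm (1 + (f x)\<^sup>2)"
    proof (rule AE_I2)
      fix x
      have "0 \<le> (\<bar>f x\<bar> - 1)\<^sup>2" by simp
      then have "2 * \<bar>f x\<bar> \<le> 1 + (f x)\<^sup>2" by (simp add: power2_diff)
      then show "norm (f x) \<le> norm (1 + (f x)\<^sup>2)" by simp
    qed
  qed (use sq in simp_all)
  have intF: "integrable M (F N)" for N
    by (rule integrable_const_bound[of _ 1]) (simp_all add: bnd)
  have intd: "integrable M (\<lambda>x. (F N x - f x)\<^sup>2)" for N
  proof (rule Bochner_Integration.integrable_bound[of M "\<lambda>x. 2 + 2 * (f x)\<^sup>2"])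
    show "AE x in M. norm ((F N x - f x)\<^sup>2) \<le> norm (2 + 2 * (f x)\<^sup>2)"
    proof (rule AE_I2)
      fix x
      have "0 \<le> (F N x + f x)\<^sup>2" by simp
      moreover have "(F N x)\<^sup>2 \<le> 1" using bnd[of N x] by (simp add: abs_square_le_1)
      ultimately have "(F N x - f x)\<^sup>2 \<le> 2 + 2 * (f x)\<^sup>2"
        unfolding power2_sum power2_diff by linarith
      then show "norm ((F N x - f x)\<^sup>2) \<le> norm (2 + 2 * (f x)\<^sup>2)" by simp
    qed
  qed (use sq in simp_all)
  have "(\<lambda>N. \<integral>x. F N x - f x \<partial>M) \<longlonglongrightarrow> 0"
  proof (rule tendsto_rabs_zero_cancel, rule real_tendsto_sandwich[of "\<lambda>_. 0" _ _ "\<lambda>N. sqrt (\<integral>x. (F N x - f x)\<^sup>2 \<partial>M)"])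
    show "\<forall>\<^sub>F N in sequentially. \<bar>\<integral>x. F N x - f x \<partial>M\<bar> \<le> sqrt (\<integral>x. (F N x - f x)\<^sup>2 \<partial>M)"
    proof (rule always_eventually, rule allI)
      fix N
      have "0 \<le> variance (\<lambda>x. F N x - f x)" by (rule variance_positive)
      also have "\<dots> = (\<integral>x. (F N x - f x)\<^sup>2 \<partial>M) - (\<integral>x. F N x - f x \<partial>M)\<^sup>2"
        by (rule variance_eq) (use intF intf intd in auto)
      finally show "\<bar>\<integral>x. F N x - f x \<partial>M\<bar> \<le> sqrt (\<integral>x. (F N x - f x)\<^sup>2 \<partial>M)"
        by (intro real_le_rsqrt) simp
    qed
    show "(\<lambda>N. sqrt (\<integral>x. (F N x - f x)\<^sup>2 \<partial>M)) \<longlonglongrightarrow> 0"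
      using tendsto_real_sqrt[OF lim] by simp
  qed simp_all
  then have "(\<lambda>N. (\<integral>x. F N x \<partial>M) - (\<integral>x. f x \<partial>M)) \<longlonglongrightarrow> 0"
    using intF intf by simp
  then have "(\<lambda>N. \<integral>x. F N x \<partial>M) \<longlonglongrightarrow> (\<integral>x. f x \<partial>M)" by (simp add: LIM_zero_iff)
  then show ?thesis by (auto simp: convergent_def)
qed


section \<open>Measure preserving actions of the integers\<close>

definition mpt :: "'a measure \<Rightarrow> ('a \<Rightarrow> 'a) \<Rightarrow> bool" where
  "mpt M G \<longleftrightarrow> G \<in> M \<rightarrow>\<^sub>M M \<and> (\<forall>A\<in>sets M. emeasure M (G -` A \<inter> space M) = emeasure M A)"

lemma mpt_measurable: "mpt M G \<Longrightarrow> G \<in> M \<rightarrow>\<^sub>M M"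
  and mpt_measure: "mpt M G \<Longrightarrow> A \<in> sets M \<Longrightarrow> measure M (G -` A \<inter> space M) = measure M A"
  and mpt_space: "mpt M G \<Longrightarrow> x \<in> space M \<Longrightarrow> G x \<in> space M"
  by (auto simp: mpt_def measure_def dest: measurable_space)

lemma mpt_comp: "mpt M F \<Longrightarrow> mpt M G \<Longrightarrow> mpt M (\<lambda>x. F (G x))"
proof -
  assume F: "mpt M F" and G: "mpt M G"
  have "emeasure M ((\<lambda>x. F (G x)) -` A \<inter> space M) = emeasure M A" if A: "A \<in> sets M" for A
  proof -
    have "(\<lambda>x. F (G x)) -` A \<inter> space M = G -` (F -` A \<inter> space M) \<inter> space M"
      using mpt_space[OF G] by auto
    then show ?thesis
      using F G A measurable_sets[OF mpt_measurable[OF F] A] by (simp add: mpt_def del: vimage_Int)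
  qed
  then show ?thesis
    using measurable_compose[OF mpt_measurable[OF G] mpt_measurable[OF F]] by (auto simp: mpt_def)
qed

lemma mpt_cong: "mpt M F \<Longrightarrow> (\<And>x. x \<in> space M \<Longrightarrow> G x = F x) \<Longrightarrow> mpt M G"
proof -
  assume F: "mpt M F" and eq: "\<And>x. x \<in> space M \<Longrightarrow> G x = F x"
  have "G -` A \<inter> space M = F -` A \<inter> space M" for A using eq by auto
  moreover have "G \<in> M \<rightarrow>\<^sub>M M" using mpt_measurable[OF F] measurable_cong[of M G F M] eq by simp
  ultimately show ?thesis using F by (simp add: mpt_def)
qed

definition int_action :: "'a measure \<Rightarrow> (int \<Rightarrow> 'a \<Rightarrow> 'a) \<Rightarrow> bool" where
  "int_action M U \<longleftrightarrow> (\<forall>k. mpt M (U k)) \<and> (\<forall>x\<in>space M. U 0 x = x) \<and>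
     (\<forall>k l. \<forall>x\<in>space M. U k (U l x) = U (k + l) x)"

context
  fixes M :: "'a measure" and U :: "int \<Rightarrow> 'a \<Rightarrow> 'a"
  assumes U: "int_action M U"
begin

lemma act_mpt: "mpt M (U k)" and act_zero: "x \<in> space M \<Longrightarrow> U 0 x = x"
  and act_add: "x \<in> space M \<Longrightarrow> U k (U l x) = U (k + l) x"
  using U by (auto simp: int_action_def)

lemma act_bij_betw: "bij_betw (U k) (space M) (space M)"
  by (rule bij_betwI[of _ _ _ "U (- k)"]) (auto simp: act_add act_zero mpt_space[OF act_mpt])

lemma act_inv_into: "x \<in> space M \<Longrightarrow> inv_into (space M) (U k) x = U (- k) x"
  using act_bij_betw[of k]
  by (intro inv_into_f_eq) (auto simp: bij_betw_def act_add act_zero mpt_space[OF act_mpt])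

lemma act_invertible_mpt: "invertible_mpt M (U k)"
proof -
  have "inv_into (space M) (U k) \<in> M \<rightarrow>\<^sub>M M"
    using mpt_measurable[OF mpt_cong[OF act_mpt act_inv_into]] .
  then show ?thesis
    using act_bij_betw[of k] act_mpt[of k] by (simp add: invertible_mpt_def mpt_def)
qed

lemma act_funpow: "x \<in> space M \<Longrightarrow> (U k ^^ n) x = U (k * int n) x"
proof (induction n)
  case (Suc n)
  then show ?case by (simp add: act_add algebra_simps)
qed (simp add: act_zero)

lemma act_int_iterate:
  assumes x: "x \<in> space M"
  shows "int_iterate M (U k) j x = U (k * j) x"
proof (cases "0 \<le> j")
  case True
  then show ?thesis using act_funpow[OF x, where k = k and n = "nat j"] by (simp add: int_iterate_def)
next
  case False
  have "(inv_into (space M) (U k) ^^ n) x = U (- k * int n) x" for n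
  proof (induction n)
    case (Suc n)
    then show ?case
      using x by (simp add: act_inv_into mpt_space[OF act_mpt] act_add algebra_simps)
  qed (simp add: act_zero x)
  from this[of "nat (- j)"] show ?thesis using False by (simp add: int_iterate_def)
qed

lemma act_invariant_set:
  assumes inv: "U d -` A \<inter> space M = A" and x: "x \<in> space M"
  shows "U (d * j) x \<in> A \<longleftrightarrow> x \<in> A"
proof -
  have step: "U d x \<in> A \<longleftrightarrow> x \<in> A" if "x \<in> space M" for x using inv that by auto
  have pos: "U (d * int n) x \<in> A \<longleftrightarrow> x \<in> A" if "x \<in> space M" for n x
    using that
  proof (induction n)
    case (Suc n)
    have "U (d * int (Suc n)) x = U d (U (d * int n) x)"
      using Suc by (simp add: act_add algebra_simps)
    then show ?case using Suc step[OF mpt_space[OF act_mpt, of x "d * int n"]] by simp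
  qed (simp add: act_zero)
  show ?thesis
  proof (cases "0 \<le> j")
    case True
    then show ?thesis using pos[OF x, of "nat j"] by simp
  next
    case False
    then have "U (d * int (nat (- j))) (U (d * j) x) = x"
      using x by (simp add: act_add act_zero)
    then show ?thesis using pos[OF mpt_space[OF act_mpt[of "d * j"] x], of "nat (- j)"] by simp
  qed
qed

end

definition conj_by :: "('a \<Rightarrow> 'a) \<Rightarrow> ('b \<Rightarrow> 'a \<Rightarrow> 'a) \<Rightarrow> 'b \<Rightarrow> 'a \<Rightarrow> 'a" where
  "conj_by \<phi> U k x = \<phi> (U k (\<phi> x))"

context
  fixes M :: "'a measure" and U :: "int \<Rightarrow> 'a \<Rightarrow> 'a" and \<phi> :: "'a \<Rightarrow> 'a"
  assumes U: "int_action M U" and \<phi>: "mpt M \<phi>" and invol: "\<And>x. x \<in> space M \<Longrightarrow> \<phi> (\<phi> x) = x"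
begin

lemma conj_int_action: "int_action M (conj_by \<phi> U)"
  unfolding int_action_def
proof (intro conjI allI ballI)
  show "mpt M (conj_by \<phi> U k)" for k
    unfolding conj_by_def[abs_def] by (rule mpt_comp[OF \<phi> mpt_comp[OF act_mpt[OF U] \<phi>]])
qed (simp_all add: conj_by_def invol act_zero[OF U] act_add[OF U] mpt_space[OF \<phi>] mpt_space[OF act_mpt[OF U]])

lemma conj_ergodic_mpt:
  assumes "ergodic_mpt M (U k)"
  shows "ergodic_mpt M (conj_by \<phi> U k)"
  unfolding ergodic_mpt_def
proof (intro conjI ballI impI)
  show "invertible_mpt M (conj_by \<phi> U k)" by (rule act_invertible_mpt[OF conj_int_action])
  fix A assume A: "A \<in> sets M" and inv: "conj_by \<phi> U k -` A \<inter> space M = A"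
  define B where "B = \<phi> -` A \<inter> space M"
  have B: "B \<in> sets M" unfolding B_def by (rule measurable_sets[OF mpt_measurable[OF \<phi>] A])
  have "U k -` B \<inter> space M = B"
  proof (intro equalityI subsetI)
    fix x assume "x \<in> U k -` B \<inter> space M"
    then have x: "x \<in> space M" "\<phi> (U k x) \<in> A" by (auto simp: B_def)
    then have "\<phi> x \<in> conj_by \<phi> U k -` A \<inter> space M"
      using invol mpt_space[OF \<phi>] by (simp add: conj_by_def)
    then show "x \<in> B" using inv x by (simp add: B_def)
  next
    fix x assume "x \<in> B"
    then have x: "x \<in> space M" "\<phi> x \<in> conj_by \<phi> U k -` A" using inv by (auto simp: B_def)
    then show "x \<in> U k -` B \<inter> space M"
      using invol mpt_space[OF act_mpt[OF U]] by (simp add: conj_by_def B_def)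
  qed
  then have "measure M B = 0 \<or> measure M B = 1" using assms B by (simp add: ergodic_mpt_def)
  then show "measure M A = 0 \<or> measure M A = 1"
    unfolding B_def mpt_measure[OF \<phi> A] .
qed

lemma conj_rigid:
  assumes "rigid M (U k)"
  shows "rigid M (conj_by \<phi> U k)"
proof -
  obtain r :: "nat \<Rightarrow> nat" where r: "\<And>i. 0 < r i"
    and lim: "\<And>A. A \<in> sets M \<Longrightarrow> (\<lambda>i. measure M (A - (U k ^^ r i) -` A)) \<longlonglongrightarrow> 0"
    using assms by (auto simp: rigid_def)
  have "(\<lambda>i. measure M (A - (conj_by \<phi> U k ^^ r i) -` A)) \<longlonglongrightarrow> 0" if A: "A \<in> sets M" for A
  proof -
    define B where "B = \<phi> -` A \<inter> space M"
    have B: "B \<in> sets M" unfolding B_def by (rule measurable_sets[OF mpt_measurable[OF \<phi>] A])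
    have "measure M (A - (conj_by \<phi> U k ^^ r i) -` A) = measure M (B - (U k ^^ r i) -` B)" for i
    proof -
      have sub: "A \<subseteq> space M" using A by (rule sets.sets_into_space)
      have "A - (conj_by \<phi> U k ^^ r i) -` A = A - (conj_by \<phi> U (k * int (r i)) -` A \<inter> space M)"
        using sub by (auto simp: act_funpow[OF conj_int_action])
      also have "\<dots> \<in> sets M"
        by (intro sets.Diff A measurable_sets[OF mpt_measurable[OF act_mpt[OF conj_int_action]] A])
      finally have meas: "A - (conj_by \<phi> U k ^^ r i) -` A \<in> sets M" .
      have "\<phi> -` (A - (conj_by \<phi> U k ^^ r i) -` A) \<inter> space M = B - (U k ^^ r i) -` B"
        by (auto simp: B_def act_funpow[OF U] act_funpow[OF conj_int_action] mpt_space[OF \<phi>]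
            conj_by_def invol mpt_space[OF act_mpt[OF U]])
      then show ?thesis using mpt_measure[OF \<phi> meas] by simp
    qed
    then show ?thesis using lim[OF B] by simp
  qed
  then show ?thesis using r by (auto simp: rigid_def)
qed

end

section \<open>The product of finite cyclic groups\<close>

definition digit :: "(nat \<Rightarrow> real) \<Rightarrow> nat \<Rightarrow> int" where
  "digit x i = \<lfloor>x i\<rfloor>"

text \<open>Points are sequences of digits \<open>digit x i \<in> {0..<q i}\<close>, stored as real numbers, with the uniform
product measure. All maps below are given by integer digits that are reduced by \<open>enc\<close>.\<close>

locale digit_space =
  fixes q :: "nat \<Rightarrow> int"
  assumes q_pos: "0 < q i"
begin

definition digit_measure :: "(nat \<Rightarrow> real) measure" where
  "digit_measure = PiM UNIV (\<lambda>i. uniform_count_measure (real_of_int ` {0..<q i}))"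

definition enc :: "(nat \<Rightarrow> int) \<Rightarrow> nat \<Rightarrow> real" where
  "enc a i = real_of_int (a i mod q i)"

lemma prob_space_component: "prob_space (uniform_count_measure (real_of_int ` {0..<q i}))"
  using q_pos[of i] by (intro prob_space_uniform_count_measure) auto

sublocale product_prob_space "\<lambda>i. uniform_count_measure (real_of_int ` {0..<q i})" UNIV
  by (intro product_prob_spaceI prob_space_component)

lemma space_digit_measure: "space digit_measure = {x. \<forall>i. x i \<in> real_of_int ` {0..<q i}}"
  by (auto simp: digit_measure_def space_PiM space_uniform_count_measure PiE_UNIV_domain)

sublocale D: prob_space digit_measure
  unfolding digit_measure_def by (rule prob_space_PiM) (rule prob_space_component)

lemma digit_range: "x \<in> space digit_measure \<Longrightarrow> 0 \<le> digit x i \<and> digit x i < q i"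
  by (auto simp: space_digit_measure digit_def dest!: spec[of _ i])

lemma digit_mod: "x \<in> space digit_measure \<Longrightarrow> digit x i mod q i = digit x i"
  using digit_range[of x i] by simp

lemma enc_space: "enc a \<in> space digit_measure"
  using q_pos by (auto simp: space_digit_measure enc_def)

lemma digit_enc: "digit (enc a) i = a i mod q i"
  by (simp add: digit_def enc_def)

lemma enc_digit: "x \<in> space digit_measure \<Longrightarrow> enc (digit x) = x"
proof
  fix i assume x: "x \<in> space digit_measure"
  then have "real_of_int \<lfloor>x i\<rfloor> = x i" by (auto simp: space_digit_measure dest!: spec[of _ i])
  then show "enc (digit x) i = x i" using digit_mod[OF x, of i] by (simp add: enc_def digit_def)
qed

lemma digit_eqI:
  assumes "x \<in> space digit_measure" "y \<in> space digit_measure" "\<And>i. digit x i = digit y i"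
  shows "x = y"
  using enc_digit[OF assms(1)] enc_digit[OF assms(2)] assms(3) by (metis ext)

lemma component_measurable:
  "(\<lambda>x. x i) \<in> digit_measure \<rightarrow>\<^sub>M count_space (real_of_int ` {0..<q i})"
proof -
  have "(\<lambda>x. x i) \<in> digit_measure \<rightarrow>\<^sub>M uniform_count_measure (real_of_int ` {0..<q i})"
    unfolding digit_measure_def by (rule measurable_component_singleton) simp
  then show ?thesis
    using measurable_cong_sets[OF refl sets_uniform_count_measure_count_space] by blast
qed

lemma digit_measurable[measurable]: "(\<lambda>x. digit x i) \<in> digit_measure \<rightarrow>\<^sub>M count_space UNIV"
  unfolding digit_def
  by (rule measurable_compose[OF component_measurable]) simp

lemma enc_measurable:
  assumes [measurable]: "\<And>i. (\<lambda>x. g x i) \<in> digit_measure \<rightarrow>\<^sub>M count_space UNIV"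
  shows "(\<lambda>x. enc (g x)) \<in> digit_measure \<rightarrow>\<^sub>M digit_measure"
  unfolding digit_measure_def
proof (rule measurable_PiM_single)
  show "(\<lambda>x. enc (g x)) \<in> space (PiM UNIV (\<lambda>i. uniform_count_measure (real_of_int ` {0..<q i})))
      \<rightarrow> (\<Pi>\<^sub>E i\<in>UNIV. space (uniform_count_measure (real_of_int ` {0..<q i})))"
    using enc_space by (auto simp: digit_measure_def space_PiM)
  fix A :: "real set" and i
  have "{x \<in> space digit_measure. enc (g x) i \<in> A} \<in> sets digit_measure" unfolding enc_def by measurable
  then show "{x \<in> space (PiM UNIV (\<lambda>i. uniform_count_measure (real_of_int ` {0..<q i}))). enc (g x) i \<in> A}
     \<in> sets (PiM UNIV (\<lambda>i. uniform_count_measure (real_of_int ` {0..<q i})))"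
    by (simp add: digit_measure_def)
qed

lemma prob_digits:
  assumes "finite J"
  shows "measure digit_measure {x\<in>space digit_measure. \<forall>i\<in>J. F i (digit x i)} = (\<Prod>i\<in>J. dens (q i) (F i))"
proof -
  let ?X = "\<lambda>i. real_of_int ` {v\<in>{0..<q i}. F i v}"
  have "{x\<in>space digit_measure. \<forall>i\<in>J. F i (digit x i)} = {x\<in>space digit_measure. \<forall>i\<in>J. x i \<in> ?X i}"
  proof (intro Collect_cong conj_cong refl ball_cong)
    fix x i assume x: "x \<in> space digit_measure"
    then obtain v where "x i = real_of_int v" "v \<in> {0..<q i}" by (auto simp: space_digit_measure dest!: spec[of _ i])
    then show "F i (digit x i) = (x i \<in> ?X i)" by (auto simp: digit_def)
  qed
  moreover have "emeasure digit_measure {x\<in>space digit_measure. \<forall>i\<in>J. x i \<in> ?X i}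
     = (\<Prod>i\<in>J. emeasure (uniform_count_measure (real_of_int ` {0..<q i})) (?X i))"
    unfolding digit_measure_def using assms
    by (intro emeasure_PiM_Collect) (auto simp: sets_uniform_count_measure)
  moreover have "emeasure (uniform_count_measure (real_of_int ` {0..<q i})) (?X i) = ennreal (dens (q i) (F i))" for i
  proof -
    have "card (real_of_int ` V) = card V" for V by (rule card_image) (simp add: inj_on_def)
    then have "card (?X i) = card {v\<in>{0..<q i}. F i v}" "card (real_of_int ` {0..<q i}) = card {0..<q i}"
      by simp_all
    then show ?thesis
      using q_pos[of i]
      by (subst emeasure_uniform_count_measure) (auto simp: dens_def divide_ennreal ennreal_of_nat_eq_real_of_nat)
  qed
  ultimately have "emeasure digit_measure {x\<in>space digit_measure. \<forall>i\<in>J. F i (digit x i)} = ennreal (\<Prod>i\<in>J. dens (q i) (F i))"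
    by (simp add: prod_ennreal dens_nonneg[OF q_pos])
  then show ?thesis
    by (simp add: measure_def prod_nonneg dens_nonneg[OF q_pos])
qed

lemma prob_digit: "measure digit_measure {x\<in>space digit_measure. F (digit x i)} = dens (q i) F"
  using prob_digits[of "{i}" "\<lambda>_. F"] by simp

definition cyl :: "nat \<Rightarrow> (nat \<Rightarrow> int) \<Rightarrow> (nat \<Rightarrow> real) set" where
  "cyl k a = {x\<in>space digit_measure. \<forall>i<k. digit x i = a i}"

definition valid :: "(nat \<Rightarrow> int) \<Rightarrow> bool" where
  "valid a \<longleftrightarrow> (\<forall>i. 0 \<le> a i \<and> a i < q i)"

lemma cyl_measurable[measurable]: "cyl k a \<in> sets digit_measure"
  unfolding cyl_def by measurable

lemma prob_cyl: "valid a \<Longrightarrow> measure digit_measure (cyl k a) = (\<Prod>i<k. 1 / q i)"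
proof -
  assume a: "valid a"
  have "measure digit_measure (cyl k a) = (\<Prod>i<k. dens (q i) (\<lambda>v. v = a i))"
    using prob_digits[of "{..<k}" "\<lambda>i v. v = a i"] by (simp add: cyl_def lessThan_def)
  moreover have "dens (q i) (\<lambda>v. v = a i) = 1 / q i" for i
  proof -
    have "{v\<in>{0..<q i}. v = a i} = {a i}" using a by (auto simp: valid_def)
    then show ?thesis by (simp add: dens_def)
  qed
  ultimately show ?thesis by simp
qed

lemma cyl_Int:
  assumes "k \<le> l"
  shows "cyl k a \<inter> cyl l b = cyl l b \<or> cyl k a \<inter> cyl l b = {}"
proof (cases "\<forall>i<k. a i = b i")
  case True
  then show ?thesis using assms by (auto simp: cyl_def)
next
  case False
  then obtain i where "i < k" "a i \<noteq> b i" by blast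
  then have "cyl k a \<inter> cyl l b = {}" using assms by (auto simp: cyl_def)
  then show ?thesis ..
qed

lemma cyl_generates: "sets digit_measure = sigma_sets (space digit_measure) (insert {} {cyl k a |k a. valid a})"
proof (rule antisym)
  let ?E = "insert {} {cyl k a |k a. valid a}"
  have sub: "?E \<subseteq> sets digit_measure" by auto
  then show "sigma_sets (space digit_measure) ?E \<subseteq> sets digit_measure" by (rule sets.sigma_sets_subset)
  interpret S: sigma_algebra "space digit_measure" "sigma_sets (space digit_measure) ?E"
    by (rule sigma_algebra_sigma_sets) (use sub sets.sets_into_space in blast)
  have "sets digit_measure = sigma_sets (space digit_measure)
     {{f\<in>space digit_measure. f i \<in> A} | i A. i \<in> UNIV \<and> A \<in> sets (uniform_count_measure (real_of_int ` {0..<q i}))}"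
    unfolding digit_measure_def sets_PiM_single space_PiM ..
  also have "\<dots> \<subseteq> sigma_sets (space digit_measure) ?E"
  proof (rule S.sigma_sets_subset, rule subsetI)
    fix B assume "B \<in> {{f\<in>space digit_measure. f i \<in> A} | i A. i \<in> UNIV \<and> A \<in> sets (uniform_count_measure (real_of_int ` {0..<q i}))}"
    then obtain i A where B: "B = {f\<in>space digit_measure. f i \<in> A}" by blast
    let ?I = "PiE {..i} (\<lambda>j. {0..<q j})"
    define ext where "ext a j = (if j \<le> i then a j else 0)" for a :: "nat \<Rightarrow> int" and j
    have "B = (\<Union>a\<in>{a\<in>?I. real_of_int (a i) \<in> A}. cyl (Suc i) (ext a))"
    proof (intro equalityI subsetI)
      fix x assume "x \<in> B"
      then have x: "x \<in> space digit_measure" "x i \<in> A" by (auto simp: B)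
      have "real_of_int (digit x i) = x i" using fun_cong[OF enc_digit[OF x(1)], of i] digit_mod[OF x(1), of i]
        by (simp add: enc_def)
      then have "restrict (digit x) {..i} \<in> {a\<in>?I. real_of_int (a i) \<in> A}"
        using x digit_range[OF x(1)] by auto
      moreover have "x \<in> cyl (Suc i) (ext (restrict (digit x) {..i}))"
        using x by (simp add: cyl_def ext_def)
      ultimately show "x \<in> (\<Union>a\<in>{a\<in>?I. real_of_int (a i) \<in> A}. cyl (Suc i) (ext a))" by blast
    next
      fix x assume "x \<in> (\<Union>a\<in>{a\<in>?I. real_of_int (a i) \<in> A}. cyl (Suc i) (ext a))"
      then obtain a where a: "real_of_int (a i) \<in> A" "x \<in> space digit_measure" "\<forall>j<Suc i. digit x j = ext a j"
        by (auto simp: cyl_def)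
      then have "digit x i = a i" by (simp add: ext_def)
      then have "x i = real_of_int (a i)"
        using fun_cong[OF enc_digit[OF a(2)], of i] digit_mod[OF a(2), of i] by (simp add: enc_def)
      then show "x \<in> B" using a by (simp add: B)
    qed
    also have "\<dots> \<in> sigma_sets (space digit_measure) ?E"
    proof (rule S.finite_UN)
      show "finite {a\<in>?I. real_of_int (a i) \<in> A}" by (simp add: finite_PiE)
      fix a assume a: "a \<in> {a\<in>?I. real_of_int (a i) \<in> A}"
      have "0 \<le> ext a j \<and> ext a j < q j" for j
        using a q_pos[of j] PiE_mem[of a "{..i}" "\<lambda>j. {0..<q j}" j] by (auto simp: ext_def)
      then have "cyl (Suc i) (ext a) \<in> ?E" unfolding valid_def by blast
      then show "cyl (Suc i) (ext a) \<in> sigma_sets (space digit_measure) ?E" by (rule sigma_sets.Basic)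
    qed
    finally show "B \<in> sigma_sets (space digit_measure) ?E" .
  qed
  finally show "sets digit_measure \<subseteq> sigma_sets (space digit_measure) ?E" .
qed

lemma measure_eq_on_cylinders:
  assumes "sets N = sets digit_measure" "sets N' = sets digit_measure" and fin: "emeasure N (space digit_measure) \<noteq> \<infinity>"
    and eq: "\<And>k a. valid a \<Longrightarrow> emeasure N (cyl k a) = emeasure N' (cyl k a)"
  shows "N = N'"
proof (rule measure_eqI_generator_eq)
  let ?E = "insert {} {cyl k a |k a. valid a}"
  show "Int_stable ?E"
  proof (rule Int_stableI)
    have *: "cyl k a \<inter> cyl l b \<in> ?E" if "valid a" "valid b" "k \<le> l" for k l a b
      using cyl_Int[OF that(3), of a b] that by auto
    fix A B assume "A \<in> ?E" "B \<in> ?E"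
    then consider "A = {} \<or> B = {}" | k a l b where "A = cyl k a" "B = cyl l b" "valid a" "valid b" by auto
    then show "A \<inter> B \<in> ?E"
    proof cases
      case 2
      then show ?thesis
        using *[of a b k l] *[of b a l k] by (cases "k \<le> l") (auto simp: Int_commute)
    qed auto
  qed
  show "?E \<subseteq> Pow (space digit_measure)" using sets.sets_into_space[OF cyl_measurable] by blast
  show "emeasure N X = emeasure N' X" if "X \<in> ?E" for X using that eq by auto
  show "sets N = sigma_sets (space digit_measure) ?E" "sets N' = sigma_sets (space digit_measure) ?E"
    using assms cyl_generates by simp_all
  have "cyl 0 (\<lambda>_. 0) = space digit_measure" "valid (\<lambda>_. 0)" using q_pos by (auto simp: cyl_def valid_def)
  then show "range (\<lambda>_::nat. space digit_measure) \<subseteq> ?E" by blast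
qed (use fin in auto)

lemma mptI_cyl:
  assumes G: "G \<in> digit_measure \<rightarrow>\<^sub>M digit_measure"
    and eq: "\<And>k a. valid a \<Longrightarrow> measure digit_measure (G -` cyl k a \<inter> space digit_measure) = measure digit_measure (cyl k a)"
  shows "mpt digit_measure G"
proof -
  have "distr digit_measure digit_measure G = digit_measure"
  proof (rule measure_eq_on_cylinders)
    fix k a assume "valid a"
    then show "emeasure (distr digit_measure digit_measure G) (cyl k a) = emeasure digit_measure (cyl k a)"
      using eq[of a k] by (simp add: emeasure_distr[OF G cyl_measurable] D.emeasure_eq_measure)
  qed (use emeasure_distr[OF G sets.top] in \<open>simp_all add: D.emeasure_eq_measure\<close>)
  then show ?thesis unfolding mpt_def using G emeasure_distr[OF G] by metis
qed

text \<open>A permutation of each digit permutes the cylinders of each length, all of which have the same measure.\<close>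

lemma mpt_digitwise:
  assumes "\<And>i v w. 0 \<le> v \<Longrightarrow> v < q i \<Longrightarrow> 0 \<le> w \<Longrightarrow> w < q i \<Longrightarrow> g i v mod q i = w \<longleftrightarrow> v = h i w mod q i"
  shows "mpt digit_measure (\<lambda>x. enc (\<lambda>i. g i (digit x i)))"
proof (rule mptI_cyl)
  show "(\<lambda>x. enc (\<lambda>i. g i (digit x i))) \<in> digit_measure \<rightarrow>\<^sub>M digit_measure"
    by (rule enc_measurable) measurable
  fix k a assume a: "valid a"
  have "(\<lambda>x. enc (\<lambda>i. g i (digit x i))) -` cyl k a \<inter> space digit_measure = cyl k (\<lambda>i. h i (a i) mod q i)"
  proof (rule Set.set_eqI)
    fix x
    have "g i (digit x i) mod q i = a i \<longleftrightarrow> digit x i = h i (a i) mod q i" if "x \<in> space digit_measure" for i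
      using assms[of "digit x i" i "a i"] digit_range[OF that, of i] a by (simp add: valid_def)
    then show "x \<in> (\<lambda>x. enc (\<lambda>i. g i (digit x i))) -` cyl k a \<inter> space digit_measure
        \<longleftrightarrow> x \<in> cyl k (\<lambda>i. h i (a i) mod q i)"
      using enc_space by (auto simp: cyl_def digit_enc)
  qed
  moreover have "valid (\<lambda>i. h i (a i) mod q i)" using q_pos by (simp add: valid_def)
  ultimately show "measure digit_measure ((\<lambda>x. enc (\<lambda>i. g i (digit x i))) -` cyl k a \<inter> space digit_measure) = measure digit_measure (cyl k a)"
    using a by (simp add: prob_cyl)
qed

text \<open>The carrier is a closed subset of the Polish space of real sequences.\<close>

lemma standard_prob_space_digit_measure: "standard_prob_space digit_measure"
  unfolding standard_prob_space_def
proof (intro conjI exI)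
  let ?X = "top_of_set (space digit_measure)"
  show "prob_space digit_measure" by unfold_locales
  have comp: "closed (real_of_int ` {0..<q i})" for i by (rule finite_imp_closed) simp
  have closed: "closed (space digit_measure)"
  proof -
    have "space digit_measure = (\<Inter>i. (\<lambda>x. x i) -` (real_of_int ` {0..<q i}))" by (auto simp: space_digit_measure)
    moreover have "closed ((\<lambda>x::nat \<Rightarrow> real. x i) -` (real_of_int ` {0..<q i}))" for i
      by (rule closed_vimage[OF comp continuous_on_product_coordinates])
    ultimately show ?thesis by (auto intro!: closed_INT)
  qed
  show "completely_metrizable_space ?X"
    by (rule completely_metrizable_space_closedin[OF completely_metrizable_space_euclidean]) (use closed in simp)
  show "second_countable ?X"
  proof (rule second_countable_subtopology)
    obtain \<B> :: "(nat \<Rightarrow> real) set set" where \<B>: "countable \<B>" "\<And>C. C \<in> \<B> \<Longrightarrow> open C"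
      "\<And>S. open S \<Longrightarrow> \<exists>V. V \<subseteq> \<B> \<and> S = \<Union>V"
      by (rule univ_second_countable) blast
    have "\<exists>V\<in>\<B>. x \<in> V \<and> V \<subseteq> U" if "open U" "x \<in> U" for U x
      using \<B>(3)[OF that(1)] that(2) by blast
    then show "second_countable (euclidean :: (nat \<Rightarrow> real) topology)"
      using \<B>(1,2) unfolding second_countable_def by auto
  qed
  show "topspace ?X = space digit_measure" by simp
  show "sets digit_measure = sigma_sets (topspace ?X) {U. openin ?X U}"
  proof (rule antisym)
    interpret S: sigma_algebra "space digit_measure" "sigma_sets (space digit_measure) {U. openin ?X U}"
      by (rule sigma_algebra_sigma_sets) (use openin_imp_subset in blast)
    have "sets digit_measure = sigma_sets (space digit_measure)
     {{f\<in>space digit_measure. f i \<in> A} | i A. i \<in> UNIV \<and> A \<in> sets (uniform_count_measure (real_of_int ` {0..<q i}))}"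
      unfolding digit_measure_def sets_PiM_single space_PiM ..
    also have "\<dots> \<subseteq> sigma_sets (space digit_measure) {U. openin ?X U}"
    proof (rule S.sigma_sets_subset, rule subsetI)
      fix B assume "B \<in> {{f\<in>space digit_measure. f i \<in> A} | i A. i \<in> UNIV \<and> A \<in> sets (uniform_count_measure (real_of_int ` {0..<q i}))}"
      then obtain i A where B: "B = {f\<in>space digit_measure. f i \<in> A}" and A: "A \<subseteq> real_of_int ` {0..<q i}"
        by (auto simp: sets_uniform_count_measure)
      have "closed A" using A by (intro finite_imp_closed finite_subset[OF A]) simp
      then have "open ((\<lambda>x::nat \<Rightarrow> real. x i) -` (- A))"
        by (intro open_vimage continuous_on_product_coordinates) auto
      then have "openin ?X (space digit_measure \<inter> (\<lambda>x. x i) -` (- A))" by (rule openin_open_Int)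
      then have "space digit_measure - (space digit_measure \<inter> (\<lambda>x. x i) -` (- A)) \<in> sigma_sets (space digit_measure) {U. openin ?X U}"
        by (intro sigma_sets.Compl sigma_sets.Basic) simp
      also have "space digit_measure - (space digit_measure \<inter> (\<lambda>x. x i) -` (- A)) = B" by (auto simp: B)
      finally show "B \<in> sigma_sets (space digit_measure) {U. openin ?X U}" .
    qed
    finally show "sets digit_measure \<subseteq> sigma_sets (topspace ?X) {U. openin ?X U}" by simp
    have "(\<lambda>x. x) \<in> digit_measure \<rightarrow>\<^sub>M (PiM UNIV (\<lambda>_. borel))"
    proof (rule measurable_PiM_single')
      show "(\<lambda>x. x i) \<in> digit_measure \<rightarrow>\<^sub>M borel" for i
        by (rule measurable_compose[OF component_measurable, of "\<lambda>x. x"]) simp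
    qed simp
    then have id: "(\<lambda>x. x) \<in> digit_measure \<rightarrow>\<^sub>M borel" by (simp add: measurable_cong_sets[OF refl sets_PiM_equal_borel])
    have "{U. openin ?X U} \<subseteq> sets digit_measure"
    proof
      fix U assume "U \<in> {U. openin ?X U}"
      then obtain V where V: "open V" "U = space digit_measure \<inter> V"
        unfolding mem_Collect_eq openin_open by (elim exE conjE)
      have "(\<lambda>x. x) -` V \<inter> space digit_measure \<in> sets digit_measure" by (rule measurable_sets[OF id borel_open[OF V(1)]])
      also have "(\<lambda>x. x) -` V \<inter> space digit_measure = U" unfolding V(2) by blast
      finally show "U \<in> sets digit_measure" .
    qed
    then show "sigma_sets (topspace ?X) {U. openin ?X U} \<subseteq> sets digit_measure"
      unfolding topspace_euclidean_subtopology by (rule sets.sigma_sets_subset)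
  qed
qed


lemma sets_mpt_sym_diff:
  assumes "mpt digit_measure H" "mpt digit_measure H'" "B \<in> sets digit_measure"
  shows "{x\<in>space digit_measure. (H x \<in> B) \<noteq> (H' x \<in> B)} \<in> sets digit_measure"
proof -
  have "{x\<in>space digit_measure. (H x \<in> B) \<noteq> (H' x \<in> B)}
      = ((H -` B \<inter> space digit_measure) - (H' -` B \<inter> space digit_measure)) \<union> ((H' -` B \<inter> space digit_measure) - (H -` B \<inter> space digit_measure))"
    by blast
  then show ?thesis
    using measurable_sets[OF mpt_measurable[OF assms(1)] assms(3)]
      measurable_sets[OF mpt_measurable[OF assms(2)] assms(3)] by (simp only: sets.Un sets.Diff)
qed

text \<open>If each digit of \<open>G k x\<close> agrees in the limit with that of \<open>F x\<close>, then \<open>G k\<close> converges to \<open>F\<close> on every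
measurable set: the sets with this property contain those that depend on one digit and form a
sigma-algebra. Invariance of the measure is used for countable unions, where the tail has to be small
under all \<open>G k\<close> simultaneously.\<close>

lemma digitwise_approx:
  assumes G: "\<And>k. mpt digit_measure (G k)" and F: "mpt digit_measure F"
    and coord: "\<And>i. (\<lambda>k. D.prob {x\<in>space digit_measure. digit (G k x) i \<noteq> digit (F x) i}) \<longlonglongrightarrow> 0"
    and A: "A \<in> sets digit_measure"
  shows "(\<lambda>k. D.prob {x\<in>space digit_measure. (G k x \<in> A) \<noteq> (F x \<in> A)}) \<longlonglongrightarrow> 0"
proof -
  have gen: "sets digit_measure = sigma_sets (space digit_measure)
     {{f\<in>space digit_measure. f i \<in> A} | i A. i \<in> UNIV \<and> A \<in> sets (uniform_count_measure (real_of_int ` {0..<q i}))}"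
    unfolding digit_measure_def sets_PiM_single space_PiM ..
  from A[unfolded gen] show ?thesis
  proof (induction rule: sigma_sets.induct)
    case (Basic a)
    then obtain i B where a: "a = {f\<in>space digit_measure. f i \<in> B}" by blast
    have coord_eq: "x i = real_of_int (digit x i)" if "x \<in> space digit_measure" for x
      using that by (auto simp: space_digit_measure digit_def dest!: spec[of _ i])
    have "D.prob {x\<in>space digit_measure. (G k x \<in> a) \<noteq> (F x \<in> a)} \<le> D.prob {x\<in>space digit_measure. digit (G k x) i \<noteq> digit (F x) i}" for k
    proof (rule D.finite_measure_mono)
      show "{x\<in>space digit_measure. (G k x \<in> a) \<noteq> (F x \<in> a)} \<subseteq> {x\<in>space digit_measure. digit (G k x) i \<noteq> digit (F x) i}"
      proof (rule subsetI, rule CollectI, rule conjI)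
        fix x assume x: "x \<in> {x\<in>space digit_measure. (G k x \<in> a) \<noteq> (F x \<in> a)}"
        then show "x \<in> space digit_measure" by simp
        then have sp: "G k x \<in> space digit_measure" "F x \<in> space digit_measure" using mpt_space[OF G] mpt_space[OF F] by auto
        then have "G k x i \<noteq> F x i" using x by (auto simp: a)
        then show "digit (G k x) i \<noteq> digit (F x) i"
          using coord_eq[OF sp(1)] coord_eq[OF sp(2)] by auto
      qed
      note mpt_measurable[OF G, measurable] mpt_measurable[OF F, measurable]
      have [measurable]: "(\<lambda>x. digit (G k x) i) \<in> digit_measure \<rightarrow>\<^sub>M count_space UNIV"
        "(\<lambda>x. digit (F x) i) \<in> digit_measure \<rightarrow>\<^sub>M count_space UNIV"
        by (rule measurable_compose[OF mpt_measurable[OF G] digit_measurable])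
           (rule measurable_compose[OF mpt_measurable[OF F] digit_measurable])
      show "{x\<in>space digit_measure. digit (G k x) i \<noteq> digit (F x) i} \<in> D.events" by measurable
    qed
    then show ?case
      by (intro tendsto_sandwich[OF _ _ tendsto_const coord[of i]]) auto
  next
    case Empty
    then show ?case by simp
  next
    case (Compl a)
    have "{x\<in>space digit_measure. (G k x \<in> space digit_measure - a) \<noteq> (F x \<in> space digit_measure - a)}
        = {x\<in>space digit_measure. (G k x \<in> a) \<noteq> (F x \<in> a)}" for k
      using mpt_space[OF G] mpt_space[OF F] by auto
    then show ?case using Compl by simp
  next
    case (Union a)
    have a: "a i \<in> sets digit_measure" for i using Union.hyps gen by blast
    let ?A = "\<Union>i. a i"
    show ?case
    proof (rule LIMSEQ_I)
      fix \<epsilon> :: real assume \<epsilon>: "\<epsilon> > 0"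
      have "(\<lambda>n. D.prob (\<Union>i<n. a i)) \<longlonglongrightarrow> D.prob (\<Union>n. \<Union>i<n. a i)"
      proof (rule D.finite_Lim_measure_incseq)
        show "incseq (\<lambda>n. \<Union>i<n. a i)" unfolding incseq_def by (intro allI impI UN_mono) auto
      qed (use a in auto)
      also have "(\<Union>n. \<Union>i<n. a i) = ?A" by auto
      finally have "\<forall>\<^sub>F n in sequentially. D.prob ?A - \<epsilon> / 4 < D.prob (\<Union>i<n. a i)"
        by (rule order_tendstoD(1)) (use \<epsilon> in simp)
      then obtain n where n: "D.prob ?A - \<epsilon> / 4 < D.prob (\<Union>i<n. a i)"
        by (auto simp: eventually_sequentially)
      define R where "R = ?A - (\<Union>i<n. a i)"
      have R: "R \<in> sets digit_measure" using a by (auto simp: R_def)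
      have "D.prob R = D.prob ?A - D.prob (\<Union>i<n. a i)"
        unfolding R_def by (rule D.finite_measure_Diff) (use a in auto)
      then have probR: "D.prob R < \<epsilon> / 4" using n by simp
      have "(\<lambda>k. \<Sum>i<n. D.prob {x\<in>space digit_measure. (G k x \<in> a i) \<noteq> (F x \<in> a i)}) \<longlonglongrightarrow> (\<Sum>i<n. 0)"
        by (intro tendsto_sum Union.IH)
      then have "\<forall>\<^sub>F k in sequentially. (\<Sum>i<n. D.prob {x\<in>space digit_measure. (G k x \<in> a i) \<noteq> (F x \<in> a i)}) < \<epsilon> / 4"
        by (intro order_tendstoD(2)) (use \<epsilon> in auto)
      then obtain k0 where k0: "\<And>k. k \<ge> k0 \<Longrightarrow>
          (\<Sum>i<n. D.prob {x\<in>space digit_measure. (G k x \<in> a i) \<noteq> (F x \<in> a i)}) < \<epsilon> / 4"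
        by (auto simp: eventually_sequentially)
      have "D.prob {x\<in>space digit_measure. (G k x \<in> ?A) \<noteq> (F x \<in> ?A)} < \<epsilon>" if "k \<ge> k0" for k
      proof -
        let ?D = "\<Union>i<n. {x\<in>space digit_measure. (G k x \<in> a i) \<noteq> (F x \<in> a i)}"
        have meas: "?D \<in> D.events" "G k -` R \<inter> space digit_measure \<in> D.events" "F -` R \<inter> space digit_measure \<in> D.events"
          using sets_mpt_sym_diff[OF G F a] measurable_sets[OF mpt_measurable[OF G] R]
            measurable_sets[OF mpt_measurable[OF F] R] by auto
        have "{x\<in>space digit_measure. (G k x \<in> ?A) \<noteq> (F x \<in> ?A)}
            \<subseteq> ?D \<union> ((G k -` R \<inter> space digit_measure) \<union> (F -` R \<inter> space digit_measure))"
          unfolding R_def by blast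
        then have "D.prob {x\<in>space digit_measure. (G k x \<in> ?A) \<noteq> (F x \<in> ?A)}
            \<le> D.prob (?D \<union> ((G k -` R \<inter> space digit_measure) \<union> (F -` R \<inter> space digit_measure)))"
          by (rule D.finite_measure_mono) (use meas in auto)
        moreover have "\<dots> \<le> D.prob ?D + D.prob ((G k -` R \<inter> space digit_measure) \<union> (F -` R \<inter> space digit_measure))"
          by (rule measure_Un_le) (use meas in auto)
        moreover have "D.prob ((G k -` R \<inter> space digit_measure) \<union> (F -` R \<inter> space digit_measure)) \<le> D.prob R + D.prob R"
          using measure_Un_le[OF meas(2,3)] mpt_measure[OF G R] mpt_measure[OF F R] by simp
        moreover have "D.prob ?D \<le> (\<Sum>i<n. D.prob {x\<in>space digit_measure. (G k x \<in> a i) \<noteq> (F x \<in> a i)})"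
          by (rule D.finite_measure_subadditive_finite) (use sets_mpt_sym_diff[OF G F a] in auto)
        ultimately show ?thesis using probR k0[OF that] \<epsilon> by linarith
      qed
      then show "\<exists>no. \<forall>k\<ge>no. norm (D.prob {x\<in>space digit_measure. (G k x \<in> ?A) \<noteq> (F x \<in> ?A)} - 0) < \<epsilon>"
        by auto
    qed
  qed
qed

end


section \<open>The skew product over an odometer\<close>

text \<open>Tolerances for the error events. They have to be summable, and \<open>2 * (\<Sum>i<k. tol i) + 4 * tol k \<le> 1 / 8\<close>
leaves a gap between the averages at even and at odd stages.\<close>

definition tol :: "nat \<Rightarrow> real" where
  "tol i = (1 / 2) ^ i / 64"

lemma tol_pos: "tol i > 0" by (simp add: tol_def)

lemma tol_tendsto: "tol \<longlonglongrightarrow> 0"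
proof -
  have "(\<lambda>i. (1 / 2 :: real) ^ i / 64) \<longlonglongrightarrow> 0 / 64" by (intro tendsto_intros LIMSEQ_power_zero) auto
  then show ?thesis by (simp add: tol_def[abs_def])
qed

lemma tol_sums: "(\<lambda>j. tol (k + j)) sums (2 * tol k)"
proof -
  have "(\<lambda>j. tol k * (1 / 2) ^ j) sums (tol k * (1 / (1 - 1 / 2)))"
    by (intro sums_mult geometric_sums) simp
  then show ?thesis by (simp add: tol_def power_add mult.commute)
qed

lemma sum_tol_le: "(\<Sum>i<k. tol i) \<le> 1 / 32"
proof -
  have "(\<Sum>i<k. tol (0 + i)) \<le> 2 * tol 0"
    using sum_le_suminf[OF sums_summable[OF tol_sums[of 0]], of "{..<k}"] tol_pos
    by (simp add: less_imp_le sums_unique[OF tol_sums[of 0], symmetric, simplified])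
  then show ?thesis by (simp add: tol_def)
qed

lemma tendsto_zero_le_tol:
  assumes "\<And>k. 0 \<le> f k" "\<And>k. f k \<le> 2 * tol k"
  shows "f \<longlonglongrightarrow> 0"
proof (rule tendsto_sandwich[of "\<lambda>_. 0" f _ "\<lambda>k. 2 * tol k"])
  show "(\<lambda>k. 2 * tol k) \<longlonglongrightarrow> 0" using tendsto_mult_left[OF tol_tendsto, of 2] by simp
  show "\<forall>\<^sub>F k in sequentially. 0 \<le> f k" "\<forall>\<^sub>F k in sequentially. f k \<le> 2 * tol k"
    using assms by (auto intro: always_eventually)
qed (rule tendsto_const)

lemma odd_card_sym_diff:
  assumes "finite A" "finite B"
  shows "odd (card ((A - B) \<union> (B - A))) \<longleftrightarrow> odd (card A) \<noteq> odd (card B)"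
proof -
  have "card ((A - B) \<union> (B - A)) = card (A - B) + card (B - A)"
    using assms by (intro card_Un_disjoint) auto
  moreover have "card A = card (A - B) + card (A \<inter> B)"
    using assms by (metis card_Diff_subset_Int card_mono finite_Int inf_le1 le_add_diff_inverse2)
  moreover have "card B = card (B - A) + card (A \<inter> B)"
    using assms by (metis card_Diff_subset_Int card_mono finite_Int inf_le1 inf_commute le_add_diff_inverse2)
  ultimately show ?thesis by presburger
qed

text \<open>A sequence of patterns on cyclic groups of pairwise coprime orders, each slow on the time scale
\<open>m * P 0 * \<dots> * P (i - 1)\<close> on which the previous ones complete their periods. The
number \<open>m\<close> is the common time step of the averages; coprimality with \<open>m\<close> makes sampling along
multiples of \<open>m\<close> as good as sampling at all times.\<close>

locale tower =
  fixes P :: "nat \<Rightarrow> int" and S :: "nat \<Rightarrow> int \<Rightarrow> bool" and z :: "nat \<Rightarrow> int \<Rightarrow> int"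
    and n0 :: "nat \<Rightarrow> int" and m :: int
  assumes m_nonzero: "m \<noteq> 0"
    and pattern: "swap_pattern (P i) (S i) (z i)"
    and coprime_below: "coprime (P i) (m * (\<Prod>j<i. P j))"
    and slow: "dens (P i) (\<lambda>v. S i (v + 1) \<noteq> S i v) * real_of_int (\<bar>m\<bar> * (\<Prod>j<i. P j)) \<le> tol i"
    and shift_invisible: "dens (P i) (\<lambda>n. S i (n + z i v) \<noteq> S i n) \<le> tol i"
    and shift_flips: "dens (P i) (\<lambda>v. S i (v + z i v) = S i v) \<le> tol i"
    and half_turn: "dens (P i) (\<lambda>v. S i (v + n0 i) = S i v) \<le> tol i"
begin

lemma P_pos: "0 < P i" and periodic_S: "periodic (P i) (S i)" and periodic_z: "periodic (P i) (z i)"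
  and z_involution: "z i (v + z i v) = - z i v"
  using pattern[of i] by (auto simp: swap_pattern_def)

lemma S_mod [simp]: "S i (v mod P i) = S i v" "S i (v mod P i + n) = S i (v + n)"
    "S i ((v + n) mod P i + k) = S i (v + n + k)" "S i ((v + n) mod P i - k) = S i (v + n - k)"
  by (rule periodic_cong[OF periodic_S], simp add: cong_def mod_simps)+

definition period :: "nat \<Rightarrow> int" where
  "period k = (\<Prod>j<k. P j)"

lemma period_pos: "0 < period k"
  unfolding period_def by (intro prod_pos) (simp add: P_pos)

lemma P_dvd_period: "i < k \<Longrightarrow> P i dvd period k"
  unfolding period_def by (rule dvd_prodI) auto

lemma period_Suc: "period (Suc k) = period k * P k"
  by (simp add: period_def)

text \<open>A pattern on the trivial group cannot be inverted by a shift.\<close>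

lemma P_ge_2: "2 \<le> P i"
proof (rule ccontr)
  assume "\<not> 2 \<le> P i"
  then have "P i = 1" using P_pos[of i] by linarith
  then have "S i (v + n0 i) = S i v" for v using S_mod(1)[of i v] S_mod(1)[of i "v + n0 i"] by simp
  then have "dens (P i) (\<lambda>v. S i (v + n0 i) = S i v) = 1" by (simp add: dens_True[OF P_pos])
  moreover have "tol i \<le> 1 / 64" by (simp add: tol_def power_le_one)
  ultimately show False using half_turn[of i] by simp
qed

lemma period_mono: "k \<le> l \<Longrightarrow> period k \<le> period l"
proof (induction l rule: dec_induct)
  case (step l)
  have "period l * 1 \<le> period l * P l" using P_pos[of l] period_pos[of l] by (intro mult_left_mono) auto
  then show ?case using step by (simp add: period_Suc)
qed simp

lemma period_strict_mono: "strict_mono period"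
proof (rule strict_monoI_Suc)
  fix k
  have "period k * 1 < period k * P k"
    using P_ge_2[of k] period_pos[of k] by (intro mult_strict_left_mono) auto
  then show "period k < period (Suc k)" by (simp add: period_Suc)
qed

lemma coprime_m: "coprime (P i) m" and coprime_period: "coprime (P i) (period i)"
  using coprime_below[of i] by (simp_all add: period_def)

lemma coprime_P: "i \<noteq> j \<Longrightarrow> coprime (P i) (P j)"
proof -
  have *: "coprime (P i) (P j)" if "j < i" for i j
    using coprime_period[of i] P_dvd_period[OF that] coprime_divisors[of "P i" "P i" "P j" "period i"]
    by simp
  assume "i \<noteq> j"
  then show ?thesis using *[of i j] *[of j i] by (cases "j < i") (auto simp: coprime_commute)
qed

lemma dens_change_far: "dens (P i) (\<lambda>v. S i (v + n) \<noteq> S i v) \<le> tol i"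
  if "k \<le> i" "\<bar>n\<bar> \<le> \<bar>m\<bar> * period k" for n
proof -
  let ?s = "dens (P i) (\<lambda>v. S i (v + 1) \<noteq> S i v)"
  have "dens (P i) (\<lambda>v. S i (v + n) \<noteq> S i v) \<le> real_of_int \<bar>n\<bar> * ?s"
    by (rule dens_change_le[OF P_pos periodic_S])
  also have "\<bar>m\<bar> * period k \<le> \<bar>m\<bar> * period i"
    using period_mono[OF that(1)] by (intro mult_left_mono) auto
  then have "real_of_int \<bar>n\<bar> * ?s \<le> real_of_int (\<bar>m\<bar> * period i) * ?s"
    using that(2) by (intro mult_right_mono dens_nonneg[OF P_pos]) linarith
  also have "\<dots> \<le> tol i" using slow[of i] by (simp add: period_def mult.commute)
  finally show ?thesis .
qed

lemma dens_change_any: "dens (P i) (\<lambda>v. S i (v + n) \<noteq> S i v) \<le> real_of_int \<bar>n\<bar> * tol i"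
proof -
  let ?s = "dens (P i) (\<lambda>v. S i (v + 1) \<noteq> S i v)"
  have "1 \<le> \<bar>m\<bar> * period i"
    using m_nonzero period_pos[of i] mult_pos_pos[of "\<bar>m\<bar>" "period i"] by linarith
  then have "?s * 1 \<le> ?s * real_of_int (\<bar>m\<bar> * period i)"
    by (intro mult_left_mono dens_nonneg[OF P_pos]) linarith
  then have "?s \<le> tol i" using slow[of i] by (simp add: period_def)
  then have "real_of_int \<bar>n\<bar> * ?s \<le> real_of_int \<bar>n\<bar> * tol i" by (intro mult_left_mono) auto
  then show ?thesis using dens_change_le[OF P_pos periodic_S, of i n] by linarith
qed

sublocale digit_space "case_nat 2 P"
  by unfold_locales (simp add: P_pos split: nat.split)

text \<open>Digit 0 is the fibre coordinate in \<open>{0, 1}\<close>, digit \<open>Suc i\<close> the coordinate in the cyclic group of order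
\<open>P i\<close>. Formally the rotation by \<open>n\<close> adds to the fibre coordinate the coboundary of the divergent sum
of all \<open>S i\<close>. The coboundary is a sum over the levels at which \<open>S i\<close> changes, and there are almost surely
only finitely many of them because the patterns are slow.\<close>

definition changes :: "int \<Rightarrow> (nat \<Rightarrow> real) \<Rightarrow> nat set" where
  "changes n x = {i. S i (digit x (Suc i) + n) \<noteq> S i (digit x (Suc i))}"

definition good :: "(nat \<Rightarrow> real) \<Rightarrow> bool" where
  "good x \<longleftrightarrow> (\<forall>n. finite (changes n x))"

text \<open>On the null set of points that are not good the fibre coordinate is left alone; this keeps the rotations
an action on the whole space.\<close>

definition turns :: "int \<Rightarrow> (nat \<Rightarrow> real) \<Rightarrow> int" where
  "turns n x = (if good x \<and> odd (card (changes n x)) then 1 else 0)"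

definition rot :: "int \<Rightarrow> (nat \<Rightarrow> real) \<Rightarrow> nat \<Rightarrow> real" where
  "rot n x = enc (case_nat (digit x 0 + turns n x) (\<lambda>i. digit x (Suc i) + n))"

definition flip :: "(nat \<Rightarrow> real) \<Rightarrow> nat \<Rightarrow> real" where
  "flip x = enc (\<lambda>i. case_nat (digit x i + 1) (\<lambda>j. digit x i) i)"

definition shuffle :: "(nat \<Rightarrow> real) \<Rightarrow> nat \<Rightarrow> real" where
  "shuffle x = enc (\<lambda>i. case_nat (digit x i) (\<lambda>j. digit x i + z j (digit x i)) i)"

lemma rot_space: "rot n x \<in> space digit_measure" and flip_space: "flip x \<in> space digit_measure"
  and shuffle_space: "shuffle x \<in> space digit_measure"
  by (simp_all add: rot_def flip_def shuffle_def enc_space)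

lemma digit0_cases: "x \<in> space digit_measure \<Longrightarrow> digit x 0 = 0 \<or> digit x 0 = 1"
  using digit_range[of x 0] by auto

lemma digit_Suc_mod: "x \<in> space digit_measure \<Longrightarrow> digit x (Suc i) mod P i = digit x (Suc i)"
  using digit_mod[of x "Suc i"] by simp

lemma digit_rot: "digit (rot n x) 0 = (digit x 0 + turns n x) mod 2"
    "digit (rot n x) (Suc i) = (digit x (Suc i) + n) mod P i"
  and digit_flip: "digit (flip x) 0 = (digit x 0 + 1) mod 2"
    "x \<in> space digit_measure \<Longrightarrow> digit (flip x) (Suc i) = digit x (Suc i)"
  and digit_shuffle: "x \<in> space digit_measure \<Longrightarrow> digit (shuffle x) 0 = digit x 0"
    "digit (shuffle x) (Suc i) = (digit x (Suc i) + z i (digit x (Suc i))) mod P i"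
  using digit_Suc_mod[of x i] digit_range[of x 0]
  by (simp_all add: rot_def flip_def shuffle_def digit_enc)

lemma turns_cases: "turns n x = 0 \<or> turns n x = 1"
  by (simp add: turns_def)

text \<open>The cocycle identity: modulo 2, cardinalities are additive under symmetric difference.\<close>

lemma changes_rot: "changes k (rot l x) = (changes (l + k) x - changes l x) \<union> (changes l x - changes (l + k) x)"
  by (auto simp: changes_def digit_rot add.assoc)

lemma good_rot: "good (rot l x) \<longleftrightarrow> good x"
proof
  assume "good x"
  then show "good (rot l x)" unfolding good_def changes_rot by auto
next
  assume g: "good (rot l x)"
  have "changes n x \<subseteq> changes (n - l) (rot l x) \<union> changes (- l) (rot l x)" for n
    by (auto simp: changes_def digit_rot)
  then show "good x" using g finite_subset unfolding good_def by (metis finite_UnI)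
qed

lemma rot_add: "x \<in> space digit_measure \<Longrightarrow> rot k (rot l x) = rot (k + l) x"
proof (rule digit_eqI[OF rot_space rot_space])
  fix i
  show "digit (rot k (rot l x)) i = digit (rot (k + l) x) i"
  proof (cases i)
    case 0
    have "(turns l x + turns k (rot l x)) mod 2 = turns (k + l) x"
    proof (cases "good x")
      case True
      then have "odd (card (changes k (rot l x))) \<longleftrightarrow> odd (card (changes (l + k) x)) \<noteq> odd (card (changes l x))"
        unfolding changes_rot by (intro odd_card_sym_diff) (auto simp: good_def)
      then show ?thesis using True by (auto simp: turns_def good_rot add.commute)
    qed (simp add: turns_def good_rot)
    then show ?thesis using 0 by (simp add: digit_rot mod_simps add.assoc) (metis mod_add_right_eq)
  qed (simp add: digit_rot mod_simps algebra_simps)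
qed

lemma rot_0: "x \<in> space digit_measure \<Longrightarrow> rot 0 x = x"
proof (rule digit_eqI[OF rot_space])
  fix i assume x: "x \<in> space digit_measure"
  have "changes 0 x = {}" by (simp add: changes_def)
  then have "turns 0 x = 0" by (simp add: turns_def)
  then show "digit (rot 0 x) i = digit x i"
    using digit_Suc_mod[OF x] digit_range[OF x, of 0] by (cases i) (simp_all add: digit_rot)
qed

lemma mpt_flip: "mpt digit_measure flip"
proof -
  have "mpt digit_measure (\<lambda>x. enc (\<lambda>i. (\<lambda>i v. case_nat (v + 1) (\<lambda>j. v) i) i (digit x i)))"
  proof (rule mpt_digitwise[where h = "\<lambda>i w. case_nat (w - 1) (\<lambda>j. w) i"])
    fix i v w assume "0 \<le> v" "v < case_nat 2 P i" "0 \<le> w" "w < case_nat 2 P i"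
    then show "case_nat (v + 1) (\<lambda>j. v) i mod case_nat 2 P i = w
        \<longleftrightarrow> v = case_nat (w - 1) (\<lambda>j. w) i mod case_nat 2 P i"
      by (cases i) (simp_all, presburger)
  qed
  then show ?thesis by (simp add: flip_def[abs_def])
qed

lemma shuffle_digit_inverse:
  assumes "0 \<le> v" "v < P i" "0 \<le> w" "w < P i" "(v + z i v) mod P i = w"
  shows "v = (w + z i w) mod P i"
proof -
  have w: "[w = v + z i v] (mod P i)" using assms(3-5) by (simp add: cong_def)
  then have "z i w = z i (v + z i v)" by (rule periodic_cong[OF periodic_z])
  then have "z i w = - z i v" by (simp add: z_involution)
  then have "[w + z i w = v + z i v + - z i v] (mod P i)" using w by (intro cong_add) auto
  then have "(w + z i w) mod P i = v mod P i" by (simp add: cong_def)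
  then show ?thesis using assms(1,2) by simp
qed

lemma mpt_shuffle: "mpt digit_measure shuffle"
proof -
  have "mpt digit_measure (\<lambda>x. enc (\<lambda>i. (\<lambda>i v. case_nat v (\<lambda>j. v + z j v) i) i (digit x i)))"
  proof (rule mpt_digitwise[where h = "\<lambda>i w. case_nat w (\<lambda>j. w + z j w) i"])
    fix i v w assume vw: "0 \<le> v" "v < case_nat 2 P i" "0 \<le> w" "w < case_nat 2 P i"
    show "case_nat v (\<lambda>j. v + z j v) i mod case_nat 2 P i = w
        \<longleftrightarrow> v = case_nat w (\<lambda>j. w + z j w) i mod case_nat 2 P i"
    proof (cases i)
      case (Suc j)
      then show ?thesis using vw shuffle_digit_inverse[of v j w] shuffle_digit_inverse[of w j v] by auto
    qed (use vw in auto)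
  qed
  then show ?thesis by (simp add: shuffle_def[abs_def])
qed

lemma shuffle_shuffle: "x \<in> space digit_measure \<Longrightarrow> shuffle (shuffle x) = x"
proof (rule digit_eqI[OF shuffle_space])
  fix i assume x: "x \<in> space digit_measure"
  show "digit (shuffle (shuffle x)) i = digit x i"
  proof (cases i)
    case (Suc j)
    then show ?thesis
      using shuffle_digit_inverse[of "digit x i" j "digit (shuffle x) i"] digit_range[OF x, of i]
        digit_range[OF shuffle_space, of x i] by (simp add: digit_shuffle)
  qed (simp add: digit_shuffle x shuffle_space)
qed

lemma changes_measurable[measurable]: "Measurable.pred digit_measure (\<lambda>x. i \<in> changes n x)"
  unfolding changes_def by simp

lemma finite_changes_iff: "finite (changes n x) \<longleftrightarrow> (\<exists>k. \<forall>i\<in>{k..}. i \<notin> changes n x)"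
  unfolding finite_nat_iff_bounded by (metis atLeast_iff lessThan_iff not_le subset_eq)

lemma good_measurable[measurable]: "Measurable.pred digit_measure good"
  unfolding good_def[abs_def] finite_changes_iff by measurable

lemma odd_changes_below_measurable[measurable]:
  "Measurable.pred digit_measure (\<lambda>x. odd (card ({..<k} \<inter> changes n x)))"
proof (induction k)
  case (Suc k)
  have "odd (card ({..<Suc k} \<inter> changes n x)) \<longleftrightarrow> odd (card ({..<k} \<inter> changes n x)) \<noteq> (k \<in> changes n x)" for x
    by (cases "k \<in> changes n x") (auto simp: lessThan_Suc Int_insert_left)
  then show ?case using Suc by simp
qed simp

lemma turns_measurable[measurable]: "(\<lambda>x. turns n x) \<in> digit_measure \<rightarrow>\<^sub>M count_space UNIV"
proof -
  have "good x \<and> odd (card (changes n x)) \<longleftrightarrow>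
      good x \<and> (\<exists>k. (\<forall>i\<in>{k..}. i \<notin> changes n x) \<and> odd (card ({..<k} \<inter> changes n x)))" for x
  proof (rule conj_cong[OF refl])
    assume "good x"
    then have "finite (changes n x)" by (simp add: good_def)
    then obtain k where k: "\<forall>i\<in>{k..}. i \<notin> changes n x"
      using finite_changes_iff by blast
    have "{..<k} \<inter> changes n x = changes n x" if "\<forall>i\<in>{k..}. i \<notin> changes n x" for k
      using that by (auto simp: not_le[symmetric])
    then show "odd (card (changes n x)) \<longleftrightarrow>
        (\<exists>k. (\<forall>i\<in>{k..}. i \<notin> changes n x) \<and> odd (card ({..<k} \<inter> changes n x)))"
      using k by metis
  qed
  then have "(\<lambda>x. turns n x) = (\<lambda>x. if good x \<and>
      (\<exists>k. (\<forall>i\<in>{k..}. i \<notin> changes n x) \<and> odd (card ({..<k} \<inter> changes n x))) then 1 else 0)"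
    by (auto simp: turns_def)
  then show ?thesis by simp
qed

lemma rot_measurable[measurable]: "rot n \<in> digit_measure \<rightarrow>\<^sub>M digit_measure"
  unfolding rot_def[abs_def]
proof (rule enc_measurable)
  fix i show "(\<lambda>x. case_nat (digit x 0 + turns n x) (\<lambda>i. digit x (Suc i) + n) i) \<in> digit_measure \<rightarrow>\<^sub>M count_space UNIV"
    by (cases i) simp_all
qed

text \<open>Given the other digits, the fibre digit is uniform: \<open>flip\<close> exchanges the two cases. Almost sure
invariance of \<open>E\<close> is enough, and this generality is needed for invariant sets of the rotation.\<close>

lemma prob_half:
  assumes E: "E \<in> sets digit_measure" and inv: "D.prob {x\<in>space digit_measure. (flip x \<in> E) \<noteq> (x \<in> E)} = 0"
    and g[measurable]: "Measurable.pred digit_measure g" and ginv: "\<And>x. x \<in> space digit_measure \<Longrightarrow> g (flip x) = g x"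
  shows "D.prob {x\<in>E. (digit x 0 = 0) = g x} = D.prob E / 2"
proof -
  define H where "H = {x\<in>E. (digit x 0 = 0) = g x}"
  define Z where "Z = {x\<in>space digit_measure. (flip x \<in> E) \<noteq> (x \<in> E)}"
  have Esub: "E \<subseteq> space digit_measure" by (rule sets.sets_into_space[OF E])
  have "H = E \<inter> {x\<in>space digit_measure. digit x 0 = 0 \<and> g x \<or> digit x 0 \<noteq> 0 \<and> \<not> g x}"
    using Esub by (auto simp: H_def)
  also have "\<dots> \<in> sets digit_measure" by (rule sets.Int[OF E]) measurable
  finally have H: "H \<in> sets digit_measure" .
  have "Z = (flip -` E \<inter> space digit_measure - E) \<union> (E - (flip -` E \<inter> space digit_measure))" using Esub by (auto simp: Z_def)
  then have Z: "Z \<in> sets digit_measure" using E measurable_sets[OF mpt_measurable[OF mpt_flip] E] by simp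
  have Z0: "D.prob Z = 0" using inv by (simp add: Z_def)
  have HF: "flip -` H \<inter> space digit_measure \<in> sets digit_measure" by (rule measurable_sets[OF mpt_measurable[OF mpt_flip] H])
  have dflip: "digit (flip x) 0 = 0 \<longleftrightarrow> digit x 0 \<noteq> 0" if "x \<in> space digit_measure" for x
    using digit0_cases[OF that] by (auto simp: digit_flip)
  have sub1: "flip -` H \<inter> space digit_measure \<subseteq> (E - H) \<union> Z"
    using dflip ginv by (auto simp: H_def Z_def)
  have sub2: "E - H \<subseteq> (flip -` H \<inter> space digit_measure) \<union> Z"
    using dflip ginv Esub by (auto simp: H_def Z_def)
  have "D.prob (flip -` H \<inter> space digit_measure) \<le> D.prob (E - H) + D.prob Z"
    using D.finite_measure_mono[OF sub1] measure_Un_le[of "E - H" digit_measure Z] E H Z by force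
  moreover have "D.prob (E - H) \<le> D.prob (flip -` H \<inter> space digit_measure) + D.prob Z"
    using D.finite_measure_mono[OF sub2] measure_Un_le[OF HF Z] HF Z by force
  moreover have "D.prob (E - H) = D.prob E - D.prob H"
    by (rule D.finite_measure_Diff[OF E H]) (auto simp: H_def)
  ultimately have "D.prob H = D.prob E - D.prob H"
    using Z0 mpt_measure[OF mpt_flip H] by simp
  then show ?thesis by (simp add: H_def)
qed

definition base_cyl :: "nat \<Rightarrow> (nat \<Rightarrow> int) \<Rightarrow> (nat \<Rightarrow> real) set" where
  "base_cyl k a = {x\<in>space digit_measure. \<forall>i<k. digit x (Suc i) = a i}"

lemma base_cyl_measurable[measurable]: "base_cyl k a \<in> sets digit_measure"
  unfolding base_cyl_def by measurable

lemma flip_base_cyl: "x \<in> space digit_measure \<Longrightarrow> flip x \<in> base_cyl k a \<longleftrightarrow> x \<in> base_cyl k a"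
  by (auto simp: base_cyl_def digit_flip flip_space)

lemma changes_flip: "x \<in> space digit_measure \<Longrightarrow> changes n (flip x) = changes n x"
  by (simp add: changes_def digit_flip)

lemma turns_flip: "x \<in> space digit_measure \<Longrightarrow> turns n (flip x) = turns n x"
  by (simp add: turns_def good_def changes_flip)

lemma cyl_Suc: "cyl (Suc k) a = {x\<in>base_cyl k (\<lambda>i. a (Suc i)). digit x 0 = a 0}"
  by (auto simp: cyl_def base_cyl_def less_Suc_eq_0_disj)

lemma valid0: "valid a \<Longrightarrow> a 0 = 0 \<or> a 0 = 1"
  unfolding valid_def by (drule spec[of _ 0]) auto

lemma cyl_Suc_half:
  assumes "valid a"
  shows "cyl (Suc k) a = {x\<in>base_cyl k (\<lambda>i. a (Suc i)). (digit x 0 = 0) = (a 0 = 0)}"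
proof -
  have "digit x 0 = a 0 \<longleftrightarrow> (digit x 0 = 0) = (a 0 = 0)" if "x \<in> space digit_measure" for x
    using digit0_cases[OF that] valid0[OF assms] by auto
  then show ?thesis unfolding cyl_Suc by (auto simp: base_cyl_def)
qed

lemma prob_base_cyl_half:
  assumes [measurable]: "Measurable.pred digit_measure g" and "\<And>x. x \<in> space digit_measure \<Longrightarrow> g (flip x) = g x"
  shows "D.prob {x\<in>base_cyl k a. (digit x 0 = 0) = g x} = D.prob (base_cyl k a) / 2"
proof -
  have "{x\<in>space digit_measure. (flip x \<in> base_cyl k a) \<noteq> (x \<in> base_cyl k a)} = {}" using flip_base_cyl by auto
  then have "D.prob {x\<in>space digit_measure. (flip x \<in> base_cyl k a) \<noteq> (x \<in> base_cyl k a)} = 0" by (simp only: measure_empty)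
  then show ?thesis by (rule prob_half[OF base_cyl_measurable _ assms])
qed

text \<open>The preimage of a cylinder prescribes shifted base digits, and for each base point one value of the fibre
digit, which has conditional probability one half.\<close>

lemma mpt_rot: "mpt digit_measure (rot n)"
proof (rule mptI_cyl)
  fix k a assume a: "valid a"
  show "D.prob (rot n -` cyl k a \<inter> space digit_measure) = D.prob (cyl k a)"
  proof (cases k)
    case 0
    then have "rot n -` cyl k a \<inter> space digit_measure = cyl k a" by (auto simp: cyl_def rot_space)
    then show ?thesis by simp
  next
    case (Suc j)
    define b where "b = (\<lambda>i. (a (Suc i) - n) mod P i)"
    have shift: "(v + n) mod P i = a (Suc i) \<longleftrightarrow> v = b i" if "0 \<le> v" "v < P i" for v i
    proof -
      have ai: "0 \<le> a (Suc i)" "a (Suc i) < P i" using a[unfolded valid_def, rule_format, of "Suc i"] by auto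
      have "(v + n) mod P i = a (Suc i) \<longleftrightarrow> [v + n = (a (Suc i) - n) + n] (mod P i)"
        using ai by (simp add: cong_def)
      also have "\<dots> \<longleftrightarrow> [v = a (Suc i) - n] (mod P i)" by (rule cong_add_rcancel)
      finally show ?thesis using that by (simp add: cong_def b_def)
    qed
    have "rot n -` cyl k a \<inter> space digit_measure = {x\<in>base_cyl j b. (digit x 0 = 0) = (turns n x = a 0)}"
    proof (rule Set.set_eqI)
      fix x
      show "x \<in> rot n -` cyl k a \<inter> space digit_measure \<longleftrightarrow> x \<in> {x\<in>base_cyl j b. (digit x 0 = 0) = (turns n x = a 0)}"
      proof (cases "x \<in> space digit_measure")
        case True
        have "digit (rot n x) (Suc i) = a (Suc i) \<longleftrightarrow> digit x (Suc i) = b i" for i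
          using digit_range[OF True, of "Suc i"] shift[of "digit x (Suc i)" i] by (simp add: digit_rot)
        moreover have "digit (rot n x) 0 = a 0 \<longleftrightarrow> (digit x 0 = 0) = (turns n x = a 0)"
          using digit0_cases[OF True] turns_cases[of n x] valid0[OF a] by (auto simp: digit_rot)
        ultimately show ?thesis using True by (auto simp: Suc cyl_Suc base_cyl_def rot_space)
      qed (auto simp: base_cyl_def)
    qed
    then have "D.prob (rot n -` cyl k a \<inter> space digit_measure) = D.prob (base_cyl j b) / 2"
      using prob_base_cyl_half[of "\<lambda>x. turns n x = a 0" j b] turns_flip by simp
    also have "\<dots> = D.prob (cyl k (case_nat 0 b))"
    proof -
      have "valid (case_nat 0 b)" by (simp add: valid_def b_def P_pos split: nat.split)
      then have "cyl k (case_nat 0 b) = {x\<in>base_cyl j b. (digit x 0 = 0) = True}"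
        using cyl_Suc_half[of "case_nat 0 b" j] by (simp add: Suc)
      then show ?thesis using prob_base_cyl_half[of "\<lambda>_. True" j b] by simp
    qed
    also have "\<dots> = D.prob (cyl k a)"
    proof -
      have "valid (case_nat 0 b)" by (simp add: valid_def b_def P_pos split: nat.split)
      then show ?thesis using a by (simp add: prob_cyl)
    qed
    finally show ?thesis .
  qed
qed measurable

lemma int_action_rot: "int_action digit_measure rot"
  using mpt_rot rot_0 rot_add by (simp add: int_action_def)

end

section \<open>Rigidity and ergodicity of the skew product\<close>

context tower
begin

lemma prob_base_digit: "D.prob {x\<in>space digit_measure. F (digit x (Suc i))} = dens (P i) F"
  using prob_digit[of F "Suc i"] by simp

lemma not_changed: "P i dvd n \<Longrightarrow> i \<notin> changes n x"
proof -
  assume "P i dvd n"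
  then have "[digit x (Suc i) + n = digit x (Suc i)] (mod P i)" by (simp add: cong_iff_dvd_diff)
  then show ?thesis using periodic_cong[OF periodic_S] by (auto simp: changes_def)
qed

lemma prob_changes_beyond:
  assumes "0 \<le> C" "\<And>i. k \<le> i \<Longrightarrow> dens (P i) (\<lambda>v. S i (v + n) \<noteq> S i v) \<le> C * tol i"
  shows "D.prob {x\<in>space digit_measure. \<exists>i\<ge>k. i \<in> changes n x} \<le> C * (2 * tol k)"
proof -
  define B where "B j = {x\<in>space digit_measure. k + j \<in> changes n x}" for j
  have B: "range B \<subseteq> D.events" unfolding B_def by (intro image_subsetI) measurable
  have le: "D.prob (B j) \<le> C * tol (k + j)" for j
  proof -
    have "D.prob (B j) = dens (P (k + j)) (\<lambda>v. S (k + j) (v + n) \<noteq> S (k + j) v)"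
      unfolding B_def changes_def mem_Collect_eq by (rule prob_base_digit)
    then show ?thesis using assms(2)[of "k + j"] by simp
  qed
  have sums: "(\<lambda>j. C * tol (k + j)) sums (C * (2 * tol k))" by (intro sums_mult tol_sums)
  have summable: "summable (\<lambda>j. D.prob (B j))"
    by (rule summable_comparison_test[OF _ sums_summable[OF sums]]) (use le in auto)
  have "{x\<in>space digit_measure. \<exists>i\<ge>k. i \<in> changes n x} = (\<Union>j. B j)"
    by (auto simp: B_def le_iff_add)
  then have "D.prob {x\<in>space digit_measure. \<exists>i\<ge>k. i \<in> changes n x} = D.prob (\<Union>j. B j)" by simp
  also have "\<dots> \<le> (\<Sum>j. D.prob (B j))" by (rule D.finite_measure_subadditive_countably[OF B summable])
  also have "\<dots> \<le> (\<Sum>j. C * tol (k + j))" by (rule suminf_le[OF le summable sums_summable[OF sums]])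
  also have "\<dots> = C * (2 * tol k)" by (rule sums_unique[OF sums, symmetric])
  finally show ?thesis .
qed

lemma prob_changes_beyond_period:
  assumes "\<bar>n\<bar> \<le> \<bar>m\<bar> * period k"
  shows "D.prob {x\<in>space digit_measure. \<exists>i\<ge>k. i \<in> changes n x} \<le> 2 * tol k"
  using prob_changes_beyond[of 1 k n] dens_change_far[OF _ assms] by simp

lemma prob_not_good: "D.prob {x\<in>space digit_measure. \<not> good x} = 0"
proof -
  have "{x\<in>space digit_measure. infinite (changes n x)} \<in> null_sets digit_measure" for n
  proof -
    have meas: "{x\<in>space digit_measure. infinite (changes n x)} \<in> sets digit_measure"
      unfolding finite_changes_iff by measurable
    have "D.prob {x\<in>space digit_measure. infinite (changes n x)} \<le> real_of_int \<bar>n\<bar> * (2 * tol k)" for k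
    proof -
      have "D.prob {x\<in>space digit_measure. infinite (changes n x)} \<le> D.prob {x\<in>space digit_measure. \<exists>i\<ge>k. i \<in> changes n x}"
      proof (rule D.finite_measure_mono)
        show "{x\<in>space digit_measure. \<exists>i\<ge>k. i \<in> changes n x} \<in> D.events" by measurable
        show "{x\<in>space digit_measure. infinite (changes n x)} \<subseteq> {x\<in>space digit_measure. \<exists>i\<ge>k. i \<in> changes n x}"
          by (auto simp: finite_changes_iff)
      qed
      also have "\<dots> \<le> real_of_int \<bar>n\<bar> * (2 * tol k)"
        by (rule prob_changes_beyond) (use dens_change_any in auto)
      finally show ?thesis .
    qed
    moreover have "(\<lambda>k. real_of_int \<bar>n\<bar> * (2 * tol k)) \<longlonglongrightarrow> real_of_int \<bar>n\<bar> * (2 * 0)"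
      by (intro tendsto_intros tol_tendsto)
    ultimately have "D.prob {x\<in>space digit_measure. infinite (changes n x)} \<le> real_of_int \<bar>n\<bar> * (2 * 0)"
      by (intro LIMSEQ_le_const) auto
    then have "D.prob {x\<in>space digit_measure. infinite (changes n x)} = 0"
      using measure_nonneg[of digit_measure "{x\<in>space digit_measure. infinite (changes n x)}"] by linarith
    then show ?thesis using meas by (intro null_setsI) (auto simp: D.emeasure_eq_measure)
  qed
  then have "(\<Union>n. {x\<in>space digit_measure. infinite (changes n x)}) \<in> null_sets digit_measure" by (intro null_sets_UN) auto
  moreover have "(\<Union>n. {x\<in>space digit_measure. infinite (changes n x)}) = {x\<in>space digit_measure. \<not> good x}"
    by (auto simp: good_def)
  ultimately have "{x\<in>space digit_measure. \<not> good x} \<in> null_sets digit_measure" by simp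
  then show ?thesis by (simp add: measure_def null_setsD1)
qed

lemma mpt_ident: "mpt digit_measure (\<lambda>x. x)"
proof -
  have "emeasure digit_measure ((\<lambda>x. x) -` A \<inter> space digit_measure) = emeasure digit_measure A" if "A \<in> sets digit_measure" for A
    using sets.sets_into_space[OF that] by (simp add: Int_absorb2)
  then show ?thesis by (simp add: mpt_def)
qed

lemma abs_divisor_le: "d dvd m \<Longrightarrow> \<bar>d\<bar> \<le> \<bar>m\<bar>"
  using m_nonzero by (simp add: dvd_imp_le_int)

text \<open>After \<open>d * period k\<close> steps the first \<open>k\<close> base digits are back, and with high probability no later pattern
has changed, so the fibre digit is back as well.\<close>

lemma rigid_rot:
  assumes "d dvd m"
  shows "rigid digit_measure (rot d)"
  unfolding rigid_def
proof (intro exI conjI allI ballI)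
  fix k show "0 < nat (period k)" using period_pos[of k] by simp
next
  fix A assume A: "A \<in> sets digit_measure"
  define G where "G k = rot (d * period k)" for k
  have unchanged: "i \<notin> changes (d * period k) x" if "i < k" for i k x
    using P_dvd_period[OF that] by (intro not_changed) simp
  have "(\<lambda>k. D.prob {x\<in>space digit_measure. digit (G k x) i \<noteq> digit x i}) \<longlonglongrightarrow> 0" for i
  proof (cases i)
    case 0
    have "D.prob {x\<in>space digit_measure. digit (G k x) i \<noteq> digit x i} \<le> 2 * tol k" for k
    proof -
      have "{x\<in>space digit_measure. digit (G k x) i \<noteq> digit x i}
          \<subseteq> {x\<in>space digit_measure. \<exists>j\<ge>k. j \<in> changes (d * period k) x}"
      proof (rule subsetI, rule CollectI, rule conjI)
        fix x assume x: "x \<in> {x\<in>space digit_measure. digit (G k x) i \<noteq> digit x i}"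
        then show "x \<in> space digit_measure" by simp
        show "\<exists>j\<ge>k. j \<in> changes (d * period k) x"
        proof (rule ccontr)
          assume "\<not> (\<exists>j\<ge>k. j \<in> changes (d * period k) x)"
          then have "changes (d * period k) x = {}" using unchanged by (meson equals0I not_le)
          then have "turns (d * period k) x = 0" by (simp add: turns_def)
          then show False using x 0 digit_range[of x 0] by (simp add: G_def digit_rot)
        qed
      qed
      then have "D.prob {x\<in>space digit_measure. digit (G k x) i \<noteq> digit x i}
          \<le> D.prob {x\<in>space digit_measure. \<exists>j\<ge>k. j \<in> changes (d * period k) x}"
        by (rule D.finite_measure_mono) measurable
      also have "\<dots> \<le> 2 * tol k"
        using abs_divisor_le[OF assms] period_pos[of k]
        by (intro prob_changes_beyond_period) (simp add: abs_mult mult_right_mono)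
      finally show ?thesis .
    qed
    then show ?thesis by (rule tendsto_zero_le_tol[OF measure_nonneg])
  next
    case (Suc j)
    have "D.prob {x\<in>space digit_measure. digit (G k x) i \<noteq> digit x i} = 0" if "k > j" for k
    proof -
      have "(v + d * period k) mod P j = v mod P j" for v
        using dvd_mult[OF P_dvd_period[OF that], of d] by (simp add: mod_eq_dvd_iff)
      then have "{x\<in>space digit_measure. digit (G k x) i \<noteq> digit x i} = {}"
        using Suc digit_Suc_mod by (auto simp: G_def digit_rot)
      then show ?thesis by (simp only: measure_empty)
    qed
    then have "\<forall>\<^sub>F k in sequentially. D.prob {x\<in>space digit_measure. digit (G k x) i \<noteq> digit x i} = 0"
      unfolding eventually_sequentially by (intro exI[of _ "Suc j"]) auto
    then show ?thesis by (rule tendsto_eventually)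
  qed
  then have lim: "(\<lambda>k. D.prob {x\<in>space digit_measure. (G k x \<in> A) \<noteq> (x \<in> A)}) \<longlonglongrightarrow> 0"
    unfolding G_def by (intro digitwise_approx[OF mpt_rot mpt_ident _ A])
  show "(\<lambda>k. D.prob (A - (rot d ^^ nat (period k)) -` A)) \<longlonglongrightarrow> 0"
  proof (rule tendsto_sandwich[OF _ _ tendsto_const lim])
    show "\<forall>\<^sub>F k in sequentially. D.prob (A - (rot d ^^ nat (period k)) -` A)
        \<le> D.prob {x\<in>space digit_measure. (G k x \<in> A) \<noteq> (x \<in> A)}"
    proof (rule always_eventually, rule allI, rule D.finite_measure_mono)
      fix k
      show "{x\<in>space digit_measure. (G k x \<in> A) \<noteq> (x \<in> A)} \<in> D.events"
        unfolding G_def by (rule sets_mpt_sym_diff[OF mpt_rot mpt_ident A])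
      show "A - (rot d ^^ nat (period k)) -` A \<subseteq> {x\<in>space digit_measure. (G k x \<in> A) \<noteq> (x \<in> A)}"
        using sets.sets_into_space[OF A] period_pos[of k]
        by (auto simp: G_def act_funpow[OF int_action_rot])
    qed
  qed simp
qed

lemma coprime_divisor: "d dvd m \<Longrightarrow> coprime (P i) d"
  using coprime_m[of i] by (meson coprime_divisors dvd_refl)

text \<open>A time which is a multiple of \<open>d * period k\<close> and congruent to \<open>n0 k\<close> modulo \<open>P k\<close> restores the first \<open>k\<close>
base digits, inverts the pattern \<open>S k\<close> at most points, and is too short to change later patterns. So
exactly one level changes and the fibre digit is flipped.\<close>

lemma rot_multiples_approximate_flip:
  assumes "d dvd m"
  obtains l where "\<And>i. (\<lambda>k. D.prob {x\<in>space digit_measure. digit (rot (d * l k) x) i \<noteq> digit (flip x) i}) \<longlonglongrightarrow> 0"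
proof -
  have d0: "d \<noteq> 0" using assms m_nonzero by auto
  have "\<exists>n. [n = 0] (mod d * period k) \<and> [n = n0 k] (mod P k) \<and> \<bar>n\<bar> \<le> \<bar>m\<bar> * period (Suc k)" for k
  proof -
    have "coprime (d * period k) (P k)"
      using coprime_divisor[OF assms, of k] coprime_period[of k] by (simp add: coprime_commute)
    then obtain y where y: "[y = 0] (mod d * period k)" "[y = n0 k] (mod P k)"
      using binary_chinese_remainder_int by blast
    define M where "M = \<bar>d\<bar> * period (Suc k)"
    have M: "M > 0" using d0 period_pos[of "Suc k"] by (simp add: M_def)
    have "[y mod M = y] (mod M)" by simp
    moreover have "M = \<bar>(d * period k) * P k\<bar>"
      using period_pos[of k] P_pos[of k] by (simp add: M_def period_Suc abs_mult)
    then have "d * period k dvd M" "P k dvd M" by simp_all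
    ultimately have "[y mod M = 0] (mod d * period k)" "[y mod M = n0 k] (mod P k)"
      using y by (meson cong_dvd_modulus cong_trans)+
    moreover have "\<bar>y mod M\<bar> \<le> M" using M by (simp add: less_imp_le)
    moreover have "M \<le> \<bar>m\<bar> * period (Suc k)"
      unfolding M_def using abs_divisor_le[OF assms] period_pos[of "Suc k"] by (intro mult_right_mono) auto
    ultimately show ?thesis by (meson order_trans)
  qed
  then obtain n where n: "\<And>k. [n k = 0] (mod d * period k)" "\<And>k. [n k = n0 k] (mod P k)"
    "\<And>k. \<bar>n k\<bar> \<le> \<bar>m\<bar> * period (Suc k)" by metis
  have dvd: "d * period k dvd n k" for k using n(1)[of k] by (simp add: cong_0_iff)
  define l where "l k = n k div d" for k
  have l: "d * l k = n k" for k
    using dvd_mult_left[OF dvd[of k]] by (simp add: l_def)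
  have unchanged: "i \<notin> changes (n k) x" if "i < k" for i k x
    using dvd_mult_right[OF dvd[of k]] P_dvd_period[OF that] by (intro not_changed) (rule dvd_trans)
  have "(\<lambda>k. D.prob {x\<in>space digit_measure. digit (rot (n k) x) i \<noteq> digit (flip x) i}) \<longlonglongrightarrow> 0" for i
  proof (cases i)
    case 0
    have "D.prob {x\<in>space digit_measure. digit (rot (n k) x) i \<noteq> digit (flip x) i} \<le> 2 * tol k" for k
    proof -
      let ?X = "{x\<in>space digit_measure. \<not> good x}"
      let ?Y = "{x\<in>space digit_measure. S k (digit x (Suc k) + n0 k) = S k (digit x (Suc k))}"
      let ?Z = "{x\<in>space digit_measure. \<exists>j\<ge>Suc k. j \<in> changes (n k) x}"
      have "{x\<in>space digit_measure. digit (rot (n k) x) i \<noteq> digit (flip x) i} \<subseteq> ?X \<union> (?Y \<union> ?Z)"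
      proof
        fix x assume x: "x \<in> {x\<in>space digit_measure. digit (rot (n k) x) i \<noteq> digit (flip x) i}"
        show "x \<in> ?X \<union> (?Y \<union> ?Z)"
        proof (rule ccontr)
          assume "x \<notin> ?X \<union> (?Y \<union> ?Z)"
          then have g: "good x" and half: "S k (digit x (Suc k) + n0 k) \<noteq> S k (digit x (Suc k))"
            and far: "\<And>j. Suc k \<le> j \<Longrightarrow> j \<notin> changes (n k) x" using x by auto
          have "S k (digit x (Suc k) + n k) = S k (digit x (Suc k) + n0 k)"
            by (rule periodic_cong[OF periodic_S cong_add[OF cong_refl n(2)]])
          then have k: "k \<in> changes (n k) x" using half by (simp add: changes_def)
          have "j \<in> changes (n k) x \<longleftrightarrow> j \<in> {k}" for j
            using k far[of j] unchanged[of j k x] by (cases j k rule: linorder_cases) auto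
          then have "changes (n k) x = {k}" by blast
          then have "turns (n k) x = 1" using g by (simp add: turns_def)
          then show False using x 0 by (simp add: digit_rot digit_flip)
        qed
      qed
      then have "D.prob {x\<in>space digit_measure. digit (rot (n k) x) i \<noteq> digit (flip x) i} \<le> D.prob (?X \<union> (?Y \<union> ?Z))"
        by (rule D.finite_measure_mono) measurable
      also have "\<dots> \<le> D.prob ?X + D.prob (?Y \<union> ?Z)" by (rule measure_Un_le) measurable
      also have "D.prob (?Y \<union> ?Z) \<le> D.prob ?Y + D.prob ?Z" by (rule measure_Un_le) measurable
      also have "D.prob ?Y = dens (P k) (\<lambda>v. S k (v + n0 k) = S k v)" by (rule prob_base_digit)
      also have "\<dots> \<le> tol k" by (rule half_turn)
      also have "D.prob ?Z \<le> 2 * tol (Suc k)" by (rule prob_changes_beyond_period[OF n(3)])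
      also have "2 * tol (Suc k) = tol k" by (simp add: tol_def)
      finally show ?thesis using prob_not_good by simp
    qed
    then show ?thesis by (rule tendsto_zero_le_tol[OF measure_nonneg])
  next
    case (Suc j)
    have "D.prob {x\<in>space digit_measure. digit (rot (n k) x) i \<noteq> digit (flip x) i} = 0" if "k > j" for k
    proof -
      have "P j dvd n k" using dvd_mult_right[OF dvd[of k]] P_dvd_period[OF that] by (rule dvd_trans[rotated])
      then have "(v + n k) mod P j = v mod P j" for v
        by (simp add: mod_eq_dvd_iff)
      then have "{x\<in>space digit_measure. digit (rot (n k) x) i \<noteq> digit (flip x) i} = {}"
        using Suc digit_Suc_mod by (auto simp: digit_rot digit_flip)
      then show ?thesis by (simp only: measure_empty)
    qed
    then have "\<forall>\<^sub>F k in sequentially. D.prob {x\<in>space digit_measure. digit (rot (n k) x) i \<noteq> digit (flip x) i} = 0"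
      unfolding eventually_sequentially by (intro exI[of _ "Suc j"]) auto
    then show ?thesis by (rule tendsto_eventually)
  qed
  then show ?thesis using that[of l] by (simp add: l)
qed

lemma simultaneous_congruences:
  assumes "d dvd m"
  shows "\<exists>n. \<forall>i<k. [d * n = u i] (mod P i)"
proof (induction k)
  case (Suc k)
  then obtain n where n: "\<forall>i<k. [d * n = u i] (mod P i)" by blast
  obtain v where v: "[d * v = 1] (mod P k)"
    using cong_solve_coprime_int[of d "P k"] coprime_divisor[OF assms, of k] by (auto simp: coprime_commute)
  obtain y where y: "[y = n] (mod period k)" "[y = v * u k] (mod P k)"
    using binary_chinese_remainder_int[of "period k" "P k" n "v * u k"] coprime_period[of k]
    by (auto simp: coprime_commute)
  have "[d * y = u i] (mod P i)" if "i < Suc k" for i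
  proof (cases "i = k")
    case True
    have "[d * y = d * (v * u k)] (mod P k)" by (rule cong_mult[OF cong_refl y(2)])
    also have "d * (v * u k) = (d * v) * u k" by (simp add: mult.assoc)
    also have "[(d * v) * u k = 1 * u k] (mod P k)" by (rule cong_mult[OF v cong_refl])
    finally show ?thesis using True by simp
  next
    case False
    then have i: "i < k" using that by simp
    have "[d * y = d * n] (mod P i)"
      by (rule cong_mult[OF cong_refl cong_dvd_modulus[OF y(1) P_dvd_period[OF i]]])
    then show ?thesis using n i cong_trans by blast
  qed
  then show ?case by blast
qed simp

definition base_valid :: "(nat \<Rightarrow> int) \<Rightarrow> bool" where
  "base_valid a \<longleftrightarrow> (\<forall>i. 0 \<le> a i \<and> a i < P i)"

context
  fixes d A
  assumes d: "d dvd m" and A: "A \<in> sets digit_measure" and inv: "rot d -` A \<inter> space digit_measure = A"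
begin

text \<open>By the Chinese remainder theorem the multiples of \<open>d\<close> act transitively on the base cylinders of each length.\<close>

lemma prob_invariant_base_cyl:
  assumes a: "base_valid a" and b: "base_valid b"
  shows "D.prob (A \<inter> base_cyl k a) = D.prob (A \<inter> base_cyl k b)"
proof -
  obtain n where n: "\<forall>i<k. [d * n = a i - b i] (mod P i)"
    using simultaneous_congruences[OF d, of k "\<lambda>i. a i - b i"] by blast
  have "rot (d * n) -` (A \<inter> base_cyl k a) \<inter> space digit_measure = A \<inter> base_cyl k b"
  proof -
    have "rot (d * n) x \<in> A \<longleftrightarrow> x \<in> A" if "x \<in> space digit_measure" for x
      by (rule act_invariant_set[OF int_action_rot inv that])
    moreover have "rot (d * n) x \<in> base_cyl k a \<longleftrightarrow> x \<in> base_cyl k b" if x: "x \<in> space digit_measure" for x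
    proof -
      have "(digit x (Suc i) + d * n) mod P i = a i \<longleftrightarrow> digit x (Suc i) = b i" if "i < k" for i
      proof -
        have r: "0 \<le> digit x (Suc i)" "digit x (Suc i) < P i" using digit_range[OF x, of "Suc i"] by auto
        have "(digit x (Suc i) + d * n) mod P i = a i \<longleftrightarrow> [digit x (Suc i) + d * n = a i] (mod P i)"
          using a by (simp add: cong_def base_valid_def)
        also have "\<dots> \<longleftrightarrow> [digit x (Suc i) + d * n = b i + d * n] (mod P i)"
        proof -
          have "[b i + d * n = b i + (a i - b i)] (mod P i)" using n that by (intro cong_add) auto
          then have "[b i + d * n = a i] (mod P i)" by simp
          then show ?thesis using cong_trans cong_sym by meson
        qed
        also have "\<dots> \<longleftrightarrow> [digit x (Suc i) = b i] (mod P i)" by (rule cong_add_rcancel)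
        also have "\<dots> \<longleftrightarrow> digit x (Suc i) = b i" using r b by (simp add: cong_def base_valid_def)
        finally show ?thesis .
      qed
      then show ?thesis using x by (auto simp: base_cyl_def digit_rot rot_space)
    qed
    moreover have "A \<subseteq> space digit_measure" by (rule sets.sets_into_space[OF A])
    ultimately show ?thesis by auto
  qed
  moreover have "A \<inter> base_cyl k a \<in> sets digit_measure" using A by simp
  ultimately show ?thesis using mpt_measure[OF mpt_rot, of "A \<inter> base_cyl k a" "d * n"] by simp
qed

lemma prob_invariant_base_cyl_eq:
  assumes a: "base_valid a"
  shows "D.prob (A \<inter> base_cyl k a) * period k = D.prob A"
proof (induction k)
  case 0
  have "A \<inter> base_cyl 0 a = A" using sets.sets_into_space[OF A] by (auto simp: base_cyl_def)
  then show ?case by (simp add: period_def)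
next
  case (Suc k)
  have av: "base_valid (a(k := v))" if "v \<in> {0..<P k}" for v using a that by (simp add: base_valid_def)
  have "A \<inter> base_cyl k a = (\<Union>v\<in>{0..<P k}. A \<inter> base_cyl (Suc k) (a(k := v)))"
    using digit_range[of _ "Suc k"] by (auto simp: base_cyl_def less_Suc_eq)
  then have "D.prob (A \<inter> base_cyl k a) = D.prob (\<Union>v\<in>{0..<P k}. A \<inter> base_cyl (Suc k) (a(k := v)))"
    by simp
  also have "\<dots> = (\<Sum>v\<in>{0..<P k}. D.prob (A \<inter> base_cyl (Suc k) (a(k := v))))"
  proof (rule D.finite_measure_finite_Union)
    show "disjoint_family_on (\<lambda>v. A \<inter> base_cyl (Suc k) (a(k := v))) {0..<P k}"
      by (auto simp: disjoint_family_on_def base_cyl_def)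
  qed (use A in auto)
  also have "\<dots> = (\<Sum>v\<in>{0..<P k}. D.prob (A \<inter> base_cyl (Suc k) a))"
    by (intro sum.cong refl prob_invariant_base_cyl av a)
  also have "\<dots> = D.prob (A \<inter> base_cyl (Suc k) a) * P k" using P_pos[of k] by (simp add: mult.commute)
  finally show ?case using Suc by (simp add: period_Suc mult_ac)
qed

lemma invariant_flip_invariant: "D.prob {x\<in>space digit_measure. (flip x \<in> A) \<noteq> (x \<in> A)} = 0"
proof -
  obtain l where l: "\<And>i. (\<lambda>k. D.prob {x\<in>space digit_measure. digit (rot (d * l k) x) i \<noteq> digit (flip x) i}) \<longlonglongrightarrow> 0"
    using rot_multiples_approximate_flip[OF d] by blast
  have "(\<lambda>k. D.prob {x\<in>space digit_measure. (rot (d * l k) x \<in> A) \<noteq> (flip x \<in> A)}) \<longlonglongrightarrow> 0"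
    by (rule digitwise_approx[OF mpt_rot mpt_flip l A])
  moreover have "{x\<in>space digit_measure. (rot (d * l k) x \<in> A) \<noteq> (flip x \<in> A)} = {x\<in>space digit_measure. (flip x \<in> A) \<noteq> (x \<in> A)}" for k
    using act_invariant_set[OF int_action_rot inv] by auto
  ultimately have "(\<lambda>k::nat. D.prob {x\<in>space digit_measure. (flip x \<in> A) \<noteq> (x \<in> A)}) \<longlonglongrightarrow> 0" by simp
  then show ?thesis by (simp add: LIMSEQ_const_iff)
qed

lemma prob_invariant_cyl:
  assumes a: "valid a"
  shows "D.prob (A \<inter> cyl (Suc k) a) * (2 * period k) = D.prob A"
proof -
  let ?b = "\<lambda>i. a (Suc i)"
  have b: "base_valid ?b" unfolding base_valid_def
  proof
    fix i show "0 \<le> a (Suc i) \<and> a (Suc i) < P i" using a[unfolded valid_def, rule_format, of "Suc i"] by simp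
  qed
  have "A \<inter> cyl (Suc k) a = {x\<in>A \<inter> base_cyl k ?b. (digit x 0 = 0) = (a 0 = 0)}"
    unfolding cyl_Suc_half[OF a] by auto
  moreover have "D.prob {x\<in>A \<inter> base_cyl k ?b. (digit x 0 = 0) = (a 0 = 0)} = D.prob (A \<inter> base_cyl k ?b) / 2"
  proof (rule prob_half)
    show "A \<inter> base_cyl k ?b \<in> D.events" using A by simp
    have "D.prob {x\<in>space digit_measure. (flip x \<in> A \<inter> base_cyl k ?b) \<noteq> (x \<in> A \<inter> base_cyl k ?b)}
        \<le> D.prob {x\<in>space digit_measure. (flip x \<in> A) \<noteq> (x \<in> A)}"
    proof (rule D.finite_measure_mono)
      show "{x\<in>space digit_measure. (flip x \<in> A) \<noteq> (x \<in> A)} \<in> D.events"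
        by (rule sets_mpt_sym_diff[OF mpt_flip mpt_ident A])
    qed (use flip_base_cyl in auto)
    then show "D.prob {x\<in>space digit_measure. (flip x \<in> A \<inter> base_cyl k ?b) \<noteq> (x \<in> A \<inter> base_cyl k ?b)} = 0"
      using invariant_flip_invariant by (simp add: measure_le_0_iff)
  qed simp_all
  ultimately have half: "D.prob (A \<inter> cyl (Suc k) a) = D.prob (A \<inter> base_cyl k ?b) / 2" by simp
  show ?thesis unfolding half using prob_invariant_base_cyl_eq[OF b, of k] by simp
qed

end

text \<open>An invariant set meets all base cylinders of a given length in the same proportion, and the flip, being
a limit of rotations by multiples of \<open>d\<close>, preserves it up to a null set, so it meets their two
halves equally. Hence it is independent of all cylinders, and so of itself.\<close>

lemma ergodic_rot:
  assumes d: "d dvd m"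
  shows "ergodic_mpt digit_measure (rot d)"
  unfolding ergodic_mpt_def
proof (intro conjI ballI impI)
  show "invertible_mpt digit_measure (rot d)" by (rule act_invertible_mpt[OF int_action_rot])
  fix A assume A: "A \<in> sets digit_measure" and inv: "rot d -` A \<inter> space digit_measure = A"
  have "rot d -` space digit_measure \<inter> space digit_measure = space digit_measure" using rot_space by auto
  note whole = prob_invariant_cyl[OF d sets.top this]
  have Asub: "A \<subseteq> space digit_measure" by (rule sets.sets_into_space[OF A])
  have indep: "D.prob (A \<inter> cyl k a) = D.prob A * D.prob (cyl k a)" if a: "valid a" for k a
  proof (cases k)
    case 0
    then have "A \<inter> cyl k a = A" "cyl k a = space digit_measure" using Asub by (auto simp: cyl_def)
    then show ?thesis using D.prob_space by simp
  next
    case (Suc j)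
    have "space digit_measure \<inter> cyl k a = cyl k a" using sets.sets_into_space[OF cyl_measurable] by blast
    then have "D.prob (cyl k a) * (2 * period j) = 1" using whole[OF a, of j] D.prob_space Suc by simp
    moreover have "D.prob (A \<inter> cyl k a) * (2 * period j) = D.prob A"
      using prob_invariant_cyl[OF d A inv a, of j] Suc by simp
    ultimately have "D.prob (A \<inter> cyl k a) * (2 * period j) = (D.prob A * D.prob (cyl k a)) * (2 * period j)"
      by (simp only: mult.assoc mult_1_right)
    then show ?thesis using period_pos[of j] by simp
  qed
  \<comment> \<open>the measure of intersections with \<open>A\<close> is proportional to the whole measure\<close>
  have "density digit_measure (indicator A) = scale_measure (ennreal (D.prob A)) digit_measure"
  proof (rule measure_eq_on_cylinders)
    show "emeasure (density digit_measure (indicator A)) (space digit_measure) \<noteq> \<infinity>"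
      using emeasure_restricted[OF A sets.top] D.emeasure_eq_measure by simp
    fix k a assume "valid a"
    then show "emeasure (density digit_measure (indicator A)) (cyl k a) = emeasure (scale_measure (ennreal (D.prob A)) digit_measure) (cyl k a)"
      using emeasure_restricted[OF A cyl_measurable] indep D.emeasure_eq_measure by (simp add: ennreal_mult)
  qed simp_all
  then have "emeasure (density digit_measure (indicator A)) A = emeasure (scale_measure (ennreal (D.prob A)) digit_measure) A" by simp
  then have "ennreal (D.prob A) = ennreal (D.prob A * D.prob A)"
    using emeasure_restricted[OF A A] D.emeasure_eq_measure by (simp add: ennreal_mult)
  then have "D.prob A = D.prob A * D.prob A" by (simp add: ennreal_inj)
  then show "D.prob A = 0 \<or> D.prob A = 1" by simp
qed

end

section \<open>Averages that alternate along the periods\<close>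

lemma sum_int_nat:
  assumes "N \<ge> 0"
  shows "(\<Sum>n<nat N. f (int n)) = (\<Sum>n\<in>{0..<N}. f n)"
proof (rule sum.reindex_bij_witness[of _ nat int])
qed (use assms in auto)

context tower
begin

lemma dens_period:
  assumes "i < k" "periodic (P i) F"
  shows "dens (period k) F = dens (P i) F"
proof -
  define R where "R = (\<Prod>j\<in>{..<k} - {i}. P j)"
  have "period k = P i * R" unfolding period_def R_def using assms(1) by (intro prod.remove) auto
  moreover have "R > 0" unfolding R_def by (intro prod_pos) (simp add: P_pos)
  moreover have "coprime (P i) R" unfolding R_def by (intro prod_coprime_right coprime_P) auto
  ultimately show ?thesis using dens_lift(1)[OF P_pos, of R i F] assms(2) by simp
qed

text \<open>Level \<open>i\<close> contributes to the difference, after \<open>n\<close> steps, between the fibre turns at \<open>x\<close> and at its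
shuffled copy.\<close>

definition swapped :: "nat \<Rightarrow> int \<Rightarrow> (nat \<Rightarrow> real) \<Rightarrow> bool" where
  "swapped i n x \<longleftrightarrow> (i \<in> changes n x) \<noteq> (i \<in> changes n (shuffle x))"

lemma changes_shuffle:
  "i \<in> changes n (shuffle x) \<longleftrightarrow> S i (digit x (Suc i) + z i (digit x (Suc i)) + n)
     \<noteq> S i (digit x (Suc i) + z i (digit x (Suc i)))"
  by (simp add: changes_def digit_shuffle)

text \<open>Modulo 2, the difference of the turns is the cardinality of the symmetric difference of the two sets of
changing levels, which here is \<open>{..<k}\<close>.\<close>

lemma turns_shuffle_parity:
  assumes "good x" "good (shuffle x)" "\<And>i. i < k \<Longrightarrow> swapped i n x" "\<And>i. k \<le> i \<Longrightarrow> \<not> swapped i n x"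
  shows "turns n x = turns n (shuffle x) \<longleftrightarrow> even k"
proof -
  have fin: "finite (changes n x)" "finite (changes n (shuffle x))" using assms(1,2) by (auto simp: good_def)
  have "i \<in> (changes n x - changes n (shuffle x)) \<union> (changes n (shuffle x) - changes n x) \<longleftrightarrow> i \<in> {..<k}" for i
    using assms(3,4)[of i] by (cases "i < k") (auto simp: swapped_def)
  then have "(changes n x - changes n (shuffle x)) \<union> (changes n (shuffle x) - changes n x) = {..<k}" by blast
  then have "odd k \<longleftrightarrow> odd (card (changes n x)) \<noteq> odd (card (changes n (shuffle x)))"
    using odd_card_sym_diff[OF fin] by simp
  then show ?thesis using assms(1,2) by (auto simp: turns_def)
qed

lemma shuffle_measurable[measurable]: "shuffle \<in> digit_measure \<rightarrow>\<^sub>M digit_measure"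
  by (rule mpt_measurable[OF mpt_shuffle])

lemma swapped_measurable[measurable]: "Measurable.pred digit_measure (\<lambda>x. swapped i n x)"
proof -
  have "Measurable.pred digit_measure (\<lambda>x. i \<in> changes n (shuffle x))"
    by (rule measurable_compose[OF shuffle_measurable changes_measurable])
  then have "Measurable.pred digit_measure (\<lambda>x. (i \<in> changes n x \<and> i \<notin> changes n (shuffle x)) \<or>
     (i \<notin> changes n x \<and> i \<in> changes n (shuffle x)))" by measurable
  then show ?thesis by (rule measurable_cong[THEN iffD1, rotated]) (auto simp: swapped_def)
qed

text \<open>A level whose period has elapsed contributes for most \<open>n\<close>. The shuffle changes the initial value of the
pattern, by the first property of the displacement. At time \<open>m * n\<close>, however, the values at \<open>x\<close> and at
the shuffled point usually agree: for fixed \<open>x\<close> the displacement is fixed while \<open>m * n\<close> runs uniformly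
through the group, and a fixed displacement is almost invisible.\<close>

lemma sum_prob_not_swapped:
  assumes "i < k"
  shows "(\<Sum>n\<in>{0..<period k}. D.prob {x\<in>space digit_measure. \<not> swapped i (m * n) x}) \<le> real_of_int (period k) * (2 * tol i)"
proof -
  define F where "F n v \<longleftrightarrow> S i (v + z i v + m * n) \<noteq> S i (v + m * n)" for n v
  have "D.prob {x\<in>space digit_measure. \<not> swapped i (m * n) x} \<le> tol i + dens (P i) (F n)" for n
  proof -
    have "D.prob {x\<in>space digit_measure. \<not> swapped i (m * n) x}
        = dens (P i) (\<lambda>v. (S i (v + m * n) \<noteq> S i v) = (S i (v + z i v + m * n) \<noteq> S i (v + z i v)))"
      unfolding prob_base_digit[symmetric] swapped_def changes_shuffle by (simp add: changes_def)
    also have "\<dots> \<le> dens (P i) (\<lambda>v. S i (v + z i v) = S i v \<or> F n v)"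
      by (rule dens_mono[OF P_pos]) (auto simp: F_def)
    also have "\<dots> \<le> dens (P i) (\<lambda>v. S i (v + z i v) = S i v) + dens (P i) (F n)"
      by (rule dens_disj[OF P_pos])
    finally show ?thesis using shift_flips[of i] by linarith
  qed
  then have "(\<Sum>n\<in>{0..<period k}. D.prob {x\<in>space digit_measure. \<not> swapped i (m * n) x})
      \<le> (\<Sum>n\<in>{0..<period k}. tol i + dens (P i) (F n))" by (rule sum_mono)
  also have "\<dots> = real_of_int (period k) * tol i + (\<Sum>n\<in>{0..<period k}. dens (P i) (F n))"
    using period_pos[of k] by (simp add: sum.distrib)
  also have "(\<Sum>n\<in>{0..<period k}. dens (P i) (F n)) \<le> real_of_int (period k) * tol i"
  proof (rule sum_dens_le[OF P_pos period_pos])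
    fix v
    define G where "G n \<longleftrightarrow> S i (n + z i v) \<noteq> S i n" for n
    have per: "periodic (P i) G"
      using periodic_change(1)[OF periodic_S, of i "z i v" 0] by (simp add: G_def[abs_def])
    have Feq: "F n v = G (m * n + v)" for n by (simp add: F_def G_def add_ac)
    have "periodic (P i) (\<lambda>n. F n v)"
      unfolding Feq by (rule periodicI) (rule periodic_cong[OF per cong_add[OF cong_mult[OF cong_refl] cong_refl]])
    then have "dens (period k) (\<lambda>n. F n v) = dens (P i) (\<lambda>n. G (m * n + v))"
      unfolding Feq by (rule dens_period[OF assms])
    also have "\<dots> = dens (P i) G"
      by (rule dens_affine[OF P_pos _ per]) (use coprime_m[of i] in \<open>simp add: coprime_commute\<close>)
    also have "\<dots> \<le> tol i" unfolding G_def by (rule shift_invisible)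
    finally show "dens (period k) (\<lambda>n. F n v) \<le> tol i" .
  qed
  finally show ?thesis by (simp add: algebra_simps)
qed

text \<open>With high probability a level which is still slow has not changed at all, neither at \<open>x\<close> nor at \<open>shuffle x\<close>.\<close>

lemma prob_swapped_beyond:
  assumes "\<bar>n\<bar> \<le> \<bar>m\<bar> * period k"
  shows "D.prob {x\<in>space digit_measure. \<exists>i\<ge>k. swapped i n x} \<le> 4 * tol k"
proof -
  let ?B = "{x\<in>space digit_measure. \<exists>i\<ge>k. i \<in> changes n x}"
  have B: "?B \<in> D.events" by measurable
  have B': "shuffle -` ?B \<inter> space digit_measure \<in> D.events" by (rule measurable_sets[OF shuffle_measurable B])
  have "D.prob {x\<in>space digit_measure. \<exists>i\<ge>k. swapped i n x} \<le> D.prob (?B \<union> (shuffle -` ?B \<inter> space digit_measure))"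
    by (rule D.finite_measure_mono) (use B B' shuffle_space in \<open>auto simp: swapped_def\<close>)
  also have "\<dots> \<le> D.prob ?B + D.prob (shuffle -` ?B \<inter> space digit_measure)" by (rule measure_Un_le[OF B B'])
  also have "\<dots> = 2 * D.prob ?B" using mpt_measure[OF mpt_shuffle B] by simp
  also have "\<dots> \<le> 4 * tol k" using prob_changes_beyond_period[OF assms] by simp
  finally show ?thesis .
qed

lemma sum_prob_wrong_parity:
  "(\<Sum>n\<in>{0..<period k}. D.prob {x\<in>space digit_measure. (turns (m * n) x = turns (m * n) (shuffle x)) \<noteq> even k})
     \<le> real_of_int (period k) * (1 / 8)"
proof -
  let ?X = "{x\<in>space digit_measure. \<not> good x}"
  have X: "?X \<in> D.events" by measurable
  have X': "shuffle -` ?X \<inter> space digit_measure \<in> D.events" by (rule measurable_sets[OF shuffle_measurable X])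
  have "D.prob {x\<in>space digit_measure. (turns (m * n) x = turns (m * n) (shuffle x)) \<noteq> even k}
      \<le> (\<Sum>i<k. D.prob {x\<in>space digit_measure. \<not> swapped i (m * n) x}) + 4 * tol k" if n: "n \<in> {0..<period k}" for n
  proof -
    let ?Y = "{x\<in>space digit_measure. \<exists>i\<ge>k. swapped i (m * n) x}"
    let ?Z = "\<Union>i<k. {x\<in>space digit_measure. \<not> swapped i (m * n) x}"
    have Y: "?Y \<in> D.events" by measurable
    have Z: "?Z \<in> D.events" by (intro sets.finite_UN) measurable
    have "{x\<in>space digit_measure. (turns (m * n) x = turns (m * n) (shuffle x)) \<noteq> even k}
        \<subseteq> (?X \<union> (shuffle -` ?X \<inter> space digit_measure)) \<union> (?Y \<union> ?Z)"
    proof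
      fix x assume x: "x \<in> {x\<in>space digit_measure. (turns (m * n) x = turns (m * n) (shuffle x)) \<noteq> even k}"
      show "x \<in> (?X \<union> (shuffle -` ?X \<inter> space digit_measure)) \<union> (?Y \<union> ?Z)"
      proof (rule ccontr)
        assume "x \<notin> (?X \<union> (shuffle -` ?X \<inter> space digit_measure)) \<union> (?Y \<union> ?Z)"
        then have "good x" "good (shuffle x)" "\<And>i. i < k \<Longrightarrow> swapped i (m * n) x" "\<And>i. k \<le> i \<Longrightarrow> \<not> swapped i (m * n) x"
          using x shuffle_space by auto
        from turns_shuffle_parity[OF this] show False using x by simp
      qed
    qed
    then have "D.prob {x\<in>space digit_measure. (turns (m * n) x = turns (m * n) (shuffle x)) \<noteq> even k}
        \<le> D.prob ((?X \<union> (shuffle -` ?X \<inter> space digit_measure)) \<union> (?Y \<union> ?Z))"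
      by (rule D.finite_measure_mono) (use X X' Y Z in auto)
    moreover have "D.prob ((?X \<union> (shuffle -` ?X \<inter> space digit_measure)) \<union> (?Y \<union> ?Z))
        \<le> D.prob (?X \<union> (shuffle -` ?X \<inter> space digit_measure)) + D.prob (?Y \<union> ?Z)"
      by (rule measure_Un_le) (use X X' Y Z in auto)
    moreover have "D.prob (?X \<union> (shuffle -` ?X \<inter> space digit_measure)) \<le> 0"
      using measure_Un_le[OF X X'] mpt_measure[OF mpt_shuffle X] prob_not_good by simp
    moreover have "D.prob (?Y \<union> ?Z) \<le> D.prob ?Y + D.prob ?Z" by (rule measure_Un_le[OF Y Z])
    moreover have "D.prob ?Y \<le> 4 * tol k"
    proof (rule prob_swapped_beyond)
      show "\<bar>m * n\<bar> \<le> \<bar>m\<bar> * period k"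
        using n unfolding abs_mult by (intro mult_left_mono) auto
    qed
    moreover have "D.prob ?Z \<le> (\<Sum>i<k. D.prob {x\<in>space digit_measure. \<not> swapped i (m * n) x})"
      by (rule D.finite_measure_subadditive_finite) auto
    ultimately show ?thesis by linarith
  qed
  then have "(\<Sum>n\<in>{0..<period k}. D.prob {x\<in>space digit_measure. (turns (m * n) x = turns (m * n) (shuffle x)) \<noteq> even k})
      \<le> (\<Sum>n\<in>{0..<period k}. (\<Sum>i<k. D.prob {x\<in>space digit_measure. \<not> swapped i (m * n) x}) + 4 * tol k)"
    by (rule sum_mono)
  also have "\<dots> = (\<Sum>i<k. \<Sum>n\<in>{0..<period k}. D.prob {x\<in>space digit_measure. \<not> swapped i (m * n) x}) + real_of_int (period k) * (4 * tol k)"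
    unfolding sum.distrib using period_pos[of k] by (subst sum.swap) simp
  also have "\<dots> \<le> (\<Sum>i<k. real_of_int (period k) * (2 * tol i)) + real_of_int (period k) * (4 * tol k)"
    by (intro add_right_mono sum_mono sum_prob_not_swapped) simp
  also have "\<dots> = real_of_int (period k) * (2 * (\<Sum>i<k. tol i) + 4 * tol k)"
    by (simp add: sum_distrib_left algebra_simps)
  also have "\<dots> \<le> real_of_int (period k) * (1 / 8)"
  proof (rule mult_left_mono)
    have "tol k \<le> 1 / 64" by (simp add: tol_def power_le_one)
    then show "2 * (\<Sum>i<k. tol i) + 4 * tol k \<le> 1 / 8" using sum_tol_le[of k] by simp
  qed (use period_pos[of k] in simp)
  finally show ?thesis .
qed

lemma conj_action: "int_action digit_measure (conj_by shuffle rot)"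
  by (rule conj_int_action[OF int_action_rot mpt_shuffle]) (rule shuffle_shuffle)

definition zero_fibre :: "(nat \<Rightarrow> real) set" where
  "zero_fibre = {x\<in>space digit_measure. digit x 0 = 0}"

lemma zero_fibre_measurable[measurable]: "zero_fibre \<in> sets digit_measure"
  unfolding zero_fibre_def by measurable

lemma prob_zero_fibre: "D.prob zero_fibre = 1 / 2"
proof -
  have "zero_fibre = {x\<in>base_cyl 0 (\<lambda>_. 0). (digit x 0 = 0) = True}" by (auto simp: zero_fibre_def base_cyl_def)
  moreover have "base_cyl 0 (\<lambda>_. 0) = space digit_measure" by (auto simp: base_cyl_def)
  ultimately show ?thesis using prob_base_cyl_half[of "\<lambda>_. True" 0 "\<lambda>_. 0"] D.prob_space by simp
qed

lemma turns_shuffle_flip: "x \<in> space digit_measure \<Longrightarrow> turns n (shuffle (flip x)) = turns n (shuffle x)"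
proof -
  assume "x \<in> space digit_measure"
  then have "changes k (shuffle (flip x)) = changes k (shuffle x)" for k
    by (auto simp: changes_shuffle digit_flip)
  then show ?thesis by (simp add: turns_def good_def)
qed

text \<open>The shuffle does not touch the fibre digit. Both orbits are in the zero fibre at time \<open>n\<close> if and only if
both turns are equal and their common value cancels the fibre digit, which is a fair coin.\<close>

lemma prob_joint_return:
  "D.prob {x\<in>space digit_measure. rot n x \<in> zero_fibre \<and> conj_by shuffle rot n x \<in> zero_fibre}
     = D.prob {x\<in>space digit_measure. turns n x = turns n (shuffle x)} / 2"
proof -
  let ?E = "{x\<in>space digit_measure. turns n x = turns n (shuffle x)}"
  have tm: "(\<lambda>x. turns n (shuffle x)) \<in> digit_measure \<rightarrow>\<^sub>M count_space UNIV"
    by (rule measurable_compose[OF shuffle_measurable turns_measurable])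
  have "Measurable.pred digit_measure (\<lambda>x. (turns n x = 0 \<and> turns n (shuffle x) = 0) \<or> (turns n x = 1 \<and> turns n (shuffle x) = 1))"
    using tm by measurable
  then have "Measurable.pred digit_measure (\<lambda>x. turns n x = turns n (shuffle x))"
    by (rule measurable_cong[THEN iffD1, rotated]) (metis turns_cases)
  then have E: "?E \<in> D.events" by measurable
  have "{x\<in>space digit_measure. rot n x \<in> zero_fibre \<and> conj_by shuffle rot n x \<in> zero_fibre}
      = {x\<in>?E. (digit x 0 = 0) = (turns n x = 0)}"
  proof (rule Set.set_eqI)
    fix x
    show "x \<in> {x\<in>space digit_measure. rot n x \<in> zero_fibre \<and> conj_by shuffle rot n x \<in> zero_fibre}
        \<longleftrightarrow> x \<in> {x\<in>?E. (digit x 0 = 0) = (turns n x = 0)}"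
    proof (cases "x \<in> space digit_measure")
      case True
      have "digit (conj_by shuffle rot n x) 0 = (digit x 0 + turns n (shuffle x)) mod 2"
        using True by (simp add: conj_by_def digit_shuffle digit_rot rot_space)
      then show ?thesis
        using True digit0_cases[OF True] turns_cases[of n x] turns_cases[of n "shuffle x"]
        by (auto simp: zero_fibre_def digit_rot rot_space shuffle_space conj_by_def)
    qed simp
  qed
  moreover have "D.prob {x\<in>?E. (digit x 0 = 0) = (turns n x = 0)} = D.prob ?E / 2"
  proof (rule prob_half[OF E])
    have "{x\<in>space digit_measure. (flip x \<in> ?E) \<noteq> (x \<in> ?E)} = {}"
      using turns_flip turns_shuffle_flip flip_space by auto
    then show "D.prob {x\<in>space digit_measure. (flip x \<in> ?E) \<noteq> (x \<in> ?E)} = 0" by (simp only: measure_empty)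
  qed (simp_all add: turns_flip)
  ultimately show ?thesis by simp
qed

lemma integral_double_average:
  assumes m: "m = c * d"
  shows "(\<integral>x. double_average digit_measure (rot d) (conj_by shuffle rot c) c d zero_fibre N x \<partial>digit_measure)
     = (1 / real N) * (\<Sum>n<N. D.prob {x\<in>space digit_measure. turns (m * int n) x = turns (m * int n) (shuffle x)} / 2)"
proof -
  define J where "J n = {x\<in>space digit_measure. rot (m * int n) x \<in> zero_fibre \<and> conj_by shuffle rot (m * int n) x \<in> zero_fibre}" for n
  have J: "J n \<in> D.events" for n
  proof -
    have "J n = (rot (m * int n) -` zero_fibre \<inter> space digit_measure) \<inter> (conj_by shuffle rot (m * int n) -` zero_fibre \<inter> space digit_measure)"
      by (auto simp: J_def)
    also have "\<dots> \<in> D.events"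
      by (intro sets.Int measurable_sets[OF rot_measurable] zero_fibre_measurable
          measurable_sets[OF mpt_measurable[OF act_mpt[OF conj_action]]])
    finally show ?thesis .
  qed
  have "(\<integral>x. double_average digit_measure (rot d) (conj_by shuffle rot c) c d zero_fibre N x \<partial>digit_measure)
      = (\<integral>x. (1 / real N) * (\<Sum>n<N. indicator (J n) x) \<partial>digit_measure)"
  proof (rule Bochner_Integration.integral_cong[OF refl])
    fix x assume x: "x \<in> space digit_measure"
    have it: "int_iterate digit_measure (rot d) (c * int n) x = rot (m * int n) x"
      "int_iterate digit_measure (conj_by shuffle rot c) (d * int n) x = conj_by shuffle rot (m * int n) x" for n
      using act_int_iterate[OF int_action_rot x, of d "c * int n"]
        act_int_iterate[OF conj_action x, of c "d * int n"] by (simp_all add: m mult_ac)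
    have "indicator zero_fibre (rot (m * int n) x) * indicator zero_fibre (conj_by shuffle rot (m * int n) x)
        = (indicator (J n) x :: real)" for n
      using x by (simp add: J_def indicator_def)
    then show "double_average digit_measure (rot d) (conj_by shuffle rot c) c d zero_fibre N x
        = (1 / real N) * (\<Sum>n<N. indicator (J n) x)"
      by (simp only: double_average_def it)
  qed
  also have "\<dots> = (1 / real N) * (\<Sum>n<N. D.prob (J n))"
    using J by (simp add: D.emeasure_eq_measure)
  finally show ?thesis unfolding J_def prob_joint_return .
qed

lemma integral_double_average_at_period:
  assumes m: "m = c * d"
  defines "I \<equiv> (\<lambda>N. \<integral>x. double_average digit_measure (rot d) (conj_by shuffle rot c) c d zero_fibre N x \<partial>digit_measure)"
  shows "even k \<Longrightarrow> 7 / 16 \<le> I (nat (period k))" and "odd k \<Longrightarrow> I (nat (period k)) \<le> 1 / 16"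
proof -
  let ?E = "\<lambda>n. {x\<in>space digit_measure. turns (m * n) x = turns (m * n) (shuffle x)}"
  let ?N = "real_of_int (period k)"
  have N: "?N > 0" using period_pos by simp
  have "I (nat (period k)) = (1 / ?N) * (\<Sum>n<nat (period k). D.prob (?E (int n)) / 2)"
    unfolding I_def integral_double_average[OF m] using period_pos[of k] by simp
  also have "(\<Sum>n<nat (period k). D.prob (?E (int n)) / 2) = (\<Sum>n\<in>{0..<period k}. D.prob (?E n) / 2)"
    using period_pos[of k] by (intro sum_int_nat[of _ "\<lambda>n. D.prob (?E n) / 2"]) simp
  also have "\<dots> = (\<Sum>n\<in>{0..<period k}. D.prob (?E n)) / 2" by (simp add: sum_divide_distrib)
  finally have I: "I (nat (period k)) = (\<Sum>n\<in>{0..<period k}. D.prob (?E n)) / (2 * ?N)" by simp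
  show "I (nat (period k)) \<le> 1 / 16" if "odd k"
  proof -
    have "(\<Sum>n\<in>{0..<period k}. D.prob (?E n)) \<le> ?N * (1 / 8)"
      using sum_prob_wrong_parity[of k] that by simp
    then show ?thesis unfolding I using N by (simp add: field_simps)
  qed
  show "7 / 16 \<le> I (nat (period k))" if "even k"
  proof -
    have E: "?E n \<in> D.events" for n
    proof -
      have "?E n = space digit_measure - {x\<in>space digit_measure. (turns (m * n) x = turns (m * n) (shuffle x)) \<noteq> True}" by auto
      have tm: "(\<lambda>x. turns (m * n) (shuffle x)) \<in> digit_measure \<rightarrow>\<^sub>M count_space UNIV"
        by (rule measurable_compose[OF shuffle_measurable turns_measurable])
      then have "(\<lambda>x. turns (m * n) x - turns (m * n) (shuffle x)) \<in> digit_measure \<rightarrow>\<^sub>M count_space UNIV"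
        by measurable
      then have "{x\<in>space digit_measure. turns (m * n) x - turns (m * n) (shuffle x) = 0} \<in> D.events" by measurable
      then show ?thesis by simp
    qed
    have "D.prob {x\<in>space digit_measure. turns (m * n) x \<noteq> turns (m * n) (shuffle x)} = 1 - D.prob (?E n)" for n
    proof -
      have "{x\<in>space digit_measure. turns (m * n) x \<noteq> turns (m * n) (shuffle x)} = space digit_measure - ?E n" by auto
      then show ?thesis using D.prob_compl[OF E] by simp
    qed
    then have "(\<Sum>n\<in>{0..<period k}. 1 - D.prob (?E n)) \<le> ?N * (1 / 8)"
      using sum_prob_wrong_parity[of k] that by simp
    then have "?N - (\<Sum>n\<in>{0..<period k}. D.prob (?E n)) \<le> ?N * (1 / 8)"
      using period_pos[of k] by (simp add: sum_subtractf)
    then have "?N * (7 / 8) \<le> (\<Sum>n\<in>{0..<period k}. D.prob (?E n))" by simp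
    then show ?thesis unfolding I using N by (simp add: field_simps)
  qed
qed

lemma double_average_not_convergent:
  assumes m: "m = c * d"
  shows "\<not> converges_in_L2 digit_measure (double_average digit_measure (rot d) (conj_by shuffle rot c) c d zero_fibre)"
proof
  let ?F = "double_average digit_measure (rot d) (conj_by shuffle rot c) c d zero_fibre"
  assume "converges_in_L2 digit_measure ?F"
  then have "convergent (\<lambda>N. \<integral>x. ?F N x \<partial>digit_measure)"
  proof (rule converges_in_L2_imp_convergent_integral[OF D.prob_space_axioms])
    fix N
    have "(\<lambda>x. (1 / real N) * (\<Sum>n<N. indicator zero_fibre (rot (d * (c * int n)) x) *
        indicator zero_fibre (conj_by shuffle rot (c * (d * int n)) x)) :: real) \<in> borel_measurable digit_measure"
      by (intro borel_measurable_times borel_measurable_const borel_measurable_sum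
          measurable_compose[OF rot_measurable borel_measurable_indicator[OF zero_fibre_measurable]]
          measurable_compose[OF mpt_measurable[OF act_mpt[OF conj_action]] borel_measurable_indicator[OF zero_fibre_measurable]])
    then show "?F N \<in> borel_measurable digit_measure"
      by (rule measurable_cong[THEN iffD1, rotated])
        (simp add: double_average_def act_int_iterate[OF int_action_rot] act_int_iterate[OF conj_action])
    fix x
    have "(\<Sum>n<N. indicator zero_fibre (int_iterate digit_measure (rot d) (c * int n) x) *
         indicator zero_fibre (int_iterate digit_measure (conj_by shuffle rot c) (d * int n) x) :: real) \<le> (\<Sum>n<N. 1)"
      by (intro sum_mono) (simp add: indicator_def)
    moreover have "0 \<le> (\<Sum>n<N. indicator zero_fibre (int_iterate digit_measure (rot d) (c * int n) x) *
         indicator zero_fibre (int_iterate digit_measure (conj_by shuffle rot c) (d * int n) x) :: real)"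
      by (intro sum_nonneg) simp
    ultimately show "\<bar>?F N x\<bar> \<le> 1"
      by (cases "N = 0") (simp_all add: double_average_def abs_mult)
  qed
  then obtain L where L: "(\<lambda>N. \<integral>x. ?F N x \<partial>digit_measure) \<longlonglongrightarrow> L" by (auto simp: convergent_def)
  have nat_period: "strict_mono (\<lambda>k. nat (period k))"
    using period_strict_mono period_pos by (auto simp: strict_mono_def less_imp_le)
  have "strict_mono (\<lambda>k. nat (period (2 * k)))" "strict_mono (\<lambda>k. nat (period (2 * k + 1)))"
    using nat_period by (auto simp: strict_mono_def period_pos)
  from LIMSEQ_subseq_LIMSEQ[OF L this(1)] LIMSEQ_subseq_LIMSEQ[OF L this(2)]
  have lim: "(\<lambda>k. \<integral>x. ?F (nat (period (2 * k))) x \<partial>digit_measure) \<longlonglongrightarrow> L"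
    "(\<lambda>k. \<integral>x. ?F (nat (period (2 * k + 1))) x \<partial>digit_measure) \<longlonglongrightarrow> L" by (simp_all add: o_def)
  have "7 / 16 \<le> L"
    by (rule LIMSEQ_le_const[OF lim(1)]) (use integral_double_average_at_period(1)[OF m] in auto)
  moreover have "L \<le> 1 / 16"
    by (rule LIMSEQ_le_const2[OF lim(2)]) (use integral_double_average_at_period(2)[OF m] in auto)
  ultimately show False by simp
qed

end

section \<open>Towers exist\<close>

text \<open>Each stage needs the product of the previous periods only, both for coprimality and for its slowness, so
the stages are chosen recursively along these products.\<close>

lemma tower_exists:
  assumes "m \<noteq> 0"
  shows "\<exists>P S z n0. tower P S z n0 m"
proof -
  define stage where "stage i Q d \<longleftrightarrow> (case d of (P, S, z, n0) \<Rightarrow>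
    swap_pattern P S z \<and> coprime P (m * Q) \<and>
    dens P (\<lambda>v. S (v + 1) \<noteq> S v) * real_of_int (\<bar>m\<bar> * Q) \<le> tol i \<and>
    (\<forall>v. dens P (\<lambda>n. S (n + z v) \<noteq> S n) \<le> tol i) \<and>
    dens P (\<lambda>v. S (v + z v) = S v) \<le> tol i \<and>
    dens P (\<lambda>v. S (v + n0) = S v) \<le> tol i)" for i Q and d :: "int \<times> (int \<Rightarrow> bool) \<times> (int \<Rightarrow> int) \<times> int"
  have "\<exists>d. stage i Q d" if Q: "Q > 0" for i Q
  proof -
    define \<kappa> where "\<kappa> = tol i / real_of_int (\<bar>m\<bar> * Q)"
    have mQ: "\<bar>m\<bar> * Q > 0" using assms Q by simp
    then have mQ1: "1 \<le> real_of_int (\<bar>m\<bar> * Q)" by linarith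
    have \<kappa>: "\<kappa> > 0" "\<kappa> \<le> tol i" "\<kappa> * real_of_int (\<bar>m\<bar> * Q) = tol i"
      using mQ mQ1 tol_pos[of i] by (auto simp: \<kappa>_def field_simps)
    obtain P S z n0 where *: "swap_pattern P S z" "coprime P (\<bar>m\<bar> * Q)"
      "dens P (\<lambda>v. S (v + 1) \<noteq> S v) \<le> \<kappa>" "\<forall>v. dens P (\<lambda>n. S (n + z v) \<noteq> S n) \<le> tol i"
      "dens P (\<lambda>v. S (v + z v) = S v) \<le> tol i" "dens P (\<lambda>v. S (v + n0) = S v) \<le> \<kappa>"
      using swap_pattern_exists[OF mQ tol_pos \<kappa>(1), of i] by blast
    have "dens P (\<lambda>v. S (v + 1) \<noteq> S v) * real_of_int (\<bar>m\<bar> * Q) \<le> tol i"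
      using mult_right_mono[OF *(3), of "real_of_int (\<bar>m\<bar> * Q)"] mQ1 \<kappa>(3) by linarith
    moreover have "coprime P (m * Q)" using *(2) by simp
    ultimately have "stage i Q (P, S, z, n0)" using * \<kappa>(2) by (auto simp: stage_def)
    then show ?thesis ..
  qed
  then have "\<forall>i Q. \<exists>d. Q > 0 \<longrightarrow> stage i Q d" by blast
  then obtain ch where ch: "\<And>i Q. Q > 0 \<Longrightarrow> stage i Q (ch i Q)" by metis
  define N where "N = rec_nat 1 (\<lambda>i Q. Q * fst (ch i Q))"
  have N0: "N 0 = 1" and NS: "N (Suc i) = N i * fst (ch i (N i))" for i by (simp_all add: N_def)
  have Npos: "N i > 0" for i
  proof (induction i)
    case (Suc i)
    then show ?case using ch[OF Suc, of i] by (auto simp: NS stage_def swap_pattern_def split: prod.splits)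
  qed (simp add: N0)
  define P where "P i = fst (ch i (N i))" for i
  define S where "S i = fst (snd (ch i (N i)))" for i
  define z where "z i = fst (snd (snd (ch i (N i))))" for i
  define n0 where "n0 i = snd (snd (snd (ch i (N i))))" for i
  have N: "N i = (\<Prod>j<i. P j)" for i by (induction i) (simp_all add: N0 NS P_def)
  have "stage i (\<Prod>j<i. P j) (P i, S i, z i, n0 i)" for i
    using ch[OF Npos, of i i] unfolding P_def S_def z_def n0_def N[unfolded P_def, symmetric] by simp
  then have "tower P S z n0 m"
    unfolding tower_def stage_def using assms by simp
  then show ?thesis by blast
qed

theorem proposition1p3:
  fixes d c :: int
  assumes "d \<noteq> 0" and "c \<noteq> 0"
  shows "\<exists>(M :: (nat \<Rightarrow> real) measure) T S A.
           standard_prob_space M \<and>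
           ergodic_mpt M T \<and> ergodic_mpt M S \<and>
           ks_entropy M T = 0 \<and> ks_entropy M S = 0 \<and>
           A \<in> sets M \<and> measure M A > 0 \<and>
           \<not> converges_in_L2 M (\<lambda>N. double_average M T S c d A N)"
proof -
  obtain P S z n0 where "tower P S z n0 (c * d)"
    using tower_exists[of "c * d"] assms by auto
  then interpret tower P S z n0 "c * d" .
  let ?T = "rot d" and ?S = "conj_by shuffle rot c"
  have dvd: "d dvd c * d" "c dvd c * d" by simp_all
  have T: "ergodic_mpt digit_measure ?T" "rigid digit_measure ?T" using ergodic_rot[OF dvd(1)] rigid_rot[OF dvd(1)] .
  have S: "ergodic_mpt digit_measure ?S" "rigid digit_measure ?S"
    by (rule conj_ergodic_mpt[OF int_action_rot mpt_shuffle shuffle_shuffle ergodic_rot[OF dvd(2)]], assumption,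
        rule conj_rigid[OF int_action_rot mpt_shuffle shuffle_shuffle rigid_rot[OF dvd(2)]], assumption)
  have "ks_entropy digit_measure ?T = 0" "ks_entropy digit_measure ?S = 0"
    using T S by (auto intro!: D.ks_entropy_rigid simp: ergodic_mpt_def)
  then show ?thesis
    using T S standard_prob_space_digit_measure zero_fibre_measurable prob_zero_fibre double_average_not_convergent[OF refl]
    by (intro exI[of _ digit_measure] exI[of _ ?T] exI[of _ ?S] exI[of _ zero_fibre]) auto
qed

end
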